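(* Let $k$ be an algebraically closed field of characteristic $0$ and let $C$ be a genus 2 curve over $k$ with a degree 4 degenerate elliptic subcover. Then at least one of the following holds. (1) $C$ is isomorphic to the curve $$y^2=\left(\tfrac{1-b}{3}+\tfrac{2}{3}(1-b)x+x^2\right)\left(\tfrac{1}{12}(b-4)b+\tfrac13(b-4)x+x^2\right)\left(b-\tfrac23(b+2)x+x^2\right),$$ where $$b=\frac{2\alpha+\sqrt{429\alpha^2+60123\alpha+\beta}}{2\alpha},\qquad \alpha=\sqrt[3]{2837051+9408\,i\sqrt5},\qquad \beta=8511153+28224\,i\sqrt5 .$$ (2) $J_2(C)\neq 0$ and the absolute invariants $i_1,i_2,i_3$ of $C$ satisfy the two equations $$\begin{aligned}&3652054494822999-312800728170302145\,i_1-247728254774362875\,i_1^2+3039113062253125\,i_1^3\\&\quad-522534367747902600\,i_2-28017734537115000\,i_1i_2-238234372300000\,i_2^2=0\end{aligned}$$ and $$\begin{aligned}&1158391804615233525\,i_1-17653298856896250\,i_1^2+100894442906250\,i_1^3-256292578125\,i_1^4+244140625\,i_1^5\\&\quad-323890167989102732668800000\,i_3-14879672225288904960000000\,i_1i_3-40609431102258000000000\,i_1^2i_3\\&\quad-16677181699666569-347405361918358396861440000000000\,i_3^2=0.\end{aligned}$$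
   Context: Curves are smooth and projective. Degree 4 degenerate elliptic subcover: let $\psi:C\to E$ be a degree 4 covering of an elliptic curve $E$ by a genus 2 curve $C$, let $w$ be the hyperelliptic involution of $C$, and choose the origin of $E$ so that $\psi\circ w=v\circ\psi$, where $v(P)=-P$. Let $\pi_C:C\to\mathbb P^1$ and $\pi_E:E\to\mathbb P^1$ be the degree 2 quotient maps by $w$ and $v$. There is an induced degree 4 map $\phi:\mathbb P^1\to\mathbb P^1$ with $\phi\circ\pi_C=\pi_E\circ\psi$. The covering $\psi$ is called degenerate if $\phi$ has ramification $(2,2,2,4)$: its branch points are exactly the four points of $\pi_E(E[2])$; over three of them the fiber of $\phi$ consists of one point of ramification index 2 and two unramified points, and over the fourth the fiber is a single point of ramification index 4. $C$ has a degree 4 degenerate elliptic subcover if such a $\psi$ exists. Invariants: for $C: y^2=f(x)$ with $f(x)=a_6x^6+\dots+a_0=a_6\prod_{i=1}^6(x-\alpha_i)$ (written with $a_6\ne0$), and $(ij)=\alpha_i-\alpha_j$, the (Igusa) invariants $J_2,J_4,J_6,J_{10}$ are $$J_2=a_6^2\sum_{15}(12)^2(34)^2(56)^2,\qquad J_4=a_6^4\sum_{10}(12)^2(23)^2(31)^2(45)^2(56)^2(64)^2,$$ $$J_6=a_6^6\sum_{60}(12)^2(23)^2(31)^2(45)^2(56)^2(64)^2(14)^2(25)^2(36)^2,\qquad J_{10}=a_6^{10}\prod_{i<j}(ij)^2,$$ where each sum runs over the distinct expressions obtained by permuting the indices (their number is the subscript). Thus $J_2=-240a_0a_6+40a_1a_5-16a_2a_4+6a_3^2$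 and $J_{10}$ is the discriminant of $f$. When $J_2\neq0$ the absolute invariants are $$i_1=144\frac{J_4}{J_2^2},\qquad i_2=-1728\frac{J_2J_4-3J_6}{J_2^3},\qquad i_3=486\frac{J_{10}}{J_2^5}.$$ In (1), $i=\sqrt{-1}$, an embedding $\overline{\mathbb Q}\subset k$ is fixed, and a choice of the cube root and square root is made. *)

theory Defs
  imports
    "HOL-Computational_Algebra.Computational_Algebra"
    "HOL-Combinatorics.Permutations"
begin

text \<open>
  A smooth projective curve over an algebraically closed field $k$ is represented by its function
  field. Curves and nonconstant morphisms form a category dual to that of function fields
  of one variable over $k$ and $k$-embeddings. So a curve is given by a field \<open>'c\<close> together
  with the inclusion of the constants \<open>'k \<Rightarrow> 'c\<close>, a morphism $C \to E$ by its
  comorphism $k(E) \to k(C)$ (so that composition is reversed), and a closed point by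
  its normalised discrete valuation.
\<close>

subsection \<open>Curves, morphisms, points\<close>

definition field_embedding :: "('a::field \<Rightarrow> 'b::field) \<Rightarrow> bool" where
  "field_embedding h \<longleftrightarrow>
     h 1 = 1 \<and> (\<forall>x y. h (x + y) = h x + h y) \<and> (\<forall>x y. h (x * y) = h x * h y)"

definition morphism ::
    "('k::field \<Rightarrow> 'c::field) \<Rightarrow> ('k \<Rightarrow> 'e::field) \<Rightarrow> ('e \<Rightarrow> 'c) \<Rightarrow> bool" where
  "morphism C E h \<longleftrightarrow> field_embedding h \<and> (\<forall>a. h (E a) = C a)"

definition morphism_degree :: "('e::field \<Rightarrow> 'c::field) \<Rightarrow> nat" where
  "morphism_degree h = vector_space.dim (\<lambda>a x. h a * x) UNIV"

definition P1 :: "'k::field \<Rightarrow> 'k poly fract" where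
  "P1 a = to_fract [:a:]"

definition curve :: "('k::field \<Rightarrow> 'c::field) \<Rightarrow> bool" where
  "curve C \<longleftrightarrow> field_embedding C \<and>
     (\<exists>h. morphism C P1 h \<and> (\<exists>B. finite B \<and> module.span (\<lambda>a x. h a * x) B = UNIV))"

text \<open>
  The value at \<open>0\<close> would be infinite; it is set to \<open>0\<close> so that distinct functions are
  distinct points.
\<close>

definition point :: "('k::field \<Rightarrow> 'c::field) \<Rightarrow> ('c \<Rightarrow> int) \<Rightarrow> bool" where
  "point C P \<longleftrightarrow>
     P 0 = 0 \<and>
     (\<forall>x y. x \<noteq> 0 \<longrightarrow> y \<noteq> 0 \<longrightarrow> P (x * y) = P x + P y) \<and>
     (\<forall>x y. x \<noteq> 0 \<longrightarrow> y \<noteq> 0 \<longrightarrow> x + y \<noteq> 0 \<longrightarrow> min (P x) (P y) \<le> P (x + y)) \<and>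
     (\<forall>a. P (C a) = 0) \<and>
     (\<exists>x. P x = 1)"

text \<open>The point \<open>P\<close> is mapped to \<open>Q\<close> with ramification index \<open>e\<close>.\<close>

definition lies_over :: "('e \<Rightarrow> 'c) \<Rightarrow> nat \<Rightarrow> ('c \<Rightarrow> int) \<Rightarrow> ('e \<Rightarrow> int) \<Rightarrow> bool" where
  "lies_over h e P Q \<longleftrightarrow> 0 < e \<and> (\<forall>f. P (h f) = int e * Q f)"

definition fiber :: "('k::field \<Rightarrow> 'c::field) \<Rightarrow> ('e \<Rightarrow> 'c) \<Rightarrow> ('e \<Rightarrow> int) \<Rightarrow> ('c \<Rightarrow> int) set" where
  "fiber C h Q = {P. point C P \<and> (\<exists>e. lies_over h e P Q)}"

definition ramification_index :: "('e \<Rightarrow> 'c) \<Rightarrow> ('c \<Rightarrow> int) \<Rightarrow> ('e \<Rightarrow> int) \<Rightarrow> nat" where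
  "ramification_index h P Q = (THE e. lies_over h e P Q)"

definition ramification_type ::
    "('k::field \<Rightarrow> 'c::field) \<Rightarrow> ('e \<Rightarrow> 'c) \<Rightarrow> ('e \<Rightarrow> int) \<Rightarrow> nat multiset" where
  "ramification_type C h Q =
     image_mset (\<lambda>P. ramification_index h P Q) (mset_set (fiber C h Q))"

definition branch_points ::
    "('k::field \<Rightarrow> 'c::field) \<Rightarrow> ('k \<Rightarrow> 'e::field) \<Rightarrow> ('e \<Rightarrow> 'c) \<Rightarrow> ('e \<Rightarrow> int) set" where
  "branch_points C E h =
     {Q. point E Q \<and> (\<exists>P \<in> fiber C h Q. ramification_index h P Q > 1)}"

subsection \<open>Divisors and genus\<close>

definition divisor :: "('k::field \<Rightarrow> 'c::field) \<Rightarrow> (('c \<Rightarrow> int) \<Rightarrow> int) \<Rightarrow> bool" where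
  "divisor C D \<longleftrightarrow> finite {P. D P \<noteq> 0} \<and> (\<forall>P. D P \<noteq> 0 \<longrightarrow> point C P)"

text \<open>All residue fields equal $k$, which is algebraically closed, so points have degree 1.\<close>

definition divisor_degree :: "(('c \<Rightarrow> int) \<Rightarrow> int) \<Rightarrow> int" where
  "divisor_degree D = (\<Sum>P | D P \<noteq> 0. D P)"

definition riemann_roch_space ::
    "('k::field \<Rightarrow> 'c::field) \<Rightarrow> (('c \<Rightarrow> int) \<Rightarrow> int) \<Rightarrow> 'c set" where
  "riemann_roch_space C D = {f. f = 0 \<or> (\<forall>P. point C P \<longrightarrow> 0 \<le> P f + D P)}"

definition divisor_dim :: "('k::field \<Rightarrow> 'c::field) \<Rightarrow> (('c \<Rightarrow> int) \<Rightarrow> int) \<Rightarrow> nat" where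
  "divisor_dim C D = vector_space.dim (\<lambda>a x. C a * x) (riemann_roch_space C D)"

text \<open>Riemann's theorem: the genus is the maximum of $\deg D - \ell(D) + 1$.\<close>

definition has_genus :: "('k::field \<Rightarrow> 'c::field) \<Rightarrow> nat \<Rightarrow> bool" where
  "has_genus C g \<longleftrightarrow>
     (\<forall>D. divisor C D \<longrightarrow> divisor_degree D - int (divisor_dim C D) + 1 \<le> int g) \<and>
     (\<exists>D. divisor C D \<and> divisor_degree D - int (divisor_dim C D) + 1 = int g)"

definition lin_equiv ::
    "('k::field \<Rightarrow> 'c::field) \<Rightarrow> (('c \<Rightarrow> int) \<Rightarrow> int) \<Rightarrow> (('c \<Rightarrow> int) \<Rightarrow> int) \<Rightarrow> bool" where
  "lin_equiv C D D' \<longleftrightarrow> (\<exists>f. f \<noteq> 0 \<and> (\<forall>R. point C R \<longrightarrow> D R - D' R = R f))"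

definition point_divisor :: "('c \<Rightarrow> int) \<Rightarrow> ('c \<Rightarrow> int) \<Rightarrow> int" where
  "point_divisor P R = (if R = P then 1 else 0)"

subsection \<open>Elliptic curves\<close>

text \<open>
  On a curve \<open>E\<close> of genus 1 with origin \<open>Z\<close>, the point \<open>R\<close> is the sum of \<open>P\<close> and \<open>Q\<close>
  in the group law iff $P + Q \sim R + Z$ as divisors.
\<close>

definition point_sum ::
    "('k::field \<Rightarrow> 'e::field) \<Rightarrow> ('e \<Rightarrow> int) \<Rightarrow> ('e \<Rightarrow> int) \<Rightarrow> ('e \<Rightarrow> int) \<Rightarrow> ('e \<Rightarrow> int) \<Rightarrow> bool" where
  "point_sum E Z P Q R \<longleftrightarrow>
     lin_equiv E (\<lambda>S. point_divisor P S + point_divisor Q S)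
                 (\<lambda>S. point_divisor R S + point_divisor Z S)"

definition two_torsion :: "('k::field \<Rightarrow> 'e::field) \<Rightarrow> ('e \<Rightarrow> int) \<Rightarrow> ('e \<Rightarrow> int) set" where
  "two_torsion E Z = {P. point E P \<and> point_sum E Z P P Z}"

text \<open>
  The automorphism $P \mapsto -P$. An automorphism with comorphism \<open>v\<close> takes \<open>P\<close> to \<open>P \<circ> v\<close>.
\<close>

definition negation ::
    "('k::field \<Rightarrow> 'e::field) \<Rightarrow> ('e \<Rightarrow> int) \<Rightarrow> ('e \<Rightarrow> 'e) \<Rightarrow> bool" where
  "negation E Z v \<longleftrightarrow>
     morphism E E v \<and> bij v \<and> (\<forall>P. point E P \<longrightarrow> point_sum E Z P (P \<circ> v) Z)"

subsection \<open>Degenerate coverings\<close>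

text \<open>The map \<open>h\<close> is a degree 2 quotient map to the projective line by the involution \<open>w\<close>.\<close>

definition quotient_to_P1 ::
    "('k::field \<Rightarrow> 'c::field) \<Rightarrow> ('c \<Rightarrow> 'c) \<Rightarrow> ('k poly fract \<Rightarrow> 'c) \<Rightarrow> bool" where
  "quotient_to_P1 C w h \<longleftrightarrow>
     morphism C P1 h \<and> morphism_degree h = 2 \<and> range h = {z. w z = z}"

definition hyperelliptic_involution ::
    "('k::field \<Rightarrow> 'c::field) \<Rightarrow> ('c \<Rightarrow> 'c) \<Rightarrow> bool" where
  "hyperelliptic_involution C w \<longleftrightarrow>
     morphism C C w \<and> w \<circ> w = id \<and> w \<noteq> id \<and> (\<exists>h. quotient_to_P1 C w h)"

definition degenerate_ramification ::
    "('k::field poly fract \<Rightarrow> 'k poly fract) \<Rightarrow> ('k poly fract \<Rightarrow> int) set \<Rightarrow> bool" where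
  "degenerate_ramification phi B \<longleftrightarrow>
     branch_points P1 P1 phi = B \<and> card B = 4 \<and>
     (\<exists>Q0 \<in> B. ramification_type P1 phi Q0 = {#4#} \<and>
        (\<forall>Q \<in> B - {Q0}. ramification_type P1 phi Q = {#2, 1, 1#}))"

definition degenerate ::
    "('k::field \<Rightarrow> 'c::field) \<Rightarrow> ('k \<Rightarrow> 'e::field) \<Rightarrow> ('e \<Rightarrow> 'c) \<Rightarrow> bool" where
  "degenerate C E psi \<longleftrightarrow>
     (\<exists>w Z v piC piE phi.
        hyperelliptic_involution C w \<and> point E Z \<and> negation E Z v \<and>
        w \<circ> psi = psi \<circ> v \<and>
        quotient_to_P1 C w piC \<and> quotient_to_P1 E v piE \<and>
        morphism P1 P1 phi \<and> morphism_degree phi = 4 \<and>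
        piC \<circ> phi = psi \<circ> piE \<and>
        degenerate_ramification phi
          {Q. point P1 Q \<and> (\<exists>P \<in> two_torsion E Z. P \<in> fiber E piE Q)})"

definition degree_4_degenerate_elliptic_subcover ::
    "('k::field \<Rightarrow> 'c::field) \<Rightarrow> ('k \<Rightarrow> 'e::field) \<Rightarrow> ('e \<Rightarrow> 'c) \<Rightarrow> bool" where
  "degree_4_degenerate_elliptic_subcover C E psi \<longleftrightarrow>
     curve E \<and> has_genus E 1 \<and> morphism C E psi \<and> morphism_degree psi = 4 \<and>
     degenerate C E psi"

subsection \<open>Equations and invariants of genus 2 curves\<close>

text \<open>
  \<open>C\<close> is isomorphic to the smooth projective curve with equation $y^2 = f(x)$, that is,
  $k(C) \cong k(x)[y]/(y^2 - f(x))$. The embedding \<open>h\<close> of $k(x)$ takes the indeterminate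
  to the coordinate function $x$.
\<close>

definition isomorphic_to_hyperelliptic :: "('k::field \<Rightarrow> 'c::field) \<Rightarrow> 'k poly \<Rightarrow> bool" where
  "isomorphic_to_hyperelliptic C f \<longleftrightarrow>
     (\<exists>h y. morphism C P1 h \<and> y \<notin> range h \<and> y\<^sup>2 = h (to_fract f) \<and>
        (\<forall>z. \<exists>a b. z = h a + h b * y))"

definition sextic :: "'k::field \<Rightarrow> (nat \<Rightarrow> 'k) \<Rightarrow> 'k poly" where
  "sextic a r = smult a (\<Prod>i = 1..6. [:- r i, 1:])"

definition sextic_model :: "('k::field \<Rightarrow> 'c::field) \<Rightarrow> 'k \<Rightarrow> (nat \<Rightarrow> 'k) \<Rightarrow> bool" where
  "sextic_model C a r \<longleftrightarrow>
     a \<noteq> 0 \<and> inj_on r {1..6} \<and> isomorphic_to_hyperelliptic C (sextic a r)"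

text \<open>
  A product of factors $(ij)^2$ is encoded by the set of its index pairs $\{i,j\}$; the
  set \<open>index_orbit\<close> collects the distinct ones obtained by permuting the indices.
\<close>

definition square_diff :: "(nat \<Rightarrow> 'k::field) \<Rightarrow> nat set \<Rightarrow> 'k" where
  "square_diff r e = (r (Min e) - r (Max e))\<^sup>2"

definition index_orbit :: "nat set set \<Rightarrow> nat set set set" where
  "index_orbit S = {(\<lambda>e. p ` e) ` S | p. p permutes {1..6}}"

definition orbit_sum :: "(nat \<Rightarrow> 'k::field) \<Rightarrow> nat set set \<Rightarrow> 'k" where
  "orbit_sum r S = (\<Sum>T \<in> index_orbit S. \<Prod>e \<in> T. square_diff r e)"

definition J2 :: "'k::field \<Rightarrow> (nat \<Rightarrow> 'k) \<Rightarrow> 'k" where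
  "J2 a r = a ^ 2 * orbit_sum r {{1,2}, {3,4}, {5,6}}"

definition J4 :: "'k::field \<Rightarrow> (nat \<Rightarrow> 'k) \<Rightarrow> 'k" where
  "J4 a r = a ^ 4 * orbit_sum r {{1,2}, {2,3}, {3,1}, {4,5}, {5,6}, {6,4}}"

definition J6 :: "'k::field \<Rightarrow> (nat \<Rightarrow> 'k) \<Rightarrow> 'k" where
  "J6 a r = a ^ 6 *
     orbit_sum r {{1,2}, {2,3}, {3,1}, {4,5}, {5,6}, {6,4}, {1,4}, {2,5}, {3,6}}"

definition J10 :: "'k::field \<Rightarrow> (nat \<Rightarrow> 'k) \<Rightarrow> 'k" where
  "J10 a r = a ^ 10 * (\<Prod>j = 1..6. \<Prod>i = 1..<j. (r i - r j)\<^sup>2)"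

definition i1 :: "'k::field \<Rightarrow> (nat \<Rightarrow> 'k) \<Rightarrow> 'k" where
  "i1 a r = 144 * J4 a r / (J2 a r) ^ 2"

definition i2 :: "'k::field \<Rightarrow> (nat \<Rightarrow> 'k) \<Rightarrow> 'k" where
  "i2 a r = - 1728 * (J2 a r * J4 a r - 3 * J6 a r) / (J2 a r) ^ 3"

definition i3 :: "'k::field \<Rightarrow> (nat \<Rightarrow> 'k) \<Rightarrow> 'k" where
  "i3 a r = 486 * J10 a r / (J2 a r) ^ 5"

end

theory Submission
  imports Defs
begin

text \<open>
  Put the totally ramified point of $\phi$ and its image at infinity. Then $\phi$ is a quartic polynomial $U$
  with three critical points, $E$ is branched over infinity and the critical values $q_i$, and $C$ has
  the equation $y^2 = g_1 g_2 g_3$ where $U - q_i = L (x - c_i)^2 g_i$. Up to affine coordinate changes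
  these sextics form a one-parameter family. As the hyperelliptic map of $C$ is unique up
  to Moebius transformations, every sextic model of $C$ arises from this one by a Moebius
  transformation, under which $J_2, J_4, J_6, J_{10}$ are covariant. For critical points of sum 0 they are
  polynomials in $A = e^3$ and $B = f^2$, where $e, f$ are the elementary symmetric functions of the critical
  points: $J_2 = -40 (20 A + 147 B)$ and so on. If $J_2 \neq 0$, this gives the two equations.
  If $J_2 = 0$, the critical points are determined up to similarity, and this is the
  curve of case (1), which has the critical points $0, 1, b/2$.
\<close>

section \<open>Covariance of the invariants\<close>

text \<open>Why \<open>E\<close> is branched over exactly these four points: write its function
  field as k(x, t) with t^2 a product of distinct factors x - a. Every root of this product
  ramifies, and the point above it is fixed by negation, hence 2-torsion; together with infinity
  this allows at most three roots. With fewer than three, \<open>E\<close> would be rational, every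
  point would be 2-torsion, and the image of the 2-torsion would be infinite instead of having four
  points. Square roots of the centred critical points are adjoined because the differences of roots
  of the sextic then split into linear factors. The four invariants are homogeneous of degrees 1, 2,
  3, 5 in A and B. So i_1, i_2, i_3 depend only on A : B and trace a rational curve; the two
  equations are its projections to (i_1, i_2) and (i_1, i_3). J_2 = 0 becomes an equation of degree
  6 for the ratio \<mu> in which one critical point divides the other two. It is a cubic in (2 \<mu>
  - 1)^2, and Cardano's formula for it produces alpha. Its roots are the ratios of one triple of
  points in its six orderings, so every choice of the radicals serves.\<close>

lemma index_orbit_closed:
  assumes "\<sigma> permutes {1..6}" "T \<in> index_orbit S"
  shows "(\<lambda>e. \<sigma> ` e) ` T \<in> index_orbit S"
proof -
  obtain p where p: "p permutes {1..6}" "T = (\<lambda>e. p ` e) ` S"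
    using assms(2) by (auto simp: index_orbit_def)
  have "(\<lambda>e. \<sigma> ` e) ` T = (\<lambda>e. (\<sigma> \<circ> p) ` e) ` S" by (auto simp: p(2) image_image image_comp)
  moreover have "\<sigma> \<circ> p permutes {1..6}" using p(1) assms(1) by (rule permutes_compose)
  ultimately show ?thesis unfolding index_orbit_def by blast
qed

text \<open>Relabelling only permutes the terms. This is needed because a Moebius transformation
  matches two numbered root sets only up to a permutation.\<close>

lemma orbit_sum_permute:
  assumes "\<sigma> permutes {1..6}"
  shows "orbit_sum r S = (\<Sum>T \<in> index_orbit S. \<Prod>e \<in> T. square_diff r (\<sigma> ` e))"
proof -
  let ?F = "\<lambda>T. (\<lambda>e. \<sigma> ` e) ` T" and ?G = "\<lambda>T. (\<lambda>e. inv \<sigma> ` e) ` T"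
  have i: "inv \<sigma> permutes {1..6}" by (rule permutes_inv[OF assms])
  have id: "\<sigma> ` inv \<sigma> ` e = e" "inv \<sigma> ` \<sigma> ` e = e" for e
    using assms by (simp_all add: image_comp permutes_inv_o)
  have "bij_betw ?F (index_orbit S) (index_orbit S)"
    by (rule bij_betwI[where g = ?G])
      (use index_orbit_closed[OF assms] index_orbit_closed[OF i] in \<open>auto simp: image_image permutes_inverses[OF assms]\<close>)
  then have "orbit_sum r S = (\<Sum>T \<in> index_orbit S. \<Prod>e \<in> ?F T. square_diff r e)"
    unfolding orbit_sum_def by (rule sum.reindex_bij_betw[symmetric])
  moreover have "(\<Prod>e \<in> ?F T. square_diff r e) = (\<Prod>e \<in> T. square_diff r (\<sigma> ` e))" for T
  proof -
    have "inj_on (\<lambda>e. \<sigma> ` e) T" by (rule inj_onI) (metis id(2))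
    then show ?thesis by (simp add: prod.reindex)
  qed
  ultimately show ?thesis by simp
qed

text \<open>An m-regular graph on the six indices. The graphs behind J_2, J_4, J_6, J_10 are a
  perfect matching, two triangles, a prism and the complete graph, with m = 1, 2, 3, 5.\<close>

definition regular :: "nat \<Rightarrow> nat set set \<Rightarrow> bool" where
  "regular m S \<longleftrightarrow> finite S \<and> card S = 3 * m \<and> (\<forall>e \<in> S. e \<subseteq> {1..6} \<and> card e = 2) \<and>
     (\<forall>i \<in> {1..6}. card {e \<in> S. i \<in> e} = m)"

lemma regular_index_orbit:
  assumes "regular m S" "T \<in> index_orbit S"
  shows "regular m T"
proof -
  obtain p where p: "p permutes {1..6}" "T = (\<lambda>e. p ` e) ` S"
    using assms(2) by (auto simp: index_orbit_def)
  have inj: "inj p" using p(1) by (rule permutes_inj)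
  then have inj_im: "inj_on (\<lambda>e. p ` e) A" for A by (auto intro!: inj_onI simp: inj_image_eq_iff)
  have "card {e \<in> T. i \<in> e} = m" if "i \<in> {1..6}" for i
  proof -
    have "i \<in> p ` {1..6}" using that by (simp only: permutes_image[OF p(1)])
    then obtain j where j: "j \<in> {1..6}" "i = p j" by auto
    have "{e \<in> T. i \<in> e} = (\<lambda>e. p ` e) ` {e \<in> S. j \<in> e}"
      using inj by (auto simp: p(2) j(2) inj_eq)
    then show ?thesis using assms(1) j(1) by (simp add: card_image[OF inj_im] regular_def)
  qed
  moreover have "p ` e \<subseteq> {1..6}" if "e \<subseteq> {1..6}" for e
    using image_mono[OF that, of p] by (simp only: permutes_image[OF p(1)])
  moreover have "card (p ` e) = card e" for e
    by (rule card_image[OF inj_on_subset[OF inj subset_UNIV]])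
  ultimately show ?thesis
    using assms(1) unfolding regular_def by (auto simp: p(2) card_image[OF inj_im])
qed

lemma square_diff_pair: "i \<noteq> j \<Longrightarrow> square_diff r {i, j} = (r i - r j)\<^sup>2"
  by (cases "i < j") (auto simp: square_diff_def min_def max_def power2_commute)

text \<open>With \<open>D\<close> the determinant and u_i the denominator at r_i, a difference of
  transformed roots is D (r_i - r_j) / (u_i u_j). A regular graph with 3m edges uses every u_i
  exactly m times, so all terms of the sum acquire the same factor.\<close>

lemma orbit_sum_moebius:
  fixes r r' :: "nat \<Rightarrow> 'k::field"
  assumes \<sigma>: "\<sigma> permutes {1..6}" and S: "regular m S"
    and w: "\<And>i. i \<in> {1..6} \<Longrightarrow> q0 + q1 * r i \<noteq> 0 \<and> r' (\<sigma> i) = (p0 + p1 * r i) / (q0 + q1 * r i)"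
  shows "orbit_sum r' S = ((p1 * q0 - p0 * q1) ^ 6 / (\<Prod>i = 1..6. q0 + q1 * r i)\<^sup>2) ^ m * orbit_sum r S"
proof -
  define D where "D = p1 * q0 - p0 * q1"
  define u where "u i = q0 + q1 * r i" for i
  define W where "W = (\<Prod>i = 1..6. u i)"
  have sd: "square_diff r' (\<sigma> ` e) = D\<^sup>2 * square_diff r e / (\<Prod>i\<in>e. u i)\<^sup>2"
    if e: "e \<subseteq> {1..6}" "card e = 2" for e
  proof -
    obtain i j where ij: "e = {i, j}" "i \<noteq> j" using e(2) by (auto simp: card_2_iff)
    have "\<sigma> i \<noteq> \<sigma> j" using permutes_inj[OF \<sigma>] ij(2) by (auto dest: injD)
    moreover have u: "u i \<noteq> 0" "u j \<noteq> 0" using w e(1) ij by (auto simp: u_def)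
    moreover have "r' (\<sigma> i) = (p0 + p1 * r i) / u i" "r' (\<sigma> j) = (p0 + p1 * r j) / u j"
      using w e(1) ij by (auto simp: u_def)
    moreover have "(p0 + p1 * r i) / u i - (p0 + p1 * r j) / u j = D * (r i - r j) / (u i * u j)"
      using u by (simp add: D_def u_def diff_frac_eq) (simp add: algebra_simps)
    ultimately show ?thesis
      using ij by (simp add: square_diff_pair power_divide power_mult_distrib)
  qed
  have T: "(\<Prod>e \<in> T. square_diff r' (\<sigma> ` e)) = (D ^ 6 / W\<^sup>2) ^ m * (\<Prod>e \<in> T. square_diff r e)"
    if "T \<in> index_orbit S" for T
  proof -
    have reg: "regular m T" using regular_index_orbit[OF S that] .
    have "{i \<in> {1..6}. i \<in> e} = e" if "e \<in> T" for e
      using reg that unfolding regular_def by blast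
    \<comment> \<open>Double counting of the incidences between edges and vertices.\<close>
    then have "(\<Prod>e\<in>T. \<Prod>i\<in>e. u i) = (\<Prod>e\<in>T. \<Prod>i\<in>{i \<in> {1..6}. i \<in> e}. u i)"
      by (intro prod.cong refl) auto
    also have "\<dots> = (\<Prod>i = 1..6. \<Prod>e\<in>{e \<in> T. i \<in> e}. u i)"
      using reg by (intro prod.swap_restrict) (auto simp: regular_def)
    also have "\<dots> = (\<Prod>i = 1..6. u i ^ m)"
      using reg by (intro prod.cong refl) (simp add: regular_def)
    also have "\<dots> = W ^ m" by (simp add: W_def prod_power_distrib)
    finally have Wm: "(\<Prod>e\<in>T. \<Prod>i\<in>e. u i) = W ^ m" .
    have "(\<Prod>e \<in> T. square_diff r' (\<sigma> ` e)) = (\<Prod>e \<in> T. D\<^sup>2 * square_diff r e / (\<Prod>i\<in>e. u i)\<^sup>2)"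
      using reg sd by (intro prod.cong refl) (auto simp: regular_def)
    also have "\<dots> = (D\<^sup>2) ^ card T * (\<Prod>e \<in> T. square_diff r e) / (\<Prod>e\<in>T. \<Prod>i\<in>e. u i)\<^sup>2"
      by (simp add: prod_dividef prod.distrib prod_power_distrib)
    also have "\<dots> = (D ^ 6 / W\<^sup>2) ^ m * (\<Prod>e \<in> T. square_diff r e)"
      using reg by (simp add: Wm regular_def power_divide flip: power_mult) (simp add: mult.commute)
    finally show ?thesis .
  qed
  show ?thesis
    unfolding orbit_sum_permute[OF \<sigma>, of r'] D_def[symmetric] u_def[symmetric] W_def[symmetric]
    unfolding orbit_sum_def sum_distrib_left using T by (rule sum.cong[OF refl])
qed

section \<open>Enumeration of the index orbits\<close>

definition pairs6 :: "(nat \<times> nat) list" where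
  "pairs6 = [(1,2),(1,3),(1,4),(1,5),(1,6),(2,3),(2,4),(2,5),(2,6),(3,4),(3,5),(3,6),(4,5),(4,6),(5,6)]"

definition edges :: "(nat \<times> nat) list \<Rightarrow> nat set set" where
  "edges s = (\<lambda>(a, b). {a, b}) ` set s"

text \<open>The list \<open>l\<close> holds the images of 1, ..., 6; list positions count from 0,
  hence \<open>x - 1\<close>.\<close>

definition relabel :: "(nat \<times> nat) list \<Rightarrow> nat list \<Rightarrow> (nat \<times> nat) list" where
  "relabel s l = map (\<lambda>(x, y). (l ! (x - 1), l ! (y - 1))) s"

text \<open>
  A set of index pairs is coded by a bit mask. An explicit list of relabelings is the whole
  index orbit once its masks are closed under the transpositions \<open>(1 k)\<close>, which
  generate the symmetric group.
\<close>

fun bits :: "bool list \<Rightarrow> int" where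
  "bits [] = 0"
| "bits (b # bs) = (if b then 1 else 0) + 2 * bits bs"

definition code_of :: "(nat \<times> nat) list \<Rightarrow> int" where
  "code_of s = bits (map (\<lambda>(a, b). List.member s (a, b) \<or> List.member s (b, a)) pairs6)"

text \<open>A pair may be listed in either orientation. Distinctness after sorting the endpoints
  excludes listing an edge twice, so products over the list and over the edge set agree.\<close>

definition edge_list :: "(nat \<times> nat) list \<Rightarrow> bool" where
  "edge_list s \<longleftrightarrow> distinct (map (\<lambda>(a, b). (min a b, max a b)) s) \<and>
     list_all (\<lambda>(a, b). List.member pairs6 (a, b) \<or> List.member pairs6 (b, a)) s"

definition swap1 :: "nat \<Rightarrow> nat \<Rightarrow> nat" where
  "swap1 k i = (if i = 1 then k else if i = k then 1 else i)"

lemma bits_inj: "length bs = length cs \<Longrightarrow> bits bs = bits cs \<Longrightarrow> bs = cs"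
proof (induction bs cs rule: list_induct2)
  case (Cons b bs c cs)
  then have "(if b then 1 else 0) + 2 * bits bs = (if c then 1 else 0) + 2 * bits cs" by simp
  then have "b = c \<and> bits bs = bits cs" by (cases b; cases c; simp; presburger)
  then show ?case using Cons by simp
qed simp

lemma pairs6_card: "(a, b) \<in> set pairs6 \<Longrightarrow> {a, b} \<subseteq> {1..6} \<and> card {a, b} = 2"
  by (auto simp: pairs6_def)

lemma edge_in_pairs6:
  assumes "edge_list s" "e \<in> edges s"
  obtains a b where "(a, b) \<in> set pairs6" "e = {a, b}"
proof -
  obtain a b where ab: "(a, b) \<in> set s" "e = {a, b}" using assms(2) by (auto simp: edges_def)
  then have "(a, b) \<in> set pairs6 \<or> (b, a) \<in> set pairs6"
    using assms(1) by (auto simp: edge_list_def list_all_iff)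
  then show thesis using ab(2) that by (metis insert_commute)
qed

lemma edges_member: "{a, b} \<in> edges s \<longleftrightarrow> (a, b) \<in> set s \<or> (b, a) \<in> set s"
  by (force simp: edges_def doubleton_eq_iff)

lemma code_of_edges: "code_of s = bits (map (\<lambda>(a, b). {a, b} \<in> edges s) pairs6)"
  unfolding code_of_def edges_member by simp

text \<open>The mask records membership for each of the fifteen pairs, and \<open>edge_list\<close>
  guarantees that there are no other edges.\<close>

lemma edges_eqI:
  assumes "edge_list s" "edge_list t" "code_of s = code_of t"
  shows "edges s = edges t"
proof -
  have "map (\<lambda>(a, b). {a, b} \<in> edges s) pairs6 = map (\<lambda>(a, b). {a, b} \<in> edges t) pairs6"
    using assms(3) unfolding code_of_edges by (intro bits_inj) simp_all
  then have *: "{a, b} \<in> edges s \<longleftrightarrow> {a, b} \<in> edges t" if "(a, b) \<in> set pairs6" for a b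
    using that unfolding map_eq_conv by fast
  show ?thesis
  proof (intro equalityI subsetI)
    fix e assume e: "e \<in> edges s"
    then obtain a b where "(a, b) \<in> set pairs6" "e = {a, b}" by (rule edge_in_pairs6[OF assms(1)])
    then show "e \<in> edges t" using e *[of a b] by simp
  next
    fix e assume e: "e \<in> edges t"
    then obtain a b where "(a, b) \<in> set pairs6" "e = {a, b}" by (rule edge_in_pairs6[OF assms(2)])
    then show "e \<in> edges s" using e *[of a b] by simp
  qed
qed

lemma edge_list_inj:
  assumes "edge_list t"
  shows "inj_on (\<lambda>(a, b). {a, b}) (set t)" "distinct t"
proof -
  have d: "distinct (map (\<lambda>(a, b). (min a b, max a b)) t)" using assms by (simp add: edge_list_def)
  then show "distinct t" by (simp add: distinct_map)
  show "inj_on (\<lambda>(a, b). {a, b}) (set t)"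
  proof (rule inj_onI)
    fix x y assume xy: "x \<in> set t" "y \<in> set t" "(\<lambda>(a, b). {a, b}) x = (\<lambda>(a, b). {a, b}) y"
    then have eq: "(\<lambda>(a, b). (min a b, max a b)) x = (\<lambda>(a, b). (min a b, max a b)) y"
    proof -
      obtain a b c d where x: "x = (a, b)" and y: "y = (c, d)" by (metis surj_pair)
      have "a = c \<and> b = d \<or> a = d \<and> b = c" using xy(3) unfolding x y by (auto simp: doubleton_eq_iff)
      then show ?thesis unfolding x y by (elim disjE) (simp_all add: min.commute max.commute)
    qed
    have "inj_on (\<lambda>(a, b). (min a b, max a b)) (set t)" using d by (simp only: distinct_map)
    from inj_onD[OF this eq xy(1,2)] show "x = y" .
  qed
qed

lemma edge_list_edges: "edge_list s \<Longrightarrow> e \<in> edges s \<Longrightarrow> e \<subseteq> {1..6} \<and> card e = 2"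
  by (metis edge_in_pairs6 pairs6_card)

lemma regular_edges:
  assumes "edge_list s" and len: "length s = 3 * m"
    and deg: "list_all (\<lambda>i. length (filter (\<lambda>(a, b). i = a \<or> i = b) s) = m) [1,2,3,4,5,6]"
  shows "regular m (edges s)"
proof -
  note inj = edge_list_inj(1)[OF assms(1)] and d = edge_list_inj(2)[OF assms(1)]
  have "card (edges s) = 3 * m"
    unfolding edges_def using card_image[OF inj] distinct_card[OF d] len by simp
  moreover have "card {e \<in> edges s. i \<in> e} = m" if "i \<in> {1..6}" for i
  proof -
    have "i \<in> set [1,2,3,4,5,6]" using that by auto
    then have l: "length (filter (\<lambda>(a, b). i = a \<or> i = b) s) = m" using deg unfolding list_all_iff by blast
    have "{e \<in> edges s. i \<in> e} = (\<lambda>(a, b). {a, b}) ` set (filter (\<lambda>(a, b). i = a \<or> i = b) s)"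
      unfolding edges_def by auto
    also have "card \<dots> = card (set (filter (\<lambda>(a, b). i = a \<or> i = b) s))"
      by (rule card_image[OF inj_on_subset[OF inj]]) auto
    also have "\<dots> = m" using distinct_card[OF distinct_filter[OF d]] l by simp
    finally show ?thesis .
  qed
  ultimately show ?thesis
    unfolding regular_def using edge_list_edges[OF assms(1)] by (simp add: edges_def)
qed

lemma prod_edges:
  assumes t: "edge_list t"
  shows "(\<Prod>e \<in> edges t. square_diff r e) = (\<Prod>(a, b)\<leftarrow>t. (r a - r b)\<^sup>2)"
proof -
  note inj = edge_list_inj(1)[OF t] and d = edge_list_inj(2)[OF t]
  have "(\<Prod>e \<in> edges t. square_diff r e) = (\<Prod>x \<in> set t. square_diff r ((\<lambda>(a, b). {a, b}) x))"
    unfolding edges_def using inj by (simp add: prod.reindex)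
  also have "\<dots> = (\<Prod>x \<in> set t. (\<lambda>(a, b). (r a - r b)\<^sup>2) x)"
  proof (intro prod.cong refl)
    fix x assume x: "x \<in> set t"
    obtain a b where ab: "x = (a, b)" by fastforce
    have "{a, b} \<in> edges t" using x by (simp add: edges_member ab)
    then obtain c d where "(c, d) \<in> set pairs6" "{a, b} = {c, d}" by (rule edge_in_pairs6[OF t])
    then have "card {a, b} = 2" using pairs6_card by simp
    then have "a \<noteq> b" by auto
    then show "square_diff r ((\<lambda>(a, b). {a, b}) x) = (\<lambda>(a, b). (r a - r b)\<^sup>2) x"
      by (simp add: ab square_diff_pair)
  qed
  also have "\<dots> = (\<Prod>(a, b)\<leftarrow>t. (r a - r b)\<^sup>2)"
    using d by (rule prod.distinct_set_conv_list)
  finally show ?thesis .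
qed

text \<open>The transpositions (1 k) generate all transpositions by conjugation, and these generate
  the symmetric group.\<close>

lemma closed_under_permutations:
  assumes p: "p permutes {1..6}"
    and swap: "\<And>k T. k \<in> {2..6} \<Longrightarrow> T \<in> F \<Longrightarrow> (\<lambda>e. swap1 k ` e) ` T \<in> F"
    and T: "T \<in> F"
  shows "(\<lambda>e. p ` e) ` T \<in> F"
  using p _ T
proof (induction p arbitrary: T rule: permutes_induct)
  show "finite {1..6 :: nat}" by simp
  show "(\<lambda>e. id ` e) ` T \<in> F" if "T \<in> F" for T using that by simp
  fix a b :: nat and p :: "nat \<Rightarrow> nat" and T
  assume ab: "a \<in> {1..6}" "b \<in> {1..6}"
    and IH: "\<And>T. T \<in> F \<Longrightarrow> (\<lambda>e. p ` e) ` T \<in> F" and T: "T \<in> F"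
  have sw: "(\<lambda>e. swap1 k ` e) ` T \<in> F" if "k \<in> {1..6}" "T \<in> F" for k T
  proof (cases "k = 1")
    case True
    then have "swap1 k = id" by (auto simp: swap1_def)
    then show ?thesis using that by simp
  qed (use that swap[of k T] in auto)
  have tr: "(\<lambda>e. transpose a b ` e) ` T \<in> F" if "T \<in> F" for T
  proof -
    \<comment> \<open>In the generic case (a b) = (1 a)(1 b)(1 a).\<close>
    have "transpose a b = (if b = 1 then swap1 a else if a = 1 then swap1 b else if a = b then id
        else swap1 a \<circ> swap1 b \<circ> swap1 a)"
      by (rule ext) (auto simp: swap1_def transpose_def)
    moreover have "(\<lambda>e. (swap1 a \<circ> swap1 b \<circ> swap1 a) ` e) ` T \<in> F"
      using sw[OF ab(1) sw[OF ab(2) sw[OF ab(1) that]]] by (simp add: image_image image_comp comp_def)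
    ultimately show ?thesis using sw ab that by auto
  qed
  show "(\<lambda>e. (transpose a b \<circ> p) ` e) ` T \<in> F"
    using tr[OF IH[OF T]] by (simp add: image_image image_comp comp_def)
qed

text \<open>Replaces the quantification over all 720 permutations by finite checks that can be
  evaluated. Closure of the masks under (1 k) puts the orbit inside the list, the entries of
  \<open>L\<close> being permutations puts the list inside the orbit, and distinct masks exclude
  repeated terms.\<close>

lemma orbit_sum_edges:
  assumes perm: "list_all (\<lambda>l. length l = 6 \<and> distinct l \<and> list_all (\<lambda>i. 1 \<le> i \<and> i \<le> 6) l) L"
    and id: "edge_list s" "List.member codes (code_of s)"
    and ok: "list_all (\<lambda>l. edge_list (relabel s l)) L"
    and codes: "map (\<lambda>l. code_of (relabel s l)) L = codes" and dist: "distinct codes"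
    and closed: "list_all (\<lambda>l. list_all (\<lambda>k. edge_list (relabel s (map (swap1 k) l)) \<and>
      List.member codes (code_of (relabel s (map (swap1 k) l)))) [2,3,4,5,6]) L"
    and s: "list_all (\<lambda>(x, y). 1 \<le> x \<and> x \<le> 6 \<and> 1 \<le> y \<and> y \<le> 6) s"
  shows "orbit_sum r (edges s) = (\<Sum>l\<leftarrow>L. \<Prod>(x, y)\<leftarrow>s. (r (l ! (x - 1)) - r (l ! (y - 1)))\<^sup>2)"
proof -
  let ?F = "(\<lambda>l. edges (relabel s l)) ` set L"
  have im: "(\<lambda>e. f ` e) ` edges (relabel s l) = edges (relabel s (map f l))" if "length l = 6" for f l
  proof -
    have "map f l ! (x - 1) = f (l ! (x - 1))" if "1 \<le> x" "x \<le> 6" for x :: nat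
      using that \<open>length l = 6\<close> by simp
    then show ?thesis
      using s unfolding edges_def relabel_def list_all_iff
      by (auto simp: image_image split_beta intro!: image_cong)
  qed
  have len: "length l = 6" if "l \<in> set L" for l using perm that by (auto simp: list_all_iff)
  have s_id: "relabel s [1,2,3,4,5,6] = s"
  proof -
    have "[1,2,3,4,5,6] ! (x - 1) = x" if "1 \<le> x" "x \<le> 6" for x :: nat
    proof -
      have "x \<in> {1,2,3,4,5,6}" using that by auto
      then show ?thesis by auto
    qed
    then show ?thesis
      using s unfolding relabel_def list_all_iff by (intro map_idI) (auto split: prod.splits)
  qed
  have "index_orbit (edges s) = ?F"
  proof (intro equalityI subsetI)
    fix T assume "T \<in> index_orbit (edges s)"
    then obtain p where p: "p permutes {1..6}" "T = (\<lambda>e. p ` e) ` edges s" by (auto simp: index_orbit_def)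
    have "edges s \<in> ?F"
    proof -
      have "code_of s \<in> set codes" using id(2) by simp
      then obtain l where l: "l \<in> set L" "code_of s = code_of (relabel s l)"
        unfolding codes[symmetric] by auto
      have "edges s = edges (relabel s l)"
        using ok l(1) by (intro edges_eqI id(1) l(2)) (auto simp: list_all_iff)
      then show ?thesis using l(1) by (rule image_eqI)
    qed
    moreover have "(\<lambda>e. swap1 k ` e) ` T \<in> ?F" if k: "k \<in> {2..6}" and T: "T \<in> ?F" for k T
    proof -
      obtain l where l: "l \<in> set L" "T = edges (relabel s l)" using T by auto
      have "k \<in> set [2,3,4,5,6]" using k by auto
      then have *: "edge_list (relabel s (map (swap1 k) l))"
        "code_of (relabel s (map (swap1 k) l)) \<in> set codes"
        using closed l(1) unfolding list_all_iff by auto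
      then obtain l' where l': "l' \<in> set L" "code_of (relabel s (map (swap1 k) l)) = code_of (relabel s l')"
        unfolding codes[symmetric] by auto
      have "edges (relabel s (map (swap1 k) l)) = edges (relabel s l')"
        using ok l'(1) by (intro edges_eqI *(1) l'(2)) (auto simp: list_all_iff)
      then show ?thesis using l'(1) l(2) im[OF len[OF l(1)]] by auto
    qed
    ultimately show "T \<in> ?F" unfolding p(2) using closed_under_permutations[OF p(1), of ?F] by blast
  next
    fix T assume "T \<in> ?F"
    then obtain l where l: "l \<in> set L" "T = edges (relabel s l)" by auto
    have dl: "distinct l" "set l \<subseteq> {1..6}" using perm l(1) by (auto simp: list_all_iff)
    have "set l = {1..6}"
      using dl len[OF l(1)] by (intro card_subset_eq) (auto simp: distinct_card)
    define p where "p i = (if i \<in> {1..6} then l ! (i - 1) else i)" for i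
    have pl: "map p [1,2,3,4,5,6] = l"
    proof (rule nth_equalityI)
      fix i assume "i < length (map p [1,2,3,4,5,6])"
      then have "i \<in> {0,1,2,3,4,5}" by auto
      then show "map p [1,2,3,4,5,6] ! i = l ! i" by (auto simp: p_def)
    qed (simp add: len[OF l(1)])
    have "{1..6} = set [1,2,3,4,5,6 :: nat]" by auto
    then have "p ` {1..6} = {1..6}" using pl \<open>set l = {1..6}\<close> by (metis set_map)
    moreover from this have "inj_on p {1..6}" by (intro eq_card_imp_inj_on) auto
    ultimately have "p permutes {1..6}"
      by (intro bij_imp_permutes) (auto simp: bij_betw_def p_def)
    moreover have "T = (\<lambda>e. p ` e) ` edges s"
      using im[of "[1,2,3,4,5,6]" p] unfolding s_id pl l(2) by simp
    ultimately show "T \<in> index_orbit (edges s)" unfolding index_orbit_def by blast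
  qed
  moreover have "distinct L" "inj_on (\<lambda>l. code_of (relabel s l)) (set L)"
    using dist unfolding codes[symmetric] by (simp_all add: distinct_map)
  moreover from this(2) have "inj_on (\<lambda>l. edges (relabel s l)) (set L)"
    by (simp add: inj_on_def code_of_edges)
  moreover have "(\<Prod>e \<in> edges (relabel s l). square_diff r e) =
      (\<Prod>(x, y)\<leftarrow>s. (r (l ! (x - 1)) - r (l ! (y - 1)))\<^sup>2)" if "l \<in> set L" for l
    using prod_edges[of "relabel s l" r] ok that
    by (simp add: list_all_iff relabel_def comp_def case_prod_unfold)
  ultimately show ?thesis
    unfolding orbit_sum_def by (simp add: sum.reindex sum.distinct_set_conv_list[symmetric])
qed

text \<open>
  In the model below \<open>{1,2}\<close>, \<open>{3,4}\<close>, \<open>{5,6}\<close> are the roots of the three quadratic factors.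
  The first six splits separate only one of these pairs, the last four separate all of them.
\<close>

definition splits :: "((nat \<times> nat \<times> nat) \<times> (nat \<times> nat \<times> nat)) list" where
  "splits = [((1,2,3),(5,6,4)), ((1,2,4),(5,6,3)), ((1,2,5),(3,4,6)), ((1,2,6),(3,4,5)),
     ((3,4,1),(5,6,2)), ((3,4,2),(5,6,1)),
     ((1,3,5),(2,4,6)), ((1,4,6),(2,3,5)), ((2,3,6),(1,4,5)), ((2,4,5),(1,3,6))]"

definition matching_perms :: "nat list list" where
  "matching_perms = [[1,2,3,4,5,6],[1,2,3,5,4,6],[1,2,3,6,4,5],[1,3,2,4,5,6],[1,4,2,3,5,6],
     [1,5,2,6,3,4],[1,6,2,5,3,4],[1,3,2,5,4,6],[1,3,2,6,4,5],[1,4,2,5,3,6],[1,4,2,6,3,5],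
     [1,5,2,3,4,6],[1,5,2,4,3,6],[1,6,2,3,4,5],[1,6,2,4,3,5]]"

definition split_perms :: "nat list list" where
  "split_perms = map (\<lambda>((a,b,c),(d,e,f)). [a,b,c,d,e,f]) splits"

text \<open>A prism consists of two triangles joined by a matching, so each of the ten splits yields
  six prisms, one for each bijection between its triangles.\<close>

definition prism_perms :: "nat list list" where
  "prism_perms = concat (map (\<lambda>((a,b,c),(d,e,f)). [[a,b,c,d,e,f],[a,b,c,d,f,e],[a,b,c,e,d,f],
     [a,b,c,e,f,d],[a,b,c,f,d,e],[a,b,c,f,e,d]]) splits)"

lemma orbit_sum_matchings:
  "orbit_sum r {{1,2}, {3,4}, {5,6}} = (\<Sum>l\<leftarrow>matching_perms.
     \<Prod>(x, y)\<leftarrow>[(1,2),(3,4),(5,6)]. (r (l ! (x - 1)) - r (l ! (y - 1)))\<^sup>2)"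
proof -
  \<comment> \<open>The masks in the order of \<open>matching_perms\<close>. The lowest bit belongs
    to (1,2), the highest to (5,6): 16897 = 1 + 2^9 + 2^14 encodes (1,2), (3,4), (5,6).\<close>
  let ?codes = "[16897, 9217, 6145, 16450, 16420, 776, 656, 8322, 4354, 2180, 1284, 8232, 2120, 4144, 1104]"
  have "orbit_sum r (edges [(1,2),(3,4),(5,6)]) = (\<Sum>l\<leftarrow>matching_perms.
     \<Prod>(x, y)\<leftarrow>[(1,2),(3,4),(5,6)]. (r (l ! (x - 1)) - r (l ! (y - 1)))\<^sup>2)"
    by (rule orbit_sum_edges[where codes = ?codes]) code_simp+
  then show ?thesis by (simp add: edges_def)
qed

lemma orbit_sum_triangles:
  "orbit_sum r {{1,2}, {2,3}, {3,1}, {4,5}, {5,6}, {6,4}} = (\<Sum>l\<leftarrow>split_perms.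
     \<Prod>(x, y)\<leftarrow>[(1,2),(2,3),(3,1),(4,5),(5,6),(6,4)]. (r (l ! (x - 1)) - r (l ! (y - 1)))\<^sup>2)"
proof -
  let ?codes = "[28707, 19525, 10889, 5905, 17286, 17016, 9546, 9396, 6444, 6354]"
  have "orbit_sum r (edges [(1,2),(2,3),(3,1),(4,5),(5,6),(6,4)]) = (\<Sum>l\<leftarrow>split_perms.
     \<Prod>(x, y)\<leftarrow>[(1,2),(2,3),(3,1),(4,5),(5,6),(6,4)]. (r (l ! (x - 1)) - r (l ! (y - 1)))\<^sup>2)"
    by (rule orbit_sum_edges[where codes = ?codes]) code_simp+
  then show ?thesis by (simp add: edges_def)
qed

lemma orbit_sum_prisms:
  "orbit_sum r {{1,2}, {2,3}, {3,1}, {4,5}, {5,6}, {6,4}, {1,4}, {2,5}, {3,6}} = (\<Sum>l\<leftarrow>prism_perms.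
     \<Prod>(x, y)\<leftarrow>[(1,2),(2,3),(3,1),(4,5),(5,6),(6,4),(1,4),(2,5),(3,6)].
       (r (l ! (x - 1)) - r (l ! (y - 1)))\<^sup>2)"
proof -
  let ?codes = "[29483,30827,29363,29811,30887,29991,20301,27757,20181,23669,27847,23879,27339,15243,27309,12173,15033,11993,22355,14227,22325,8085,14137,8025,26503,18390,23431,19406,21430,25518,26233,18300,23161,19196,21370,25338,26443,15691,25966,11726,13690,10202,26293,15541,25846,13750,11516,10172,23341,15661,22894,7548,14766,7100,23251,15571,22774,14586,7638,7130]"
  have "orbit_sum r (edges [(1,2),(2,3),(3,1),(4,5),(5,6),(6,4),(1,4),(2,5),(3,6)]) = (\<Sum>l\<leftarrow>prism_perms.
     \<Prod>(x, y)\<leftarrow>[(1,2),(2,3),(3,1),(4,5),(5,6),(6,4),(1,4),(2,5),(3,6)].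
       (r (l ! (x - 1)) - r (l ! (y - 1)))\<^sup>2)"
    by (rule orbit_sum_edges[where codes = ?codes]) code_simp+
  then show ?thesis by (simp add: edges_def)
qed

text \<open>The complete graph is fixed by every permutation, so its orbit is a single term, with
  mask 32767 = 2^15 - 1.\<close>

lemma orbit_sum_pairs: "orbit_sum r (edges pairs6) = (\<Prod>(a, b)\<leftarrow>pairs6. (r a - r b)\<^sup>2)"
proof -
  have "orbit_sum r (edges pairs6) = (\<Sum>l\<leftarrow>[[1,2,3,4,5,6]].
      \<Prod>(x, y)\<leftarrow>pairs6. (r (l ! (x - 1)) - r (l ! (y - 1)))\<^sup>2)"
    by (rule orbit_sum_edges[where codes = "[32767]"]) code_simp+
  then show ?thesis by (simp add: pairs6_def)
qed

section \<open>The invariants of the model\<close>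

text \<open>
  With critical points $c_i = g_i^2$ of sum 0, the quadratic factors have the roots
  $-c_i \pm \sqrt{-2 c_j c_k} = -g_i^2 \pm w g_j g_k$ with $w^2 = -2$. Write $e$ for the second elementary
  symmetric function of the $c_i$ and $f = t^2$ for their product. A split of the six roots
  into two triples contributes the product of the discriminants to $J_4$, and this product times a
  permanent to $J_6$. The contributions are first reduced modulo $c^3 = -e c + f$ (splits
  keeping two pairs of roots together) or $s^2 = 2u$, $u^2 = e + 2 s t$ (the other splits), where
  $s, u, t$ are the elementary symmetric functions of the $g_i$.
\<close>

definition tri :: "'k::field \<Rightarrow> 'k \<Rightarrow> 'k \<Rightarrow> 'k" where
  "tri p q s = ((p - q) * (q - s) * (s - p))\<^sup>2"

text \<open>The permanent of the 3 by 3 matrix with entries (p_i - q_j)^2.\<close>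

definition perm6 :: "'k::field \<Rightarrow> 'k \<Rightarrow> 'k \<Rightarrow> 'k \<Rightarrow> 'k \<Rightarrow> 'k \<Rightarrow> 'k" where
  "perm6 p1 p2 p3 q1 q2 q3 =
     ((p1 - q1) * (p2 - q2) * (p3 - q3))\<^sup>2 + ((p1 - q1) * (p2 - q3) * (p3 - q2))\<^sup>2 +
     ((p1 - q2) * (p2 - q1) * (p3 - q3))\<^sup>2 + ((p1 - q2) * (p2 - q3) * (p3 - q1))\<^sup>2 +
     ((p1 - q3) * (p2 - q1) * (p3 - q2))\<^sup>2 + ((p1 - q3) * (p2 - q2) * (p3 - q1))\<^sup>2"

text \<open>Stands for two splits together: those that separate the pair of roots belonging to the
  critical point \<open>c\<close>. Only their sum is free of square roots.\<close>

definition split_I4 :: "'k::field \<Rightarrow> 'k \<Rightarrow> 'k \<Rightarrow> 'k" where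
  "split_I4 c e f = 508032 * f ^ 4 + 71808 * e ^ 3 * f\<^sup>2 + 10368 * c\<^sup>2 * e\<^sup>2 * f\<^sup>2 + 2048 * c * e ^ 4 * f - 17280 * c * e * f ^ 3"

definition split_I6 :: "'k::field \<Rightarrow> 'k \<Rightarrow> 'k \<Rightarrow> 'k" where
  "split_I6 c e f = - 749025792 * f ^ 6 - 18384896 * e ^ 6 * f\<^sup>2 - 233765376 * e ^ 3 * f ^ 4 - 2820096 * c\<^sup>2 * e ^ 5 * f\<^sup>2
      - 22934016 * c\<^sup>2 * e\<^sup>2 * f ^ 4 - 557056 * c * e ^ 7 * f + 169984 * c * e ^ 4 * f ^ 3 + 38223360 * c * e * f ^ 5"

text \<open>Stands for one split that separates all three pairs; the other three such splits arise
  by changing signs of the g_i. The reduced form is linear in \<open>s\<close>, \<open>u\<close> and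
  \<open>u * s\<close>, which makes the sum over the sign changes easy.\<close>

definition split_II4 :: "'k::field \<Rightarrow> 'k \<Rightarrow> 'k \<Rightarrow> 'k \<Rightarrow> 'k" where
  "split_II4 s u t e = 531441 * t ^ 8 - 132840 * u * s * t ^ 7 + 16 * e ^ 6 - 128 * e ^ 5 * s * t + 1184 * e ^ 4 * u * t ^ 2 +
     24408 * e ^ 3 * t ^ 4 - 4128 * e ^ 3 * u * s * t ^ 3 - 16416 * e ^ 2 * s * t ^ 5 + 66312 * e * u * t ^ 6"

definition split_II6 :: "'k::field \<Rightarrow> 'k \<Rightarrow> 'k \<Rightarrow> 'k \<Rightarrow> 'k" where
  "split_II6 s u t e = - 800350146 * t ^ 12 + 200034360 * u * s * t ^ 11 - 4224 * e ^ 9 + 34304 * e ^ 8 * s * t -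
     315264 * e ^ 7 * u * t ^ 2 - 6253024 * e ^ 6 * t ^ 4 + 1079168 * e ^ 6 * u * s * t ^ 3 + 3985664 * e ^ 5 * s * t ^ 5 -
     16638272 * e ^ 4 * u * t ^ 6 - 153556344 * e ^ 3 * t ^ 8 + 35550528 * e ^ 3 * u * s * t ^ 7 +
     24469344 * e ^ 2 * s * t ^ 9 - 99717048 * e * u * t ^ 10"

text \<open>Each triple contains a whole pair of roots. Its discriminant is therefore that of the
  quadratic factor, such as 4 x^2, times the squared value of this factor at the third root; these
  two values split off 2a + b and a + 2b, whose product is 2c^2 + ab.\<close>

lemma type_I_tri:
  fixes a b c x y z :: "'k::field"
  assumes c: "c = - (a + b)" and x: "x\<^sup>2 = - 2 * b * c" and y: "y\<^sup>2 = - 2 * a * b" and z: "z\<^sup>2 = - 2 * a * c"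
  shows "tri (- a + x) (- a - x) (- c + y) * tri (- b + z) (- b - z) (- c - y) =
    64 * (a * b) * c\<^sup>2 * (2 * c\<^sup>2 + a * b)\<^sup>2 * (17 * (a * b) - 2 * c\<^sup>2 + 6 * (b - a) * y)\<^sup>2"
proof -
  have u: "(- a - x - (- c + y)) * (- c + y - (- a + x)) = - ((2 * a + b) * (2 * a - b + 2 * y))"
    using x y unfolding c by algebra
  have v: "(- b - z - (- c - y)) * (- c - y - (- b + z)) = - ((a + 2 * b) * (2 * b - a - 2 * y))"
    using z y unfolding c by algebra
  have k: "(2 * a + b) * (2 * a - b + 2 * y) * ((a + 2 * b) * (2 * b - a - 2 * y)) =
      (2 * c\<^sup>2 + a * b) * (17 * (a * b) - 2 * c\<^sup>2 + 6 * (b - a) * y)"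
    using y unfolding c by algebra
  have t1: "tri (- a + x) (- a - x) (- c + y) = 4 * x\<^sup>2 * ((2 * a + b) * (2 * a - b + 2 * y))\<^sup>2"
    unfolding tri_def mult.assoc u by (simp add: power2_eq_square algebra_simps)
  have t2: "tri (- b + z) (- b - z) (- c - y) = 4 * z\<^sup>2 * ((a + 2 * b) * (2 * b - a - 2 * y))\<^sup>2"
    unfolding tri_def mult.assoc v by (simp add: power2_eq_square algebra_simps)
  have "tri (- a + x) (- a - x) (- c + y) * tri (- b + z) (- b - z) (- c - y) =
      16 * (x\<^sup>2 * z\<^sup>2) * ((2 * a + b) * (2 * a - b + 2 * y) * ((a + 2 * b) * (2 * b - a - 2 * y)))\<^sup>2"
    unfolding t1 t2 by (simp add: power_mult_distrib)
  also have "\<dots> = 16 * ((- 2 * b * c) * (- 2 * a * c)) *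
      ((2 * c\<^sup>2 + a * b) * (17 * (a * b) - 2 * c\<^sup>2 + 6 * (b - a) * y))\<^sup>2"
    unfolding k x z ..
  finally show ?thesis by (simp add: power_mult_distrib power2_eq_square)
qed

lemma type_I_perm:
  fixes a b c x y z :: "'k::field"
  assumes c: "c = - (a + b)" and x: "x\<^sup>2 = - 2 * b * c" and y: "y\<^sup>2 = - 2 * a * b" and z: "z\<^sup>2 = - 2 * a * c"
  shows "perm6 (- a + x) (- a - x) (- c + y) (- b + z) (- b - z) (- c - y) =
    272 * c ^ 6 - 832 * c ^ 4 * (a * b) - 1268 * c\<^sup>2 * (a * b)\<^sup>2 - 528 * (a * b) ^ 3 +
    (48 * c ^ 4 + 216 * c\<^sup>2 * (a * b) + 96 * (a * b)\<^sup>2) * (b - a) * y"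
  using x y z unfolding c perm6_def by algebra

text \<open>Here p1 - p2 = (g2 - g1)(g1 + g2 + w g3), and q1 - q2 is the same with -w. By w^2 = -2
  and the vanishing sum of squares, the product of the second factors is -(g1 - g2)^2. The mixed
  differences behave alike with g1 + g2.\<close>

lemma type_II_factors:
  fixes g1 g2 g3 w :: "'k::field"
  assumes K: "g1\<^sup>2 + g2\<^sup>2 + g3\<^sup>2 = 0" and w: "w\<^sup>2 = - 2"
    and p: "p1 = - g1\<^sup>2 + w * g2 * g3" "p2 = - g2\<^sup>2 + w * g1 * g3" "p3 = - g3\<^sup>2 + w * g1 * g2"
    and q: "q1 = - g1\<^sup>2 - w * g2 * g3" "q2 = - g2\<^sup>2 - w * g1 * g3" "q3 = - g3\<^sup>2 - w * g1 * g2"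
  shows "(p1 - p2) * (q1 - q2) = - ((g1 - g2) ^ 4)" "(p1 - q2) * (p2 - q1) = (g1 + g2) ^ 4"
    "(p1 - q2) * (p2 - q3) * (p3 - q1) - (p1 - q3) * (p2 - q1) * (p3 - q2) =
      6 * ((g1 + g2) * (g1 + g3) * (g2 + g3)) * ((g1 - g2) * (g1 - g3) * (g2 - g3))"
  subgoal using K w unfolding p q by algebra
  subgoal using K w unfolding p q by algebra
  subgoal using w unfolding p q by algebra
  done

text \<open>\<open>V\<close> collects the differences and \<open>W\<close> the sums of the g_i. The
  discriminants multiply to V^8. The six terms of the permanent are grouped by the cycle type of the
  matching: the identity (\<open>d\<close>), the transpositions (\<open>one\<close>) and the two
  3-cycles (\<open>cyc\<close>).\<close>

lemma type_II:
  fixes g1 g2 g3 w :: "'k::field"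
  assumes K: "g1\<^sup>2 + g2\<^sup>2 + g3\<^sup>2 = 0" and w: "w\<^sup>2 = - 2"
    and p: "p1 = - g1\<^sup>2 + w * g2 * g3" "p2 = - g2\<^sup>2 + w * g1 * g3" "p3 = - g3\<^sup>2 + w * g1 * g2"
    and q: "q1 = - g1\<^sup>2 - w * g2 * g3" "q2 = - g2\<^sup>2 - w * g1 * g3" "q3 = - g3\<^sup>2 - w * g1 * g2"
    and s: "s = g1 + g2 + g3" and u: "u = g1 * g2 + g1 * g3 + g2 * g3" and t: "t = g1 * g2 * g3"
    and e: "e = g1\<^sup>2 * g2\<^sup>2 + g1\<^sup>2 * g3\<^sup>2 + g2\<^sup>2 * g3\<^sup>2"
  shows "tri p1 p2 p3 * tri q1 q2 q3 =
      split_II4 s u t e"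
    and "tri p1 p2 p3 * tri q1 q2 q3 * perm6 p1 p2 p3 q1 q2 q3 =
      split_II6 s u t e"
    and "tri p1 p2 p3 * tri q1 q2 q3 * ((p1 - q1) * (p2 - q2) * (p3 - q3) *
        ((p1 - q2) * (p2 - q1)) * ((p1 - q3) * (p3 - q1)) * ((p2 - q3) * (p3 - q2)))\<^sup>2 =
      - 512 * t ^ 4 * (4 * e ^ 3 + 27 * t ^ 4) ^ 4"
proof -
  have s2: "s\<^sup>2 = 2 * u" using K unfolding s u by algebra
  have u2: "u\<^sup>2 = e + 2 * s * t" unfolding s u t e by algebra
  define V W where "V = (g1 - g2) * (g1 - g3) * (g2 - g3)" and "W = (g1 + g2) * (g1 + g3) * (g2 + g3)"
  \<comment> \<open>The discriminant of the cubic with roots g_i in terms of its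
    coefficients.\<close>
  have "V\<^sup>2 = s\<^sup>2 * u\<^sup>2 - 4 * u ^ 3 - 4 * s ^ 3 * t + 18 * s * u * t - 27 * t\<^sup>2"
    unfolding V_def s u t by algebra
  then have V2: "V\<^sup>2 = 6 * t * s * u - 2 * e * u - 27 * t\<^sup>2"
    using s2 u2 by algebra
  have W: "W = s * u - t" unfolding W_def s u t by algebra
  have W2: "W\<^sup>2 = t\<^sup>2 + 2 * u * s * t + 2 * e * u"
    using s2 u2 unfolding W by algebra
  have f: "(p1 - p2) * (q1 - q2) = - ((g1 - g2) ^ 4)" "(p1 - q2) * (p2 - q1) = (g1 + g2) ^ 4"
    "(p1 - q2) * (p2 - q3) * (p3 - q1) - (p1 - q3) * (p2 - q1) * (p3 - q2) = 6 * W * V"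
    using type_II_factors[OF K w p q] unfolding V_def W_def by blast+
  have f23: "(p2 - p3) * (q2 - q3) = - ((g2 - g3) ^ 4)" "(p2 - q3) * (p3 - q2) = (g2 + g3) ^ 4"
    by (rule type_II_factors(1,2)[of g2 g3 g1 w p2 p3 p1 q2 q3 q1]; use K w p q in \<open>simp add: ac_simps\<close>)+
  have f13: "(p1 - p3) * (q1 - q3) = - ((g1 - g3) ^ 4)" "(p1 - q3) * (p3 - q1) = (g1 + g3) ^ 4"
    by (rule type_II_factors(1,2)[of g1 g3 g2 w p1 p3 p2 q1 q3 q2]; use K w p q in \<open>simp add: ac_simps\<close>)+
  have "tri p1 p2 p3 * tri q1 q2 q3 =
      ((p1 - p2) * (q1 - q2) * ((p1 - p3) * (q1 - q3)) * ((p2 - p3) * (q2 - q3)))\<^sup>2"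
    unfolding tri_def by algebra
  also have "\<dots> = (V\<^sup>2) ^ 4" unfolding f f13 f23 V_def by (simp add: power_mult_distrib flip: power_mult)
  finally have T: "tri p1 p2 p3 * tri q1 q2 q3 = (V\<^sup>2) ^ 4" .
  have V4: "(V\<^sup>2)\<^sup>2 = 729 * t ^ 4 - 180 * u * s * t ^ 3 + 4 * e ^ 3 - 16 * e\<^sup>2 * s * t + 84 * e * u * t\<^sup>2"
    unfolding V2 using s2 u2 by algebra
  have V8: "(V\<^sup>2) ^ 4 = split_II4 s u t e"
  proof -
    have "(V\<^sup>2) ^ 4 = ((V\<^sup>2)\<^sup>2)\<^sup>2" by (simp flip: power_mult)
    then show ?thesis unfolding V4 split_II4_def using s2 u2 by algebra
  qed
  then show "tri p1 p2 p3 * tri q1 q2 q3 = split_II4 s u t e"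
    unfolding T .
  have pq: "p1 - q1 = 2 * w * (g2 * g3)" "p2 - q2 = 2 * w * (g1 * g3)" "p3 - q3 = 2 * w * (g1 * g2)"
    unfolding p q by (simp_all add: algebra_simps)
  have w6: "w ^ 6 = - 8"
  proof -
    have "w ^ 6 = (w\<^sup>2) ^ 3" by (simp flip: power_mult)
    then show ?thesis by (simp add: w)
  qed
  have "((p1 - q1) * (p2 - q2) * (p3 - q3))\<^sup>2 = 64 * w ^ 6 * t ^ 4"
    unfolding pq t by algebra
  then have d: "((p1 - q1) * (p2 - q2) * (p3 - q3))\<^sup>2 = - 512 * t ^ 4" by (simp add: w6)
  have PQ: "((p1 - q2) * (p2 - q3) * (p3 - q1)) * ((p1 - q3) * (p2 - q1) * (p3 - q2)) = (W\<^sup>2)\<^sup>2"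
  proof -
    have "((p1 - q2) * (p2 - q3) * (p3 - q1)) * ((p1 - q3) * (p2 - q1) * (p3 - q2)) =
        ((p1 - q2) * (p2 - q1)) * ((p1 - q3) * (p3 - q1)) * ((p2 - q3) * (p3 - q2))" by (simp add: ac_simps)
    also have "\<dots> = (W\<^sup>2)\<^sup>2" unfolding f f13 f23 W_def by (simp add: power_mult_distrib flip: power_mult)
    finally show ?thesis .
  qed
  \<comment> \<open>The difference of the two 3-cycle products is 6WV and their product is W^4,
    which determines the sum of their squares.\<close>
  have cyc: "((p1 - q2) * (p2 - q3) * (p3 - q1))\<^sup>2 + ((p1 - q3) * (p2 - q1) * (p3 - q2))\<^sup>2 =
      36 * W\<^sup>2 * V\<^sup>2 + 2 * (W\<^sup>2)\<^sup>2"
    using f(3) PQ by algebra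
  have one: "((p1 - q1) * (p2 - q3) * (p3 - q2))\<^sup>2 = - 8 * ((g2 * g3)\<^sup>2 * (g2 + g3) ^ 8)"
    "((p1 - q2) * (p2 - q1) * (p3 - q3))\<^sup>2 = - 8 * ((g1 * g2)\<^sup>2 * (g1 + g2) ^ 8)"
    "((p1 - q3) * (p2 - q2) * (p3 - q1))\<^sup>2 = - 8 * ((g1 * g3)\<^sup>2 * (g1 + g3) ^ 8)"
  proof -
    have sq: "(A * B)\<^sup>2 = - 8 * (y\<^sup>2 * v ^ 8)" if "A = 2 * w * y" "B = v ^ 4" for A B y v
    proof -
      have "(A * B)\<^sup>2 = 4 * w\<^sup>2 * (y\<^sup>2 * (v ^ 4)\<^sup>2)" unfolding that by (simp add: power_mult_distrib)
      then show ?thesis by (simp add: w flip: power_mult)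
    qed
    show "((p1 - q1) * (p2 - q3) * (p3 - q2))\<^sup>2 = - 8 * ((g2 * g3)\<^sup>2 * (g2 + g3) ^ 8)"
      using sq[OF pq(1) f23(2)] by (simp add: mult.assoc)
    show "((p1 - q2) * (p2 - q1) * (p3 - q3))\<^sup>2 = - 8 * ((g1 * g2)\<^sup>2 * (g1 + g2) ^ 8)"
      using sq[OF pq(3) f(2)] by (simp add: mult.commute[of "p3 - q3"])
    show "((p1 - q3) * (p2 - q2) * (p3 - q1))\<^sup>2 = - 8 * ((g1 * g3)\<^sup>2 * (g1 + g3) ^ 8)"
      using sq[OF pq(2) f13(2)] by (simp add: ac_simps)
  qed
  \<comment> \<open>The remainder modulo the cubic x^3 = s x^2 - u x + t. It is quadratic in x, so
    summing over the three g_i only requires that they sum to s and their squares to 0.\<close>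
  have G: "(y * z)\<^sup>2 * (y + z) ^ 8 =
      (t ^ 4 + 16 * e ^ 3 + 16 * e\<^sup>2 * s * t - 32 * e * u * t\<^sup>2) +
      (40 * u * t ^ 3 + 16 * e\<^sup>2 * t - 16 * e\<^sup>2 * u * s + 32 * e * s * t\<^sup>2) * x +
      (- 40 * s * t ^ 3 + 16 * e\<^sup>2 * u - 17 * e * t\<^sup>2) * x\<^sup>2"
    if x: "s = x + y + z" "u = x * y + x * z + y * z" "t = x * y * z" for x y z
  proof -
    have x3: "x ^ 3 = s * x\<^sup>2 - u * x + t" unfolding x by algebra
    have yz: "y * z = u - s * x + x\<^sup>2" "y + z = s - x" unfolding x by algebra+
    show ?thesis using x3 s2 u2 unfolding yz by algebra
  qed
  have "(g2 * g3)\<^sup>2 * (g2 + g3) ^ 8 + (g1 * g2)\<^sup>2 * (g1 + g2) ^ 8 + (g1 * g3)\<^sup>2 * (g1 + g3) ^ 8 =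
      3 * t ^ 4 + 40 * u * s * t ^ 3 + 16 * e ^ 3 - 32 * e * u * t\<^sup>2"
  proof -
    note G1 = G[of g1 g2 g3] and G2 = G[of g2 g1 g3] and G3 = G[of g3 g1 g2]
    have "g1 + g2 + g3 = s" "g1\<^sup>2 + g2\<^sup>2 + g3\<^sup>2 = 0" using s K by auto
    then show ?thesis
      using G1 G2 G3 s2 u2 unfolding s u t by algebra
  qed
  then have "perm6 p1 p2 p3 q1 q2 q3 =
      - 512 * t ^ 4 - 8 * (3 * t ^ 4 + 40 * u * s * t ^ 3 + 16 * e ^ 3 - 32 * e * u * t\<^sup>2) +
      (36 * W\<^sup>2 * V\<^sup>2 + 2 * (W\<^sup>2)\<^sup>2)"
    unfolding perm6_def using d cyc one by algebra
  then have perm: "perm6 p1 p2 p3 q1 q2 q3 = - 1506 * t ^ 4 - 280 * u * s * t ^ 3 - 264 * e ^ 3 + 32 * e ^ 2 * s * t + 344 * e * u * t ^ 2"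
    unfolding V2 W2 using s2 u2 by algebra
  show "tri p1 p2 p3 * tri q1 q2 q3 * perm6 p1 p2 p3 q1 q2 q3 =
      split_II6 s u t e"
    unfolding T V8 perm split_II4_def split_II6_def using s2 u2 by algebra
  \<comment> \<open>V^2 W^2 is the product of the squared differences of the g_i^2, the discriminant
    of c^3 + e c - t^2.\<close>
  have vw: "V\<^sup>2 * W\<^sup>2 = - (4 * e ^ 3 + 27 * t ^ 4)" unfolding V2 W2 using s2 u2 by algebra
  have VW: "(V\<^sup>2) ^ 4 * (W\<^sup>2) ^ 4 = (4 * e ^ 3 + 27 * t ^ 4) ^ 4"
  proof -
    have "(V\<^sup>2) ^ 4 * (W\<^sup>2) ^ 4 = (V\<^sup>2 * W\<^sup>2) ^ 4" by (rule power_mult_distrib[symmetric])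
    also have "\<dots> = (4 * e ^ 3 + 27 * t ^ 4) ^ 4" unfolding vw by (rule power_minus_Bit0)
    finally show ?thesis .
  qed
  have "((p1 - q1) * (p2 - q2) * (p3 - q3) *
        ((p1 - q2) * (p2 - q1)) * ((p1 - q3) * (p3 - q1)) * ((p2 - q3) * (p3 - q2)))\<^sup>2 =
      ((p1 - q1) * (p2 - q2) * (p3 - q3))\<^sup>2 * (W\<^sup>2) ^ 4"
    unfolding f f13 f23 W_def by (simp add: power_mult_distrib flip: power_mult)
  then show "tri p1 p2 p3 * tri q1 q2 q3 * ((p1 - q1) * (p2 - q2) * (p3 - q3) *
        ((p1 - q2) * (p2 - q1)) * ((p1 - q3) * (p3 - q1)) * ((p2 - q3) * (p3 - q2)))\<^sup>2 =
      - 512 * t ^ 4 * (4 * e ^ 3 + 27 * t ^ 4) ^ 4"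
    unfolding T VW[symmetric] d by (simp add: ac_simps)
qed

text \<open>The two splits differ in the sign of \<open>y\<close>, so the terms odd in
  \<open>h\<close> cancel. What remains is reduced with a b = e + c^2 and c^3 = -e c + f.\<close>

lemma type_I:
  fixes a b c x y z e f :: "'k::field"
  assumes c: "a + b + c = 0" and x: "x\<^sup>2 = - 2 * b * c" and y: "y\<^sup>2 = - 2 * a * b" and z: "z\<^sup>2 = - 2 * a * c"
    and e: "e = a * b + a * c + b * c" and f: "f = a * b * c"
  shows "tri (- a + x) (- a - x) (- c + y) * tri (- b + z) (- b - z) (- c - y) +
      tri (- a + x) (- a - x) (- c - y) * tri (- b + z) (- b - z) (- c + y) =
      split_I4 c e f"
    and "tri (- a + x) (- a - x) (- c + y) * tri (- b + z) (- b - z) (- c - y) *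
        perm6 (- a + x) (- a - x) (- c + y) (- b + z) (- b - z) (- c - y) +
      tri (- a + x) (- a - x) (- c - y) * tri (- b + z) (- b - z) (- c + y) *
        perm6 (- a + x) (- a - x) (- c - y) (- b + z) (- b - z) (- c + y) =
      split_I6 c e f"
proof -
  have c': "c = - (a + b)" using c by algebra
  define m h where "m = a * b" and "h = (b - a) * y"
  have m: "m = e + c\<^sup>2" and c3: "c ^ 3 = - e * c + f" and h2: "h\<^sup>2 = - 2 * m * (c\<^sup>2 - 4 * m)"
    using y unfolding m_def h_def e f c' by algebra+
  define pre k n0 n1 where "pre = 64 * m * c\<^sup>2 * (2 * c\<^sup>2 + m)\<^sup>2" and "k = 17 * m - 2 * c\<^sup>2"
    and "n0 = 272 * c ^ 6 - 832 * c ^ 4 * m - 1268 * c\<^sup>2 * m\<^sup>2 - 528 * m ^ 3"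
    and "n1 = 48 * c ^ 4 + 216 * c\<^sup>2 * m + 96 * m\<^sup>2"
  have y': "(- y)\<^sup>2 = - 2 * a * b" using y by simp
  have T1: "tri (- a + x) (- a - x) (- c + y) * tri (- b + z) (- b - z) (- c - y) = pre * (k + 6 * h)\<^sup>2"
    using type_I_tri[OF c' x y z] unfolding pre_def k_def m_def h_def by (simp only: mult.assoc)
  have T2: "tri (- a + x) (- a - x) (- c - y) * tri (- b + z) (- b - z) (- c + y) = pre * (k - 6 * h)\<^sup>2"
    using type_I_tri[OF c' x y' z] unfolding pre_def k_def m_def h_def
    by (simp only: mult.assoc mult_minus_right add_uminus_conv_diff diff_minus_eq_add)
  have P1: "perm6 (- a + x) (- a - x) (- c + y) (- b + z) (- b - z) (- c - y) = n0 + n1 * h"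
    using type_I_perm[OF c' x y z] unfolding n0_def n1_def m_def h_def by (simp add: mult.assoc)
  have P2: "perm6 (- a + x) (- a - x) (- c - y) (- b + z) (- b - z) (- c + y) = n0 - n1 * h"
    using type_I_perm[OF c' x y' z] unfolding n0_def n1_def m_def h_def by (simp add: mult.assoc)
  have pre: "2 * pre = - 384 * e * f\<^sup>2 + 1152 * c\<^sup>2 * f\<^sup>2 + 512 * c * e\<^sup>2 * f"
    using c3 unfolding pre_def m by algebra
  have g0: "k\<^sup>2 + 36 * h\<^sup>2 = 577 * e\<^sup>2 + 573 * c\<^sup>2 * e + 441 * c * f"
    using c3 h2 unfolding k_def m by algebra
  have "pre * (k + 6 * h)\<^sup>2 + pre * (k - 6 * h)\<^sup>2 = 2 * pre * (k\<^sup>2 + 36 * h\<^sup>2)" by algebra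
  then show "tri (- a + x) (- a - x) (- c + y) * tri (- b + z) (- b - z) (- c - y) +
      tri (- a + x) (- a - x) (- c - y) * tri (- b + z) (- b - z) (- c + y) =
      split_I4 c e f"
    unfolding T1 T2 pre g0 split_I4_def using c3 by algebra
  have q6: "(k\<^sup>2 + 36 * h\<^sup>2) * n0 + 12 * k * n1 * h\<^sup>2 = - 147984 * e ^ 5 - 842596 * e\<^sup>2 * f\<^sup>2
      - 146896 * c\<^sup>2 * e ^ 4 - 833748 * c\<^sup>2 * e * f\<^sup>2 - 650196 * c * f ^ 3 - 113232 * c * e ^ 3 * f"
    unfolding g0 using c3 h2 unfolding k_def n0_def n1_def m by algebra
  have "pre * (k + 6 * h)\<^sup>2 * (n0 + n1 * h) + pre * (k - 6 * h)\<^sup>2 * (n0 - n1 * h) =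
      2 * pre * ((k\<^sup>2 + 36 * h\<^sup>2) * n0 + 12 * k * n1 * h\<^sup>2)" by algebra
  then show "tri (- a + x) (- a - x) (- c + y) * tri (- b + z) (- b - z) (- c - y) *
        perm6 (- a + x) (- a - x) (- c + y) (- b + z) (- b - z) (- c - y) +
      tri (- a + x) (- a - x) (- c - y) * tri (- b + z) (- b - z) (- c + y) *
        perm6 (- a + x) (- a - x) (- c - y) (- b + z) (- b - z) (- c + y) =
      split_I6 c e f"
    unfolding T1 T2 P1 P2 pre q6 split_I6_def using c3 by algebra
qed

section \<open>The ten splits assembled into the invariants\<close>

lemma orbit_sum_tri:
  "orbit_sum r {{1,2}, {2,3}, {3,1}, {4,5}, {5,6}, {6,4}} =
     (\<Sum>((a, b, c), (d, e, f))\<leftarrow>splits. tri (r a) (r b) (r c) * tri (r d) (r e) (r f))"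
  unfolding orbit_sum_triangles
  by (simp add: split_perms_def splits_def tri_def power_mult_distrib mult.assoc)

lemma prism_six:
  "tri a b c * tri d e f * ((a - d) * (b - e) * (c - f))\<^sup>2 +
   tri a b c * tri d f e * ((a - d) * (b - f) * (c - e))\<^sup>2 +
   tri a b c * tri e d f * ((a - e) * (b - d) * (c - f))\<^sup>2 +
   tri a b c * tri e f d * ((a - e) * (b - f) * (c - d))\<^sup>2 +
   tri a b c * tri f d e * ((a - f) * (b - d) * (c - e))\<^sup>2 +
   tri a b c * tri f e d * ((a - f) * (b - e) * (c - d))\<^sup>2 = tri a b c * tri d e f * perm6 a b c d e f"
proof -
  have t: "tri d f e = tri d e f" "tri e d f = tri d e f" "tri e f d = tri d e f" "tri f d e = tri d e f"
    "tri f e d = tri d e f"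
    unfolding tri_def by algebra+
  show ?thesis
    unfolding t perm6_def by (simp only: distrib_left)
qed

lemma orbit_sum_perm6:
  "orbit_sum r {{1,2}, {2,3}, {3,1}, {4,5}, {5,6}, {6,4}, {1,4}, {2,5}, {3,6}} =
     (\<Sum>((a, b, c), (d, e, f))\<leftarrow>splits. tri (r a) (r b) (r c) * tri (r d) (r e) (r f) *
       perm6 (r a) (r b) (r c) (r d) (r e) (r f))"
proof -
  have *: "(\<Prod>(x, y)\<leftarrow>[(1,2),(2,3),(3,1),(4,5),(5,6),(6,4),(1,4),(2,5),(3,6)].
       (r (l ! (x - 1)) - r (l ! (y - 1)))\<^sup>2) =
     tri (r (l ! 0)) (r (l ! 1)) (r (l ! 2)) * tri (r (l ! 3)) (r (l ! 4)) (r (l ! 5)) *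
     ((r (l ! 0) - r (l ! 3)) * (r (l ! 1) - r (l ! 4)) * (r (l ! 2) - r (l ! 5)))\<^sup>2" for l
    by (simp add: tri_def power_mult_distrib mult.assoc)
  show ?thesis
    unfolding orbit_sum_prisms *
    by (simp add: prism_perms_def splits_def prism_six[symmetric] add.assoc)
qed

lemma matching_sum:
  fixes a b c x y z :: "'k::field"
  assumes "a + b + c = 0" "x\<^sup>2 = - 2 * b * c" "y\<^sup>2 = - 2 * a * c" "z\<^sup>2 = - 2 * a * b"
    and "r 1 = - a + x" "r 2 = - a - x" "r 3 = - b + y" "r 4 = - b - y" "r 5 = - c + z" "r 6 = - c - z"
  shows "orbit_sum r {{1,2}, {3,4}, {5,6}} =
    - 800 * (a * b + a * c + b * c) ^ 3 - 5880 * (a * b * c)\<^sup>2"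
proof -
  have c: "c = - (a + b)" using assms(1) by algebra
  have r: "r (Suc 0) = - a + x" using assms(5) by simp
  show ?thesis
    unfolding orbit_sum_matchings
    using assms(2-4) unfolding c
    by (simp add: matching_perms_def assms(6-10) r c) algebra
qed

text \<open>The six splits of the first kind come as three pairs (\<open>X1\<close> to
  \<open>X3\<close>), one for each critical point; the four of the second kind (\<open>Y1\<close> to
  \<open>Y4\<close>) come from one by sign changes. Their sums are symmetric and hence polynomials
  in \<open>A\<close> and \<open>B\<close>.\<close>

lemma model_invariants:
  fixes g1 g2 g3 w :: "'k::field"
  assumes K: "g1\<^sup>2 + g2\<^sup>2 + g3\<^sup>2 = 0" and w: "w\<^sup>2 = - 2"
    and r: "r 1 = - g1\<^sup>2 + w * g2 * g3" "r 2 = - g1\<^sup>2 - w * g2 * g3" "r 3 = - g2\<^sup>2 + w * g1 * g3"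
      "r 4 = - g2\<^sup>2 - w * g1 * g3" "r 5 = - g3\<^sup>2 + w * g1 * g2" "r 6 = - g3\<^sup>2 - w * g1 * g2"
    and A: "A = (g1\<^sup>2 * g2\<^sup>2 + g1\<^sup>2 * g3\<^sup>2 + g2\<^sup>2 * g3\<^sup>2) ^ 3" and B: "B = (g1 * g2 * g3) ^ 4"
  shows "J2 1 r = - 800 * A - 5880 * B"
    and "J4 1 r = 64 * A\<^sup>2 + 242784 * A * B + 2055780 * B\<^sup>2"
    and "J6 1 r = - 16896 * A ^ 3 - 61576576 * A\<^sup>2 * B - 843047136 * A * B\<^sup>2 - 3048065640 * B ^ 3"
    and "orbit_sum r (edges pairs6) = - 512 * B * (4 * A + 27 * B) ^ 4"
proof -
  define e t where "e = g1\<^sup>2 * g2\<^sup>2 + g1\<^sup>2 * g3\<^sup>2 + g2\<^sup>2 * g3\<^sup>2" and "t = g1 * g2 * g3"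
  have AB: "A = e ^ 3" "B = t ^ 4" unfolding A B e_def t_def by blast+
  have sq: "(w * x * y)\<^sup>2 = - 2 * x\<^sup>2 * y\<^sup>2" for x y by (simp add: power_mult_distrib w)
  have "orbit_sum r {{1,2}, {3,4}, {5,6}} = - 800 * (g1\<^sup>2 * g2\<^sup>2 + g1\<^sup>2 * g3\<^sup>2 + g2\<^sup>2 * g3\<^sup>2) ^ 3
      - 5880 * (g1\<^sup>2 * g2\<^sup>2 * g3\<^sup>2)\<^sup>2"
    by (rule matching_sum[OF K sq sq sq r])
  also have "(g1\<^sup>2 * g2\<^sup>2 * g3\<^sup>2)\<^sup>2 = t ^ 4" unfolding t_def by (simp add: power_mult_distrib flip: power_mult)
  finally show "J2 1 r = - 800 * A - 5880 * B" unfolding J2_def AB e_def by simp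
  let ?c1 = "g1\<^sup>2" and ?c2 = "g2\<^sup>2" and ?c3 = "g3\<^sup>2"
  note tI = type_I[where e = e and f = "t\<^sup>2"]
  have c123: "?c1 + ?c3 + ?c2 = 0" "?c1 + ?c2 + ?c3 = 0" "?c2 + ?c3 + ?c1 = 0"
    using K by (simp_all add: ac_simps)
  have e3: "e = ?c1 * ?c3 + ?c1 * ?c2 + ?c3 * ?c2" "e = ?c1 * ?c2 + ?c1 * ?c3 + ?c2 * ?c3"
    "e = ?c2 * ?c3 + ?c2 * ?c1 + ?c3 * ?c1" by (simp_all add: e_def ac_simps)
  have t3: "t\<^sup>2 = ?c1 * ?c3 * ?c2" "t\<^sup>2 = ?c1 * ?c2 * ?c3" "t\<^sup>2 = ?c2 * ?c3 * ?c1"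
    by (simp_all add: t_def power_mult_distrib ac_simps)
  have sq': "(w * x * y)\<^sup>2 = - 2 * y\<^sup>2 * x\<^sup>2" for x y by (simp add: sq)
  \<comment> \<open>Changing two of the signs of the g_i keeps their squares and \<open>t\<close>,
    but exchanges the two roots in two of the pairs; this produces the other three splits from the
    first.\<close>
  define s1 s2 s3 s4 u1 u2 u3 u4 where "s1 = g1 + g2 + g3" and "s2 = g1 + - g2 + - g3"
    and "s3 = - g1 + g2 + - g3" and "s4 = - g1 + - g2 + g3"
    and "u1 = g1 * g2 + g1 * g3 + g2 * g3" and "u2 = g1 * - g2 + g1 * - g3 + - g2 * - g3"
    and "u3 = - g1 * g2 + - g1 * - g3 + g2 * - g3" and "u4 = - g1 * - g2 + - g1 * g3 + - g2 * g3"
  \<comment> \<open>These three sums suffice because \<open>split_II4\<close> and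
    \<open>split_II6\<close> are linear in s, u and u s.\<close>
  have su: "s1 + s2 + s3 + s4 = 0" "u1 + u2 + u3 + u4 = 0"
    "u1 * s1 + u2 * s2 + u3 * s3 + u4 * s4 = 12 * t"
    unfolding s1_def s2_def s3_def s4_def u1_def u2_def u3_def u4_def t_def by algebra+
  \<comment> \<open>\<open>split_I4\<close> and \<open>split_I6\<close> are quadratic in c, so only
    the first two power sums of the critical points enter.\<close>
  have c2: "?c1\<^sup>2 + ?c2\<^sup>2 + ?c3\<^sup>2 = - 2 * e" unfolding e_def using K by algebra
  note II = type_II[where e = e and t = t]
  have t_eq: "t = g1 * - g2 * - g3" "t = - g1 * g2 * - g3" "t = - g1 * - g2 * g3"
    by (simp_all add: t_def)
  note X1 = tI[where a = ?c1 and b = ?c3 and c = ?c2 and x = "w * g2 * g3" and y = "w * g1 * g3" and z = "w * g1 * g2",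
      OF c123(1) sq' sq sq e3(1) t3(1), folded r]
  note X2 = tI[where a = ?c1 and b = ?c2 and c = ?c3 and x = "w * g2 * g3" and y = "w * g1 * g2" and z = "w * g1 * g3",
      OF c123(2) sq sq sq e3(2) t3(2), folded r]
  note X3 = tI[where a = ?c2 and b = ?c3 and c = ?c1 and x = "w * g1 * g3" and y = "w * g2 * g3" and z = "w * g1 * g2",
      OF c123(3) sq' sq sq' e3(3) t3(3), folded r]
  note Y1 = II[OF K w r(1,3,5,2,4,6) s1_def u1_def t_def e_def]
  note Y2 = II[of g1 "- g2" "- g3" w "r 1" "r 4" "r 6" "r 2" "r 3" "r 5", OF _ w _ _ _ _ _ _ s2_def u2_def t_eq(1)]
  note Y3 = II[of "- g1" g2 "- g3" w "r 2" "r 3" "r 6" "r 1" "r 4" "r 5", OF _ w _ _ _ _ _ _ s3_def u3_def t_eq(2)]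
  note Y4 = II[of "- g1" "- g2" g3 w "r 2" "r 4" "r 5" "r 1" "r 3" "r 6", OF _ w _ _ _ _ _ _ s4_def u4_def t_eq(3)]
  have J4_sum: "J4 1 r = split_I4 ?c1 e (t\<^sup>2) + split_I4 ?c2 e (t\<^sup>2) + split_I4 ?c3 e (t\<^sup>2) + (split_II4 s1 u1 t e + split_II4 s2 u2 t e + split_II4 s3 u3 t e + split_II4 s4 u4 t e)"
  proof -
    have y: "tri (r 1) (r 4) (r 6) * tri (r 2) (r 3) (r 5) = split_II4 s2 u2 t e"
      "tri (r 2) (r 3) (r 6) * tri (r 1) (r 4) (r 5) = split_II4 s3 u3 t e"
      "tri (r 2) (r 4) (r 5) * tri (r 1) (r 3) (r 6) = split_II4 s4 u4 t e"
      by (rule Y2(1) Y3(1) Y4(1); use K r in \<open>simp add: e_def\<close>)+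
    show ?thesis
      unfolding J4_def orbit_sum_tri splits_def
      using X1(1) X2(1) X3(1) Y1(1) y by simp
  qed
  show "J4 1 r = 64 * A\<^sup>2 + 242784 * A * B + 2055780 * B\<^sup>2"
    unfolding J4_sum split_I4_def split_II4_def AB using su c123(2) c2 by algebra
  have J6_sum: "J6 1 r = split_I6 ?c1 e (t\<^sup>2) + split_I6 ?c2 e (t\<^sup>2) + split_I6 ?c3 e (t\<^sup>2) + (split_II6 s1 u1 t e + split_II6 s2 u2 t e + split_II6 s3 u3 t e + split_II6 s4 u4 t e)"
  proof -
    have y: "tri (r 1) (r 4) (r 6) * tri (r 2) (r 3) (r 5) * perm6 (r 1) (r 4) (r 6) (r 2) (r 3) (r 5) = split_II6 s2 u2 t e"
      "tri (r 2) (r 3) (r 6) * tri (r 1) (r 4) (r 5) * perm6 (r 2) (r 3) (r 6) (r 1) (r 4) (r 5) = split_II6 s3 u3 t e"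
      "tri (r 2) (r 4) (r 5) * tri (r 1) (r 3) (r 6) * perm6 (r 2) (r 4) (r 5) (r 1) (r 3) (r 6) = split_II6 s4 u4 t e"
      by (rule Y2(2) Y3(2) Y4(2); use K r in \<open>simp add: e_def\<close>)+
    show ?thesis
      unfolding J6_def orbit_sum_perm6 splits_def
      using X1(2) X2(2) X3(2) Y1(2) y by simp
  qed
  show "J6 1 r = - 16896 * A ^ 3 - 61576576 * A\<^sup>2 * B - 843047136 * A * B\<^sup>2 - 3048065640 * B ^ 3"
    unfolding J6_sum split_I6_def split_II6_def AB using su c123(2) c2 by algebra
  have "orbit_sum r (edges pairs6) = tri (r 1) (r 3) (r 5) * tri (r 2) (r 4) (r 6) *
      ((r 1 - r 2) * (r 3 - r 4) * (r 5 - r 6) * ((r 1 - r 4) * (r 3 - r 2)) * ((r 1 - r 6) * (r 5 - r 2)) *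
       ((r 3 - r 6) * (r 5 - r 4)))\<^sup>2"
    unfolding orbit_sum_pairs tri_def unfolding pairs6_def
    by (simp add: power_mult_distrib power2_commute[of "r 5" "r (Suc 0)"] power2_commute[of "r 6" "r 2"]
        power2_commute[of "r 3" "r 2"] power2_commute[of "r 5" "r 2"] power2_commute[of "r 5" "r 4"] ac_simps)
  also have "\<dots> = - 512 * t ^ 4 * (4 * e ^ 3 + 27 * t ^ 4) ^ 4" by (rule Y1(3))
  finally show "orbit_sum r (edges pairs6) = - 512 * B * (4 * A + 27 * B) ^ 4" unfolding AB .
qed

text \<open>Written as an orbit sum, the discriminant is covered by \<open>orbit_sum_moebius\<close>
  like the other invariants.\<close>

lemma J10_edges: "J10 a r = a ^ 10 * orbit_sum r (edges pairs6)"
proof -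
  have "{1..6} = {1, 2, 3, 4, 5, 6 :: nat}" "{1..<1} = ({} :: nat set)" "{1..<2} = {1 :: nat}"
    "{1..<3} = {1, 2 :: nat}" "{1..<4} = {1, 2, 3 :: nat}" "{1..<5} = {1, 2, 3, 4 :: nat}"
    "{1..<6} = {1, 2, 3, 4, 5 :: nat}" by auto
  then show ?thesis
    unfolding J10_def orbit_sum_pairs unfolding pairs6_def by (simp add: ac_simps)
qed

lemma regular_edge_sets:
  "regular 1 {{1,2}, {3,4}, {5,6}}"
  "regular 2 {{1,2}, {2,3}, {3,1}, {4,5}, {5,6}, {6,4}}"
  "regular 3 {{1,2}, {2,3}, {3,1}, {4,5}, {5,6}, {6,4}, {1,4}, {2,5}, {3,6}}"
  "regular 5 (edges pairs6)"
proof -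
  have "regular 1 (edges [(1,2),(3,4),(5,6)])" by (rule regular_edges; code_simp)
  then show "regular 1 {{1,2}, {3,4}, {5,6}}" by (simp add: edges_def)
  have "regular 2 (edges [(1,2),(2,3),(3,1),(4,5),(5,6),(6,4)])" by (rule regular_edges; code_simp)
  then show "regular 2 {{1,2}, {2,3}, {3,1}, {4,5}, {5,6}, {6,4}}" by (simp add: edges_def)
  have "regular 3 (edges [(1,2),(2,3),(3,1),(4,5),(5,6),(6,4),(1,4),(2,5),(3,6)])"
    by (rule regular_edges; code_simp)
  then show "regular 3 {{1,2}, {2,3}, {3,1}, {4,5}, {5,6}, {6,4}, {1,4}, {2,5}, {3,6}}"
    by (simp add: edges_def)
  show "regular 5 (edges pairs6)" by (rule regular_edges; code_simp)
qed

section \<open>Rational functions in one variable\<close>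

context
  fixes h :: "'a::field \<Rightarrow> 'b::field"
  assumes h: "field_embedding h"
begin

lemma emb_one: "h 1 = 1" and emb_add: "h (x + y) = h x + h y" and emb_mult: "h (x * y) = h x * h y"
  using h by (auto simp: field_embedding_def)

lemma emb_zero: "h 0 = 0"
  by (metis add_cancel_right_right add_0 emb_add)

lemma emb_uminus: "h (- x) = - h x"
  using emb_add[of x "- x"] by (simp add: emb_zero eq_neg_iff_add_eq_0 add.commute)

lemma emb_diff: "h (x - y) = h x - h y"
  using emb_add[of x "- y"] by (simp add: emb_uminus)

lemma emb_eq_zero_iff: "h x = 0 \<longleftrightarrow> x = 0"
  using emb_mult[of x "inverse x"] by (cases "x = 0") (auto simp: emb_zero emb_one)

lemma emb_inverse: "h (inverse x) = inverse (h x)"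
proof (cases "x = 0")
  case False
  then have "h x * h (inverse x) = 1"
    by (simp add: emb_one flip: emb_mult)
  then show ?thesis
    by (metis inverse_unique)
qed (auto simp: emb_zero)

lemma emb_divide: "h (x / y) = h x / h y"
  by (simp add: divide_inverse emb_mult emb_inverse)

lemma emb_power: "h (x ^ n) = h x ^ n"
  by (induction n) (auto simp: emb_mult emb_one)

lemma emb_prod: "h (prod f S) = (\<Prod>i\<in>S. h (f i))"
  by (induction S rule: infinite_finite_induct) (auto simp: emb_mult emb_one)

lemma emb_numeral: "h (numeral n) = numeral n"
proof -
  have "h (of_nat k) = of_nat k" for k
    by (induction k) (auto simp: emb_add emb_zero emb_one)
  from this[of "numeral n"] show ?thesis by simp
qed

lemma emb_eq_iff: "h x = h y \<longleftrightarrow> x = y"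
  using emb_eq_zero_iff[of "x - y"] by (simp add: emb_diff)

lemma emb_inj: "inj h"
  by (auto intro: injI simp: emb_eq_iff)

lemma emb_inv: "inv h (h x) = x"
  by (simp add: emb_inj)

end

lemmas emb_ring = emb_add emb_mult emb_diff emb_uminus emb_power
lemmas emb_simps = emb_ring emb_one emb_zero emb_inverse emb_divide emb_prod

lemma field_embedding_comp:
  "field_embedding h \<Longrightarrow> field_embedding g \<Longrightarrow> field_embedding (h \<circ> g)"
  by (auto simp: field_embedding_def)

lemma morphism_emb: "morphism C E h \<Longrightarrow> field_embedding h"
  by (auto simp: morphism_def)

lemma morphism_const: "morphism C E h \<Longrightarrow> h (E a) = C a"
  by (auto simp: morphism_def)

lemma morphism_comp: "morphism C E h \<Longrightarrow> morphism E F g \<Longrightarrow> morphism C F (h \<circ> g)"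
  by (auto simp: morphism_def field_embedding_comp)

lemma morphism_inv:
  assumes h: "morphism C E h" and "bij h"
  shows "morphism E C (inv h)"
proof -
  note e = morphism_emb[OF h]
  have s: "h (inv h x) = x" for x
    using \<open>bij h\<close> by (simp add: bij_is_surj surj_f_inv_f)
  have i: "inv h x = y" if "h y = x" for x y
    using that emb_inv[OF e] by auto
  show ?thesis
    unfolding morphism_def field_embedding_def
    by (auto intro!: i simp: s emb_simps[OF e] morphism_const[OF h])
qed

text \<open>A unital ring homomorphism, with no injectivity implied: the specializations of
  polynomials at a point, used further below, are of this kind.\<close>

definition ring_embedding :: "('a::comm_ring_1 \<Rightarrow> 'b::comm_ring_1) \<Rightarrow> bool" where
  "ring_embedding h \<longleftrightarrow>
     h 1 = 1 \<and> (\<forall>x y. h (x + y) = h x + h y) \<and> (\<forall>x y. h (x * y) = h x * h y)"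

lemma field_ring_embedding: "field_embedding h \<Longrightarrow> ring_embedding h"
  by (simp add: field_embedding_def ring_embedding_def)

definition ev :: "('a::comm_ring_1 \<Rightarrow> 'b::comm_ring_1) \<Rightarrow> 'b \<Rightarrow> 'a poly \<Rightarrow> 'b" where
  "ev C s p = poly (map_poly C p) s"

context
  fixes C :: "'a::comm_ring_1 \<Rightarrow> 'b::comm_ring_1"
  assumes C: "ring_embedding C"
begin

lemma hom_one: "C 1 = 1" and hom_add: "C (x + y) = C x + C y" and hom_mult: "C (x * y) = C x * C y"
  using C by (auto simp: ring_embedding_def)

lemma hom_zero: "C 0 = 0"
  by (metis add_cancel_right_right add_0 hom_add)

lemma hom_uminus: "C (- x) = - C x"
  using hom_add[of x "- x"] by (simp add: hom_zero eq_neg_iff_add_eq_0 add.commute)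

lemmas hom_simps = hom_one hom_add hom_mult hom_zero hom_uminus

lemma hom_ev_pCons: "ev C s (pCons a p) = C a + s * ev C s p"
  by (simp add: ev_def map_poly_pCons hom_zero)

lemma hom_ev_0: "ev C s 0 = 0"
  by (simp add: ev_def)

lemma hom_ev_1: "ev C s 1 = 1"
  by (simp add: one_pCons hom_ev_pCons hom_ev_0 hom_simps)

lemma hom_ev_add: "ev C s (p + q) = ev C s p + ev C s q"
  by (induction p q rule: poly_induct2) (auto simp: hom_ev_pCons hom_ev_0 hom_simps algebra_simps)

lemma hom_ev_smult: "ev C s (smult a p) = C a * ev C s p"
  by (induction p) (auto simp: hom_ev_pCons hom_ev_0 hom_simps algebra_simps)

lemma hom_ev_mult: "ev C s (p * q) = ev C s p * ev C s q"
  by (induction p) (auto simp: hom_ev_pCons hom_ev_0 hom_ev_add hom_ev_smult hom_simps algebra_simps)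

lemma hom_ev_uminus: "ev C s (- p) = - ev C s p"
  using hom_ev_smult[of s "-1" p] by (simp add: hom_simps)

lemma hom_ev_diff: "ev C s (p - q) = ev C s p - ev C s q"
  using hom_ev_add[of s p "- q"] by (simp add: hom_ev_uminus)

lemma hom_ev_power: "ev C s (p ^ n) = ev C s p ^ n"
  by (induction n) (auto simp: hom_ev_mult hom_ev_1)

lemma hom_ev_prod: "ev C s (prod f S) = (\<Prod>i\<in>S. ev C s (f i))"
  by (induction S rule: infinite_finite_induct) (auto simp: hom_ev_mult hom_ev_1)

end

lemmas hom_ev_simps = hom_ev_pCons hom_ev_0 hom_ev_1 hom_ev_add hom_ev_smult hom_ev_mult
  hom_ev_uminus hom_ev_diff hom_ev_power hom_ev_prod
lemmas ev_simps = hom_ev_simps[OF field_ring_embedding]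
lemmas ev_mult = hom_ev_mult[OF field_ring_embedding]

lemma ev_morphism:
  assumes C: "field_embedding C" and h: "morphism D C h"
  shows "h (ev C s p) = ev D (h s) p"
proof -
  have "D 0 = 0"
    using morphism_const[OF h, of 0] by (simp add: emb_zero[OF C] emb_zero[OF morphism_emb[OF h]])
  then show ?thesis
    by (induction p)
      (auto simp: ev_def map_poly_pCons emb_zero[OF C] emb_simps[OF morphism_emb[OF h]]
        morphism_const[OF h])
qed

abbreviation X :: "'k::field poly fract" where "X \<equiv> to_fract [:0, 1:]"

lemma P1_emb: "field_embedding P1"
  by (auto simp: field_embedding_def P1_def to_fract_def One_fract_def mult.commute simp flip: one_pCons)

lemma to_fract_ev: "to_fract p = ev P1 X p"
proof (induction p)
  case (pCons a p)
  have "to_fract (pCons a p) = P1 a + X * to_fract p"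
    by (simp add: P1_def flip: to_fract_mult to_fract_add)
  with pCons show ?case by (simp add: ev_simps[OF P1_emb])
qed (simp add: ev_simps[OF P1_emb])

lemma morphism_to_fract:
  assumes "morphism C P1 h"
  shows "h (to_fract p) = ev C (h X) p"
  by (subst to_fract_ev) (rule ev_morphism[OF P1_emb assms])

lemma fract_cases_poly:
  obtains p q where "z = to_fract p / to_fract q" "q \<noteq> (0::'k::field poly)"
  by (cases z) (auto simp: to_fract_def)

lemma morphism_quotient:
  assumes "morphism C P1 h"
  shows "h (to_fract p / to_fract q) = ev C (h X) p / ev C (h X) q"
  by (simp only: emb_divide[OF morphism_emb[OF assms]] morphism_to_fract[OF assms, of p]
      morphism_to_fract[OF assms, of q])

lemma morphism_eqI:
  assumes "morphism C P1 h" "morphism C P1 g" "h X = g X"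
  shows "h = g"
proof
  fix z
  show "h z = g z"
    by (cases z rule: fract_cases_poly)
      (simp only: morphism_quotient[OF assms(1)] morphism_quotient[OF assms(2)] assms(3))
qed

section \<open>Transcendental elements and the morphisms that they define\<close>

definition transcendental :: "('k::field \<Rightarrow> 'c::field) \<Rightarrow> 'c \<Rightarrow> bool" where
  "transcendental C s \<longleftrightarrow> (\<forall>p. ev C s p = 0 \<longrightarrow> p = 0)"

text \<open>Over an algebraically closed k a polynomial relation splits into linear factors, none of
  which vanishes at an element outside k.\<close>

lemma transcendentalI:
  fixes C :: "'k::alg_closed_field \<Rightarrow> 'c::field"
  assumes C: "field_embedding C" and s: "s \<notin> range C"
  shows "transcendental C s"
  unfolding transcendental_def
proof (intro allI impI)
  fix p :: "'k poly"
  assume "ev C s p = 0"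
  then show "p = 0"
  proof (induction "degree p" arbitrary: p)
    case 0
    then show ?case
      by (auto elim!: degree_eq_zeroE simp: ev_simps[OF C] emb_eq_zero_iff[OF C])
  next
    case (Suc n)
    then obtain a where "poly p a = 0"
      using alg_closed_imp_poly_has_root[of p] by auto
    then obtain q where q: "p = [:-a, 1:] * q"
      by (metis poly_eq_0_iff_dvd dvdE)
    have "s \<noteq> C a" using s by auto
    with Suc.prems q have "ev C s q = 0"
      by (simp add: ev_simps[OF C] emb_simps[OF C] del: mult_pCons_left)
    moreover have "n = degree q"
      using Suc.hyps(2) by (cases "q = 0") (auto simp: q degree_mult_eq simp del: mult_pCons_left)
    ultimately show ?case
      using Suc.hyps(1)[of q] q by (simp del: mult_pCons_left)
  qed
qed

text \<open>The comorphism k(x) -> k(C) with x -> s. The choice ranges over all ways to write the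
  argument as a quotient; for transcendental \<open>s\<close> all of them give the same
  value.\<close>

definition subst :: "('k::field \<Rightarrow> 'c::field) \<Rightarrow> 'c \<Rightarrow> 'k poly fract \<Rightarrow> 'c" where
  "subst C s z = (SOME w. \<exists>p q. q \<noteq> 0 \<and> z = to_fract p / to_fract q \<and> w = ev C s p / ev C s q)"

lemma fract_eq_iff:
  fixes q :: "'k::field poly"
  assumes "q \<noteq> 0" "q' \<noteq> 0"
  shows "to_fract p / to_fract q = to_fract p' / to_fract q' \<longleftrightarrow> p * q' = p' * q"
  using assms by (auto simp: to_fract_def eq_fract)

context
  fixes C :: "'k::field \<Rightarrow> 'c::field" and s
  assumes C: "field_embedding C" and s: "transcendental C s"
begin

lemma subst_quotient:
  assumes "q \<noteq> 0"
  shows "subst C s (to_fract p / to_fract q) = ev C s p / ev C s q"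
proof -
  have nz: "ev C s r \<noteq> 0" if "r \<noteq> 0" for r
    using s that by (auto simp: transcendental_def)
  show ?thesis
    unfolding subst_def
  proof (rule some_equality)
    fix w assume "\<exists>p' q'. q' \<noteq> 0 \<and> to_fract p / to_fract q = to_fract p' / to_fract q' \<and>
      w = ev C s p' / ev C s q'"
    then obtain p' q' where *: "q' \<noteq> 0" "p * q' = p' * q" "w = ev C s p' / ev C s q'"
      using fract_eq_iff[OF assms] by metis
    have "ev C s p * ev C s q' = ev C s p' * ev C s q"
      using *(2) by (simp flip: ev_mult[OF C])
    then show "w = ev C s p / ev C s q"
      using * assms by (simp add: nz frac_eq_eq)
  qed (use assms in auto)
qed

lemma subst_to_fract: "subst C s (to_fract p) = ev C s p"
  using subst_quotient[of 1 p] by (simp add: ev_simps[OF C])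

lemma subst_X [simp]: "subst C s X = s"
  by (simp add: subst_to_fract ev_simps[OF C] emb_simps[OF C])

lemma subst_morphism: "morphism C P1 (subst C s)"
proof -
  have nz: "ev C s r \<noteq> 0" if "r \<noteq> 0" for r
    using s that by (auto simp: transcendental_def)
  have "subst C s (x + y) = subst C s x + subst C s y" for x y
  proof -
    obtain p q where x: "x = to_fract p / to_fract q" "q \<noteq> 0" by (rule fract_cases_poly)
    obtain p' q' where y: "y = to_fract p' / to_fract q'" "q' \<noteq> 0" by (rule fract_cases_poly)
    have "x + y = to_fract (p * q' + p' * q) / to_fract (q * q')"
      using x y by (simp add: add_frac_eq)
    then have "subst C s (x + y) = ev C s (p * q' + p' * q) / ev C s (q * q')"
      using x y by (simp only: subst_quotient mult_eq_0_iff simp_thms)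
    then show ?thesis
      using x y by (simp add: subst_quotient ev_simps[OF C] nz add_frac_eq)
  qed
  moreover have "subst C s (x * y) = subst C s x * subst C s y" for x y
  proof -
    obtain p q where x: "x = to_fract p / to_fract q" "q \<noteq> 0" by (rule fract_cases_poly)
    obtain p' q' where y: "y = to_fract p' / to_fract q'" "q' \<noteq> 0" by (rule fract_cases_poly)
    have "x * y = to_fract (p * p') / to_fract (q * q')"
      using x y by simp
    then have "subst C s (x * y) = ev C s (p * p') / ev C s (q * q')"
      using x y by (simp only: subst_quotient mult_eq_0_iff simp_thms)
    then show ?thesis
      using x y by (simp add: subst_quotient ev_simps[OF C] nz)
  qed
  moreover have "subst C s 1 = 1"
    using subst_to_fract[of 1] by (simp add: ev_simps[OF C])
  ultimately show ?thesis
    by (auto simp: morphism_def field_embedding_def P1_def subst_to_fract ev_simps[OF C])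
qed

end

section \<open>Points of the projective line\<close>

text \<open>A point without the normalization. The restriction of a point to a subfield is in
  general only a multiple of a point, and a priori may even be trivial.\<close>

definition valuation :: "('k::field \<Rightarrow> 'c::field) \<Rightarrow> ('c \<Rightarrow> int) \<Rightarrow> bool" where
  "valuation C V \<longleftrightarrow>
     V 0 = 0 \<and>
     (\<forall>x y. x \<noteq> 0 \<longrightarrow> y \<noteq> 0 \<longrightarrow> V (x * y) = V x + V y) \<and>
     (\<forall>x y. x \<noteq> 0 \<longrightarrow> y \<noteq> 0 \<longrightarrow> x + y \<noteq> 0 \<longrightarrow> min (V x) (V y) \<le> V (x + y)) \<and>
     (\<forall>a. V (C a) = 0)"

lemma point_iff_valuation: "point C P \<longleftrightarrow> valuation C P \<and> (\<exists>x. P x = 1)"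
  by (auto simp: point_def valuation_def)

lemma point_valuation: "point C P \<Longrightarrow> valuation C P"
  by (simp add: point_iff_valuation)

lemma valuation_comp:
  assumes "valuation C V" "morphism C E h"
  shows "valuation E (V \<circ> h)"
proof -
  note e = morphism_emb[OF assms(2)]
  have "h x + h y \<noteq> 0" if "x + y \<noteq> 0" for x y
    using that by (simp add: emb_eq_zero_iff[OF e] flip: emb_add[OF e])
  then show ?thesis
    using assms(1) unfolding valuation_def
    by (auto simp: emb_simps[OF e] emb_eq_zero_iff[OF e] morphism_const[OF assms(2)])
qed

context
  fixes C :: "'k::field \<Rightarrow> 'c::field" and V
  assumes V: "valuation C V" and C: "field_embedding C"
begin

lemma val_0: "V 0 = 0" and val_mult: "x \<noteq> 0 \<Longrightarrow> y \<noteq> 0 \<Longrightarrow> V (x * y) = V x + V y"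
  and val_add: "x \<noteq> 0 \<Longrightarrow> y \<noteq> 0 \<Longrightarrow> x + y \<noteq> 0 \<Longrightarrow> min (V x) (V y) \<le> V (x + y)"
  and val_const: "V (C a) = 0"
  using V by (auto simp: valuation_def)

lemma val_1: "V 1 = 0"
  using val_const[of 1] C by (simp add: emb_one)

lemma val_uminus: "V (- x) = V x"
proof (cases "x = 0")
  case False
  have "V (C (-1)) = 0" by (rule val_const)
  then have "V (-1) = 0" by (simp add: emb_simps[OF C] emb_one[OF C])
  then show ?thesis
    using val_mult[of "-1" x] False by simp
qed simp

lemma val_inverse: "V (inverse x) = - V x"
proof (cases "x = 0")
  case False
  then show ?thesis
    using val_mult[of x "inverse x"] by (simp add: val_1)
qed (simp add: val_0)

lemma val_divide: "x \<noteq> 0 \<Longrightarrow> y \<noteq> 0 \<Longrightarrow> V (x / y) = V x - V y"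
  by (simp add: divide_inverse val_mult val_inverse)

lemma val_power: "V (x ^ n) = int n * V x"
proof (cases "x = 0")
  case True
  then show ?thesis by (cases n) (auto simp: val_0 val_1)
next
  case False
  then show ?thesis by (induction n) (auto simp: val_1 val_mult algebra_simps)
qed

lemma val_power_int: "x \<noteq> 0 \<Longrightarrow> V (x powi n) = n * V x"
  by (auto simp: power_int_def val_power val_inverse)

lemma val_add_eq:
  assumes "x \<noteq> 0" "y \<noteq> 0" "V x < V y"
  shows "x + y \<noteq> 0" "V (x + y) = V x"
proof -
  show *: "x + y \<noteq> 0"
    using assms val_uminus[of x] by (metis add.inverse_unique less_irrefl)
  have "min (V (x + y)) (V (- y)) \<le> V (x + y + - y)"
    by (rule val_add) (use assms * in auto)
  then show "V (x + y) = V x"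
    using val_add[of x y] assms * val_uminus[of y] by (auto simp: min_def split: if_splits)
qed

end

text \<open>Extends an order function from nonzero polynomials to quotients. The value at 0 is 0, in
  accordance with the convention for points.\<close>

definition fract_val :: "('k::field poly \<Rightarrow> int) \<Rightarrow> 'k poly fract \<Rightarrow> int" where
  "fract_val v z = (SOME n. \<exists>p q. q \<noteq> 0 \<and> z = to_fract p / to_fract q \<and>
     n = (if p = 0 then 0 else v p - v q))"

context
  fixes v :: "'k::field poly \<Rightarrow> int"
  assumes v_mult: "\<And>p q. p \<noteq> 0 \<Longrightarrow> q \<noteq> 0 \<Longrightarrow> v (p * q) = v p + v q"
begin

lemma fract_val_quotient:
  assumes "q \<noteq> 0" "p \<noteq> 0"
  shows "fract_val v (to_fract p / to_fract q) = v p - v q"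
  unfolding fract_val_def
proof (rule some_equality)
  fix n assume "\<exists>p' q'. q' \<noteq> 0 \<and> to_fract p / to_fract q = to_fract p' / to_fract q' \<and>
      n = (if p' = 0 then 0 else v p' - v q')"
  then obtain p' q' where *: "q' \<noteq> 0" "p * q' = p' * q" "n = (if p' = 0 then 0 else v p' - v q')"
    using fract_eq_iff[OF assms(1)] by metis
  moreover have "p' \<noteq> 0" using * assms by auto
  moreover have "v p + v q' = v p' + v q"
    using v_mult[of p q'] v_mult[of p' q] * assms \<open>p' \<noteq> 0\<close> by simp
  ultimately show "n = v p - v q" by simp
qed (use assms in auto)

lemma fract_val_0: "fract_val v 0 = 0"
  unfolding fract_val_def
  by (rule some_equality, rule exI[of _ 0], rule exI[of _ 1]) auto

lemma fract_val_to_fract: "p \<noteq> 0 \<Longrightarrow> fract_val v (to_fract p) = v p"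
  using fract_val_quotient[of 1 p] v_mult[of 1 1] by simp

lemma fract_val_valuation:
  assumes v_add: "\<And>p q. p \<noteq> 0 \<Longrightarrow> q \<noteq> 0 \<Longrightarrow> p + q \<noteq> 0 \<Longrightarrow> min (v p) (v q) \<le> v (p + q)"
    and v_const: "\<And>a. a \<noteq> 0 \<Longrightarrow> v [:a:] = 0"
  shows "valuation P1 (fract_val v)"
  unfolding valuation_def
proof (intro conjI allI impI)
  show "fract_val v 0 = 0" by (rule fract_val_0)
  show "fract_val v (P1 a) = 0" for a
    by (cases "a = 0") (auto simp: P1_def fract_val_0 fract_val_to_fract v_const)
  fix x y :: "'k poly fract"
  assume x0: "x \<noteq> 0" and y0: "y \<noteq> 0"
  obtain p q where x: "x = to_fract p / to_fract q" "q \<noteq> 0" by (rule fract_cases_poly)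
  obtain p' q' where y: "y = to_fract p' / to_fract q'" "q' \<noteq> 0" by (rule fract_cases_poly)
  have nz: "p \<noteq> 0" "p' \<noteq> 0" using x0 y0 x y by auto
  have *: "x * y = to_fract (p * p') / to_fract (q * q')"
    using x y by simp
  show "fract_val v (x * y) = fract_val v x + fract_val v y"
    using x y nz unfolding * by (subst fract_val_quotient) (auto simp: fract_val_quotient v_mult)
  assume xy: "x + y \<noteq> 0"
  have *: "x + y = to_fract (p * q' + p' * q) / to_fract (q * q')"
    using x y by (simp add: add_frac_eq)
  with xy have "p * q' + p' * q \<noteq> 0" by (metis to_fract_0 div_0)
  then show "min (fract_val v x) (fract_val v y) \<le> fract_val v (x + y)"
    using x y nz v_add[of "p * q'" "p' * q"] unfolding *
    by (subst fract_val_quotient) (auto simp: fract_val_quotient v_mult)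
qed

end

definition ord_at :: "'k::field \<Rightarrow> 'k poly fract \<Rightarrow> int" where
  "ord_at a = fract_val (\<lambda>p. int (order a p))"

definition ord_inf :: "'k::field poly fract \<Rightarrow> int" where
  "ord_inf = fract_val (\<lambda>p. - int (degree p))"

lemma order_add_ge:
  assumes "p + q \<noteq> 0"
  shows "min (order a p) (order a q) \<le> order a (p + q)"
proof -
  let ?m = "min (order a p) (order a q)"
  have "[:-a, 1:] ^ ?m dvd p" "[:-a, 1:] ^ ?m dvd q"
    using order_1 by (meson le_imp_power_dvd dvd_trans min.cobounded1 min.cobounded2)+
  then have "[:-a, 1:] ^ ?m dvd p + q" by (rule dvd_add)
  with assms show ?thesis by (simp add: order_divides)
qed

lemma ord_at_valuation: "valuation P1 (ord_at a)"
  unfolding ord_at_def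
proof (rule fract_val_valuation)
  show "min (int (order a p)) (int (order a q)) \<le> int (order a (p + q))"
    if "p + q \<noteq> 0" for p q
    using order_add_ge[OF that, of a] by simp
qed (auto simp: order_mult order_0I)

lemma ord_inf_valuation: "valuation P1 ord_inf"
  unfolding ord_inf_def
proof (rule fract_val_valuation)
  show "min (- int (degree p)) (- int (degree q)) \<le> - int (degree (p + q))"
    for p q :: "'a poly"
    using degree_add_le_max[of p q] by simp
qed (auto simp: degree_mult_eq)

lemma ord_at_to_fract: "p \<noteq> 0 \<Longrightarrow> ord_at a (to_fract p) = int (order a p)"
  unfolding ord_at_def by (rule fract_val_to_fract) (auto simp: order_mult)

lemma ord_inf_to_fract: "p \<noteq> 0 \<Longrightarrow> ord_inf (to_fract p) = - int (degree p)"
  unfolding ord_inf_def by (rule fract_val_to_fract) (auto simp: degree_mult_eq)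

lemma X_minus: "X - P1 a = to_fract [:-a, 1:]"
  by (simp add: P1_def flip: to_fract_diff)

lemma X_neq_P1 [simp]: "X \<noteq> P1 a"
proof -
  have "X - P1 a \<noteq> 0" by (simp add: X_minus)
  then show ?thesis by simp
qed

lemma X_neq_0 [simp]: "X \<noteq> 0"
  using X_neq_P1[of 0] by (simp add: P1_def)

lemma order_linear: "order a [:-b, 1:] = (if a = b then 1 else 0)"
  using order_power_n_n[of a 1] by (auto intro: order_0I)

lemma ord_at_linear: "ord_at a (X - P1 b) = (if a = b then 1 else 0)"
  by (simp add: X_minus ord_at_to_fract order_linear)

lemma ord_inf_linear: "ord_inf (X - P1 b) = - 1"
  by (simp add: X_minus ord_inf_to_fract)

lemma ord_at_point: "point P1 (ord_at a)"
  using ord_at_linear[of a a] by (auto simp: point_iff_valuation ord_at_valuation)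

lemma ord_at_eq_iff [simp]: "ord_at a = ord_at b \<longleftrightarrow> a = b"
  using ord_at_linear[of a a] ord_at_linear[of b a] by (auto split: if_splits)

lemma ord_at_neq_inf [simp]: "ord_at a \<noteq> ord_inf" "ord_inf \<noteq> ord_at a"
  using ord_at_linear[of a a] ord_inf_linear[of a] by auto

text \<open>Polynomials split into linear factors, so the values at x - a determine a valuation. The
  factor \<open>n\<close> will be a ramification index.\<close>

lemma valuation_eqI:
  fixes V W :: "'k::alg_closed_field poly fract \<Rightarrow> int"
  assumes V: "valuation P1 V" and W: "valuation P1 W"
    and eq: "\<And>a. V (X - P1 a) = n * W (X - P1 a)"
  shows "V z = n * W z"
proof -
  have *: "V (to_fract p) = n * W (to_fract p)" if "p \<noteq> 0" for p
    using that
  proof (induction "degree p" arbitrary: p)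
    case 0
    then obtain a where "p = [:a:]" by (auto elim!: degree_eq_zeroE)
    then show ?case
      using val_const[OF V P1_emb, of a] val_const[OF W P1_emb, of a] by (simp add: P1_def)
  next
    case (Suc m)
    then obtain a where "poly p a = 0"
      using alg_closed_imp_poly_has_root[of p] by auto
    then obtain q where q: "p = [:-a, 1:] * q"
      by (metis poly_eq_0_iff_dvd dvdE)
    have q0: "q \<noteq> 0" using q Suc.prems by auto
    then have "m = degree q"
      using Suc.hyps(2) by (auto simp: q degree_mult_eq simp del: mult_pCons_left)
    moreover have "to_fract p = (X - P1 a) * to_fract q"
      by (simp add: q X_minus del: mult_pCons_left)
    ultimately show ?case
      using Suc.hyps(1)[of q] eq[of a] q0
      by (simp add: val_mult[OF V P1_emb] val_mult[OF W P1_emb] distrib_left)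
  qed
  obtain p q where z: "z = to_fract p / to_fract q" "q \<noteq> 0" by (rule fract_cases_poly)
  show ?thesis
    using z * by (cases "p = 0")
      (auto simp: val_0[OF V P1_emb] val_0[OF W P1_emb] val_divide[OF V P1_emb] val_divide[OF W P1_emb]
        algebra_simps)
qed

text \<open>The classification of valuations of k(x) over k. A negative value at x forces the place
  at infinity. Otherwise at most one x - a has positive value, since two of them would give the
  nonzero constant a - b a positive value.\<close>

lemma valuation_P1_cases:
  fixes V :: "'k::alg_closed_field poly fract \<Rightarrow> int"
  assumes V: "valuation P1 V"
  obtains (trivial) "\<And>z. V z = 0"
  | (finite) a where "V (X - P1 a) > 0" "\<And>z. V z = V (X - P1 a) * ord_at a z"
  | (infinite) "V X < 0" "\<And>z. V z = (- V X) * ord_inf z"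
proof -
  have sh: "P1 (a - b) + (X - P1 a) = X - P1 b" for a b :: 'k
    by (simp add: emb_simps[OF P1_emb])
  have sh0: "X + P1 (- b) = X - P1 b" for b :: 'k
    by (simp add: emb_simps[OF P1_emb])
  have X0: "X - P1 0 = (X :: 'k poly fract)" by (simp add: emb_zero[OF P1_emb])
  have c0: "P1 c \<noteq> 0" "V (P1 c) = 0" if "c \<noteq> 0" for c
    using that by (auto simp: emb_eq_zero_iff[OF P1_emb] val_const[OF V P1_emb])
  show thesis
  proof (cases "V X < 0")
    case True
    have *: "V (X - P1 a) = V X" for a
      using val_add_eq(2)[OF V P1_emb, of X "P1 (- a)"] True c0[of "- a"] X0
      by (cases "a = 0") (auto simp: sh0)
    have "V z = (- V X) * ord_inf z" for z
      by (rule valuation_eqI[OF V ord_inf_valuation]) (simp only: * ord_inf_linear mult_minus1_right minus_minus)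
    then show thesis by (rule infinite[OF True])
  next
    case False
    have ge: "V (X - P1 b) \<ge> 0" for b
      using val_add[OF V P1_emb, of X "P1 (- b)"] False c0[of "- b"] X0
      by (cases "b = 0") (auto simp: sh0)
    show thesis
    proof (cases "\<exists>a. V (X - P1 a) > 0")
      case True
      then obtain a where a: "V (X - P1 a) > 0" by auto
      have *: "V (X - P1 b) = 0" if "b \<noteq> a" for b
        using val_add_eq(2)[OF V P1_emb, of "P1 (a - b)" "X - P1 a"] that c0[of "a - b"] a
        by (auto simp: sh)
      have "V z = V (X - P1 a) * ord_at a z" for z
        by (rule valuation_eqI[OF V ord_at_valuation]) (auto simp: ord_at_linear *)
      then show thesis by (rule finite[OF a])
    next
      case False
      then have *: "V (X - P1 a) = 0" for a using ge[of a] by (meson not_less antisym)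
      have "V z = 0 * ord_inf z" for z
        by (rule valuation_eqI[OF V ord_inf_valuation]) (simp only: * mult_zero_left)
      then show thesis by (intro trivial) simp
    qed
  qed
qed

lemma point_P1_cases:
  fixes P :: "'k::alg_closed_field poly fract \<Rightarrow> int"
  assumes P: "point P1 P"
  obtains (finite) a where "P = ord_at a" | (infinite) "P = ord_inf"
proof -
  obtain x where x: "P x = 1" using P by (auto simp: point_def)
  from P have "valuation P1 P" by (rule point_valuation)
  then show thesis
  proof (cases rule: valuation_P1_cases)
    case trivial
    then show ?thesis using x by simp
  next
    case (finite a)
    have "P (X - P1 a) * ord_at a x = 1" using finite(2)[of x] x by linarith
    then have "P (X - P1 a) = 1" using finite(1) pos_zmult_eq_1_iff by blast
    then have "P z = ord_at a z" for z using finite(2)[of z] by simp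
    then show ?thesis by (intro that(1)[of a] ext)
  next
    case infinite
    have "(- P X) * ord_inf x = 1" using infinite(2)[of x] x by linarith
    then have "- P X = 1" using infinite(1) pos_zmult_eq_1_iff[of "- P X" "ord_inf x"] by linarith
    then have "P z = ord_inf z" for z using infinite(2)[of z] by simp
    then show ?thesis by (intro that(2) ext)
  qed
qed

section \<open>Double covers of the projective line\<close>

lemma morphism_base_emb: "morphism C P1 h \<Longrightarrow> field_embedding C"
proof -
  assume h: "morphism C P1 h"
  then have "C = h \<circ> P1" by (auto simp: morphism_const)
  then show ?thesis
    using field_embedding_comp[OF morphism_emb[OF h] P1_emb] by simp
qed

lemma val_prod:
  assumes "valuation C V" "field_embedding C" "\<And>i. i \<in> S \<Longrightarrow> f i \<noteq> 0"
  shows "V (prod f S) = (\<Sum>i\<in>S. V (f i))"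
  using assms(3)
  by (induction S rule: infinite_finite_induct)
    (auto simp: val_1[OF assms(1,2)] val_mult[OF assms(1,2)])

text \<open>Dividing a basis u, v by u gives the basis 1, t.\<close>

lemma morphism_degree_2:
  fixes h :: "'a::field \<Rightarrow> 'b::field"
  assumes h: "field_embedding h" and "morphism_degree h = 2"
  obtains t where "t \<notin> range h" "\<And>z. \<exists>a b. z = h a + h b * t"
proof -
  interpret vector_space "\<lambda>a x. h a * x"
    by unfold_locales (auto simp: emb_simps[OF h] algebra_simps)
  obtain B where B: "independent B" "UNIV \<subseteq> span B" "card B = dim UNIV"
    by (rule basis_exists[of UNIV]) auto
  then have "card B = 2" using assms by (simp add: morphism_degree_def)
  then obtain u v where uv: "B = {u, v}" "u \<noteq> v" by (auto simp: card_2_iff)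
  have u: "u \<noteq> 0" using B(1) uv dependent_zero by auto
  have v: "v \<notin> span {u}" using B(1) uv independent_insert[of v "{u}"] by (auto simp: insert_commute)
  show thesis
  proof (rule that[of "v / u"])
    show "v / u \<notin> range h"
    proof
      assume "v / u \<in> range h"
      then obtain c where "v / u = h c" by auto
      then have "v = h c * u" using u by (simp add: field_simps)
      then show False using v span_scale[OF span_base, of u "{u}" c] by simp
    qed
    fix z
    have "z * u \<in> span {u, v}" using B uv by auto
    then obtain a where "z * u - h a * u \<in> span {v}" by (auto simp: span_breakdown_eq)
    then obtain b where "z * u - h a * u = h b * v" by (auto simp: span_breakdown_eq)
    then have "z = h a + h b * (v / u)" using u by (simp add: field_simps)
    then show "\<exists>a b. z = h a + h b * (v / u)" by blast
  qed
qed

text \<open>Constants are squares. Splitting off one root at a time toggles its membership in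
  \<open>A\<close>.\<close>

lemma squarefree_part_poly:
  fixes p :: "'k::alg_closed_field poly"
  assumes "p \<noteq> 0"
  shows "\<exists>A q. finite A \<and> q \<noteq> 0 \<and> to_fract p = q\<^sup>2 * (\<Prod>a\<in>A. X - P1 a)"
  using assms
proof (induction "degree p" arbitrary: p)
  case 0
  then obtain c where c: "p = [:c:]" by (auto elim!: degree_eq_zeroE)
  obtain r where r: "r ^ 2 = c" using nth_root_exists[of 2 c] by auto
  have "to_fract p = (P1 r)\<^sup>2" "P1 r \<noteq> 0"
    using 0 r c by (auto simp: P1_def[of c, symmetric] emb_power[OF P1_emb] emb_eq_zero_iff[OF P1_emb])
  then show ?case by (intro exI[of _ "{}"] exI[of _ "P1 r"]) auto
next
  case (Suc n)
  then obtain a where "poly p a = 0"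
    using alg_closed_imp_poly_has_root[of p] by auto
  then obtain r where r: "p = [:-a, 1:] * r" by (metis poly_eq_0_iff_dvd dvdE)
  have r0: "r \<noteq> 0" using r Suc.prems by auto
  then have "n = degree r"
    using Suc.hyps(2) by (auto simp: r degree_mult_eq simp del: mult_pCons_left)
  then obtain A q where A: "finite A" "q \<noteq> 0" "to_fract r = q\<^sup>2 * (\<Prod>a\<in>A. X - P1 a)"
    using Suc.hyps(1) r0 by blast
  have p: "to_fract p = (X - P1 a) * to_fract r" by (simp add: r X_minus del: mult_pCons_left)
  show ?case
  proof (cases "a \<in> A")
    case True
    then have "(\<Prod>a\<in>A. X - P1 a) = (X - P1 a) * (\<Prod>a\<in>A - {a}. X - P1 a)"
      using A by (simp add: prod.remove)
    then show ?thesis using A p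
      by (intro exI[of _ "A - {a}"] exI[of _ "q * (X - P1 a)"]) (auto simp: power2_eq_square ac_simps)
  next
    case False
    then show ?thesis using A p
      by (intro exI[of _ "insert a A"] exI[of _ q]) (auto simp: ac_simps)
  qed
qed

lemma squarefree_part:
  fixes z :: "'k::alg_closed_field poly fract"
  assumes "z \<noteq> 0"
  obtains A q where "finite A" "q \<noteq> 0" "z = q\<^sup>2 * (\<Prod>a\<in>A. X - P1 a)"
proof -
  obtain p q where z: "z = to_fract p / to_fract q" "q \<noteq> 0" by (rule fract_cases_poly)
  then have "p * q \<noteq> 0" using assms by auto
  then obtain A r where "finite A" "r \<noteq> 0" "to_fract (p * q) = r\<^sup>2 * (\<Prod>a\<in>A. X - P1 a)"
    using squarefree_part_poly by blast
  moreover have "z = to_fract (p * q) / (to_fract q)\<^sup>2"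
    using z by (simp add: power2_eq_square)
  ultimately show thesis
    using z by (intro that[of A "r / to_fract q"]) (auto simp: power_divide)
qed

text \<open>Completing the square removes the linear term, and square factors of the radicand are
  moved into the generator. The involution must then negate it, since its fixed field is
  k(x).\<close>

lemma double_cover_generator:
  fixes E :: "'k::{alg_closed_field, field_char_0} \<Rightarrow> 'e::field"
  assumes g: "morphism E P1 g" and v: "morphism E E v" and fixed: "range g = {z. v z = z}"
    and t: "t \<notin> range g" "\<And>z. \<exists>a b. z = g a + g b * t"
  obtains A s where "finite A" "s \<notin> range g" "s\<^sup>2 = g (\<Prod>a\<in>A. X - P1 a)" "v s = - s"
    "\<And>z. \<exists>a b. z = g a + g b * s"
proof -
  note ge = morphism_emb[OF g] and ve = morphism_emb[OF v]
  have two: "(2 :: 'k poly fract) \<noteq> 0"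
    using emb_eq_zero_iff[OF P1_emb, of "2 :: 'k"] by (simp add: emb_numeral[OF P1_emb])
  obtain a b where ab: "t\<^sup>2 = g a + g b * t" using t by blast
  define t1 where "t1 = t - g (b / 2)"
  have gb: "g b = 2 * g (b / 2)"
    using two by (simp add: emb_numeral[OF ge] flip: emb_mult[OF ge] emb_numeral[OF ge])
  have t1: "t1\<^sup>2 = g (a + (b / 2)\<^sup>2)"
    using ab unfolding t1_def by (simp add: gb power2_diff emb_add[OF ge] emb_power[OF ge])
  have t1r: "t1 \<notin> range g"
  proof
    assume "t1 \<in> range g"
    then obtain c where "t1 = g c" by auto
    then have "t = g (c + b / 2)" by (simp add: t1_def emb_add[OF ge] algebra_simps)
    then show False using t by auto
  qed
  have "t1 \<noteq> 0" using t1r emb_zero[OF ge] by (metis rangeI)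
  then have "a + (b / 2)\<^sup>2 \<noteq> 0" using t1 emb_zero[OF ge] by auto
  then obtain A q where A: "finite A" "q \<noteq> 0" "a + (b / 2)\<^sup>2 = q\<^sup>2 * (\<Prod>a\<in>A. X - P1 a)"
    by (rule squarefree_part)
  define s where "s = t1 / g q"
  have gq: "g q \<noteq> 0" using A by (simp add: emb_eq_zero_iff[OF ge])
  have s2: "s\<^sup>2 = g (\<Prod>a\<in>A. X - P1 a)"
    using t1 A gq by (simp add: s_def power_divide emb_mult[OF ge] emb_power[OF ge])
  have t_s: "t = g (b / 2) + g q * s" using gq by (simp add: s_def t1_def)
  have sr: "s \<notin> range g"
  proof
    assume "s \<in> range g"
    then obtain c where "s = g c" by auto
    then have "t1 = g (q * c)" using gq by (simp add: s_def emb_mult[OF ge] field_simps)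
    then show False using t1r by auto
  qed
  show thesis
  proof (rule that[of A s])
    have "v (g w) = g w" for w using fixed by auto
    then have "(v s)\<^sup>2 = s\<^sup>2" using s2 by (simp flip: emb_power[OF ve])
    moreover have "v s \<noteq> s" using sr fixed by auto
    ultimately show "v s = - s" by (simp add: power2_eq_iff)
    show "\<exists>a b. z = g a + g b * s" for z
    proof -
      obtain a' b' where "z = g a' + g b' * t" using t by blast
      then have "z = g (a' + b' * (b / 2)) + g (b' * q) * s"
        by (simp only: t_s emb_add[OF ge] emb_mult[OF ge]) (simp add: algebra_simps)
      then show ?thesis by blast
    qed
  qed (use A sr s2 in auto)
qed

text \<open>The norm of the quadratic extension turns an odd valuation into a ramified point.\<close>

lemma ramified_point:
  fixes E :: "'k::{alg_closed_field, field_char_0} \<Rightarrow> 'e::field"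
  assumes g: "morphism E P1 g" and v: "morphism E E v" and fixed: "range g = {z. v z = z}"
    and t: "t\<^sup>2 = g G" "v t = - t" "\<And>z. \<exists>a b. z = g a + g b * t"
    and Q: "point P1 Q" "odd (Q G)"
  obtains P where "point E P" "lies_over g 2 P Q" "P \<circ> v = P"
proof -
  note ge = morphism_emb[OF g] and ve = morphism_emb[OF v] and Qv = point_valuation[OF Q(1)]
  note val = val_0[OF Qv P1_emb] val_mult[OF Qv P1_emb] val_power[OF Qv P1_emb]
    val_uminus[OF Qv P1_emb] val_const[OF Qv P1_emb]
  have vg: "v (g w) = g w" for w using fixed by auto
  have v_form: "v (g a + g b * t) = g a - g b * t" for a b
    by (simp add: emb_simps[OF ve] vg t)
  have vv: "v (v z) = z" for z
  proof -
    obtain a b where "z = g a + g b * t" using t(3) by blast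
    then show ?thesis by (simp add: v_form emb_diff[OF ve] emb_mult[OF ve] vg t)
  qed
  define nm where "nm z = inv g (z * v z)" for z
  have g_nm: "g (nm z) = z * v z" for z
  proof -
    have "v (z * v z) = z * v z" by (simp add: emb_mult[OF ve] vv)
    then have "z * v z \<in> range g" using fixed by auto
    then show ?thesis by (simp add: nm_def f_inv_into_f)
  qed
  have nmI: "nm z = w" if "z * v z = g w" for z w
    using that g_nm[of z] emb_eq_iff[OF ge] by metis
  have nm_mult: "nm (x * y) = nm x * nm y" for x y
    by (rule nmI) (simp add: emb_mult[OF ve] emb_mult[OF ge] g_nm)
  have nm_form: "nm (g a + g b * t) = a\<^sup>2 - b\<^sup>2 * G" for a b
    by (rule nmI) (simp add: v_form emb_simps[OF ge] flip: t(1), simp add: power2_eq_square algebra_simps)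
  have nm_g: "nm (g a) = a\<^sup>2" for a
    using nm_form[of a 0] by (simp add: emb_zero[OF ge])
  have nm_0: "nm z = 0 \<longleftrightarrow> z = 0" for z
  proof -
    have "nm z = 0 \<longleftrightarrow> z * v z = 0" by (simp only: emb_eq_zero_iff[OF ge, symmetric] g_nm)
    then show ?thesis by (simp add: emb_eq_zero_iff[OF ve])
  qed
  have G: "G \<noteq> 0" using Q val(1) by auto
  \<comment> \<open>The two terms of the norm a^2 - b^2 G have values of different parity, so the
    value of the norm is their minimum.\<close>
  have le: "m \<le> Q (nm (g a + g b * t)) \<longleftrightarrow>
      (a \<noteq> 0 \<longrightarrow> m \<le> 2 * Q a) \<and> (b \<noteq> 0 \<longrightarrow> m \<le> 2 * Q b + Q G)"
    if "g a + g b * t \<noteq> 0" for a b m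
  proof -
    have a2: "Q (a\<^sup>2) = 2 * Q a" by (simp add: val)
    have b2: "Q (- (b\<^sup>2 * G)) = 2 * Q b + Q G" if "b \<noteq> 0" using that G by (simp add: val)
    consider "a = 0" "b \<noteq> 0" | "b = 0" "a \<noteq> 0" | "a \<noteq> 0" "b \<noteq> 0"
      using \<open>g a + g b * t \<noteq> 0\<close> emb_zero[OF ge] by fastforce
    then show ?thesis
    proof cases
      case 3
      have "2 * Q a \<noteq> 2 * Q b + Q G" using Q(2) by presburger
      then consider "Q (a\<^sup>2) < Q (- (b\<^sup>2 * G))" | "Q (- (b\<^sup>2 * G)) < Q (a\<^sup>2)"
        using a2 b2[OF 3(2)] by linarith
      then have "Q (a\<^sup>2 + - (b\<^sup>2 * G)) = min (Q (a\<^sup>2)) (Q (- (b\<^sup>2 * G)))"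
      proof cases
        case 1
        then show ?thesis using val_add_eq(2)[OF Qv P1_emb, of "a\<^sup>2" "- (b\<^sup>2 * G)"] 3 G by simp
      next
        case 2
        then show ?thesis
          using val_add_eq(2)[OF Qv P1_emb, of "- (b\<^sup>2 * G)" "a\<^sup>2"] 3 G by (simp add: add.commute)
      qed
      then show ?thesis using 3 a2 b2[OF 3(2)] by (auto simp: nm_form)
    qed (use a2 b2 in \<open>auto simp: nm_form\<close>)
  qed
  show thesis
  proof (rule that[of "\<lambda>z. Q (nm z)"])
    show "(\<lambda>z. Q (nm z)) \<circ> v = (\<lambda>z. Q (nm z))"
      by (auto simp: nm_def vv mult.commute)
    show "lies_over g 2 (\<lambda>z. Q (nm z)) Q"
      by (auto simp: lies_over_def nm_g val)
    have "valuation E (\<lambda>z. Q (nm z))"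
      unfolding valuation_def
    proof (intro conjI allI impI)
      show "Q (nm 0) = 0" using nm_0[of 0] val(1) by simp
      show "Q (nm (x * y)) = Q (nm x) + Q (nm y)" if "x \<noteq> 0" "y \<noteq> 0" for x y
        using that by (simp add: nm_mult val nm_0)
      show "Q (nm (E a)) = 0" for a
        using nm_g[of "P1 a"] by (simp add: morphism_const[OF g] val)
      fix x y :: 'e
      assume nz: "x \<noteq> 0" "y \<noteq> 0" "x + y \<noteq> 0"
      obtain a b where x: "x = g a + g b * t" using t by blast
      obtain c d where y: "y = g c + g d * t" using t by blast
      have xy: "x + y = g (a + c) + g (b + d) * t"
        by (simp add: x y emb_add[OF ge] algebra_simps)
      let ?m = "min (Q (nm x)) (Q (nm y))"
      have *: "?m \<le> Q (nm x)" "?m \<le> Q (nm y)" by auto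
      have add: "min (Q p) (Q q) \<le> Q (p + q)" if "p \<noteq> 0" "q \<noteq> 0" "p + q \<noteq> 0" for p q
        using val_add[OF Qv P1_emb] that by blast
      have 1: "?m \<le> 2 * Q (a + c)" if "a + c \<noteq> 0"
        using * le[of a b ?m] le[of c d ?m] nz x y add[of a c] that
        by (cases "a = 0"; cases "c = 0") (auto simp: min_def split: if_splits)
      have 2: "?m \<le> 2 * Q (b + d) + Q G" if "b + d \<noteq> 0"
        using * le[of a b ?m] le[of c d ?m] nz x y add[of b d] that
        by (cases "b = 0"; cases "d = 0") (auto simp: min_def split: if_splits)
      show "?m \<le> Q (nm (x + y))"
        using le[of "a + c" "b + d" ?m] nz(3) 1 2 unfolding xy by blast
    qed
    moreover have "\<exists>x. Q (nm x) = 1"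
    proof -
      obtain p where p: "Q p = 1" using Q by (auto simp: point_def)
      then have p0: "p \<noteq> 0" using val(1) by auto
      obtain k where k: "Q G = 2 * k + 1" using Q(2) by (auto elim: oddE)
      \<comment> \<open>With Q G = 2k + 1 and Q p = 1, the norm of p^(-k) t has value 1, so this
        element is a uniformizer.\<close>
      define b where "b = p powi (- k)"
      have b: "b \<noteq> 0" "Q b = - k"
        using p p0 val_power_int[OF Qv P1_emb p0, of "- k"] by (auto simp: b_def)
      have "Q (nm (g 0 + g b * t)) = 1"
        unfolding nm_form using b G k by (simp add: val)
      then show ?thesis by blast
    qed
    ultimately show "point E (\<lambda>z. Q (nm z))" by (simp add: point_iff_valuation)
  qed
qed

section \<open>Rational curves\<close>

text \<open>
  On a rational curve every point is 2-torsion, which will contradict the finiteness of the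
  set of branch points.
\<close>

lemma point_comp_surj:
  assumes "point C P" "morphism C E h" "surj h"
  shows "point E (P \<circ> h)"
proof -
  obtain x where "P x = 1" using assms by (auto simp: point_def)
  moreover obtain y where "x = h y" using assms(3) by auto
  ultimately show ?thesis
    using valuation_comp[OF point_valuation[OF assms(1)] assms(2)]
    by (auto simp: point_iff_valuation)
qed

text \<open>Each point S has a function with divisor S - \<infinity>. For \<open>u\<close> and
  \<open>w\<close> of this kind at P and Z, the divisor of (u / w)^2 is 2P - 2Z.\<close>

lemma rational_point_sum:
  fixes E :: "'k::alg_closed_field \<Rightarrow> 'e::field"
  assumes h: "morphism E P1 h" "surj h" and Z: "point E Z" and P: "point E P"
  shows "point_sum E Z P P Z"
proof -
  note he = morphism_emb[OF h(1)]
  have eq: "R = S \<longleftrightarrow> R \<circ> h = S \<circ> h" for R S :: "'e \<Rightarrow> int"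
    using h(2) by (metis surj_fun_eq comp_apply fun_eq_iff image_comp surj_def)
  have "\<exists>u. u \<noteq> 0 \<and> (\<forall>R. point E R \<longrightarrow>
      R u = (if R = S then 1 else 0) - (if R \<circ> h = ord_inf then 1 else 0))"
    if S: "point E S" for S
    using point_comp_surj[OF S h]
  proof (cases rule: point_P1_cases)
    case (finite a)
    have "R (h (X - P1 a)) = (if R = S then 1 else 0) - (if R \<circ> h = ord_inf then 1 else 0)"
      if "point E R" for R
      using point_comp_surj[OF that h]
    proof (cases rule: point_P1_cases)
      case (finite b)
      then have "R (h (X - P1 a)) = ord_at b (X - P1 a)" by (metis comp_apply)
      then show ?thesis using finite \<open>S \<circ> h = ord_at a\<close> by (auto simp: eq ord_at_linear)
    next
      case infinite
      then have "R (h (X - P1 a)) = ord_inf (X - P1 a)" by (metis comp_apply)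
      then show ?thesis using infinite \<open>S \<circ> h = ord_at a\<close> by (auto simp: eq ord_inf_linear)
    qed
    then show ?thesis
      by (intro exI[of _ "h (X - P1 a)"]) (auto simp: emb_eq_zero_iff[OF he])
  next
    case infinite
    have "R 1 = 0" if "point E R" for R
      using val_1[OF point_valuation[OF that] morphism_base_emb[OF h(1)]] .
    then show ?thesis using infinite by (intro exI[of _ 1]) (auto simp: eq)
  qed
  then obtain u w where u: "u \<noteq> 0" "\<And>R. point E R \<Longrightarrow>
      R u = (if R = P then 1 else 0) - (if R \<circ> h = ord_inf then 1 else 0)"
    and w: "w \<noteq> 0" "\<And>R. point E R \<Longrightarrow>
      R w = (if R = Z then 1 else 0) - (if R \<circ> h = ord_inf then 1 else 0)"
    using P Z by meson
  have "R ((u / w)\<^sup>2) = (2 * (if R = P then 1 else 0)) - (2 * (if R = Z then 1 else 0))" if R: "point E R" for R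
    unfolding val_power[OF point_valuation[OF R] morphism_base_emb[OF h(1)]]
      val_divide[OF point_valuation[OF R] morphism_base_emb[OF h(1)] u(1) w(1)]
      u(2)[OF R] w(2)[OF R]
    by simp
  then show ?thesis
    unfolding point_sum_def lin_equiv_def point_divisor_def
    using u(1) w(1) by (intro exI[of _ "(u / w)\<^sup>2"]) auto
qed

definition torsion_image where
  "torsion_image E Z g = {Q. point P1 Q \<and> (\<exists>P \<in> two_torsion E Z. P \<in> fiber E g Q)}"

text \<open>The coordinate of the rational curve has its square in k(x), so the points with
  coordinates s and s' can have the same image only for s' = s or s' = -s.\<close>

lemma rational_torsion_image_infinite:
  fixes E :: "'k::{alg_closed_field, field_char_0} \<Rightarrow> 'e::field"
  assumes h: "morphism E P1 h" "surj h" and Z: "point E Z" and g: "morphism E P1 g"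
    and tau: "(h X)\<^sup>2 = g tau"
  shows "infinite (torsion_image E Z g)"
proof -
  note he = morphism_emb[OF h(1)] and ge = morphism_emb[OF g]
  have bij: "bij h" using h emb_inj[OF he] by (auto simp: bij_def)
  note ih = morphism_inv[OF h(1) bij]
  define P where "P s = ord_at s \<circ> inv h" for s :: 'k
  define R where "R s = P s \<circ> g" for s
  have P: "point E (P s)" for s
    unfolding P_def using bij by (intro point_comp_surj[OF ord_at_point ih]) (simp add: bij_imp_bij_inv bij_is_surj)
  \<comment> \<open>The function tau - r^2 pulls back to (X - r)(X + r), so its value tells the
    images of different points apart.\<close>
  have val: "R s (tau - P1 (r\<^sup>2)) = ord_at s ((X - P1 r) * (X - P1 (- r)))" for s r
  proof -
    have "g (tau - P1 (r\<^sup>2)) = h ((X - P1 r) * (X - P1 (- r)))"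
      by (simp add: emb_diff[OF ge] emb_mult[OF he] emb_diff[OF he] emb_simps[OF P1_emb]
          morphism_const[OF g] morphism_const[OF h(1)] emb_uminus[OF he] emb_add[OF he]
          emb_power[OF ge] flip: tau)
        (simp add: power2_eq_square algebra_simps)
    then show ?thesis by (simp add: R_def P_def emb_inv[OF he])
  qed
  have val': "ord_at s ((X - P1 r) * (X - P1 (- r))) = (if s = r then 1 else 0) + (if s = - r then 1 else 0)"
    for s r :: 'k
    by (subst val_mult[OF ord_at_valuation P1_emb]) (simp_all add: ord_at_linear)
  have R1: "R s (tau - P1 (s\<^sup>2)) = 1" if "s \<noteq> 0" for s
    using that by (simp add: val val')
  have R: "R s \<in> torsion_image E Z g" if "s \<noteq> 0" for s
  proof -
    have "point P1 (R s)"
      using R1[OF that] valuation_comp[OF point_valuation[OF P] g]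
      by (auto simp: point_iff_valuation R_def)
    moreover have "lies_over g 1 (P s) (R s)" by (auto simp: lies_over_def R_def)
    ultimately show ?thesis
      using P rational_point_sum[OF h Z P] by (auto simp: torsion_image_def two_torsion_def fiber_def)
  qed
  \<comment> \<open>Positive integers are used because in characteristic 0 no two of them are
    negatives of each other.\<close>
  have "inj (\<lambda>n. R (of_nat (Suc n)))"
  proof
    fix m n
    assume eq: "R (of_nat (Suc m)) = R (of_nat (Suc n))"
    have "R (of_nat (Suc m)) (tau - P1 ((of_nat (Suc n))\<^sup>2)) = 1"
      unfolding eq by (rule R1) (simp del: of_nat_Suc)
    moreover have "of_nat (Suc m) \<noteq> - (of_nat (Suc n) :: 'k)"
      by (metis add_eq_0_iff2 of_nat_0_eq_iff of_nat_add nat.simps(3) add_Suc)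
    ultimately show "m = n"
      by (auto simp: val val' simp del: of_nat_Suc split: if_splits)
  qed
  then have "infinite (range (\<lambda>n. R (of_nat (Suc n))))"
    by (rule range_inj_infinite)
  moreover have "range (\<lambda>n. R (of_nat (Suc n))) \<subseteq> torsion_image E Z g"
    using R by (auto simp del: of_nat_Suc)
  ultimately show ?thesis using finite_subset by blast
qed

text \<open>If both x and t lie in k(s), the whole function field is k(s).\<close>

lemma rational_generator:
  fixes E :: "'k::{alg_closed_field, field_char_0} \<Rightarrow> 'e::field"
  assumes g: "morphism E P1 g" and t: "\<And>z. \<exists>a b. z = g a + g b * t"
    and s: "s \<notin> range g" and gX: "g X \<in> range (subst E s)" "t \<in> range (subst E s)"
  shows "morphism E P1 (subst E s)" "surj (subst E s)" "subst E s X = s"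
proof -
  note E = morphism_base_emb[OF g]
  have "s \<notin> range E" using s morphism_const[OF g] by (metis rangeE rangeI)
  then have tr: "transcendental E s" by (rule transcendentalI[OF E])
  show h: "morphism E P1 (subst E s)" and "subst E s X = s"
    using subst_morphism[OF E tr] subst_X[OF E tr] by auto
  let ?h = "subst E s"
  obtain w y where w: "g X = ?h w" and y: "t = ?h y" using gX by auto
  have "g f \<in> range ?h" for f
  proof (cases f rule: fract_cases_poly)
    case (1 p q)
    have "g f = ?h (ev P1 w p / ev P1 w q)"
      by (simp only: 1 morphism_quotient[OF g] emb_divide[OF morphism_emb[OF h]]
          ev_morphism[OF P1_emb h] w)
    then show ?thesis by blast
  qed
  then have "\<exists>x. z = ?h x" for z
    using t[of z] y by (metis emb_add[OF morphism_emb[OF h]] emb_mult[OF morphism_emb[OF h]] rangeE)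
  then show "surj ?h" by (auto simp: surj_def)
qed

section \<open>The branch points of the quotient by negation\<close>

text \<open>Each root of the squarefree radicand ramifies, and the ramified point is fixed by
  \<open>v\<close>, so it is 2-torsion. With infinity this gives at most three roots; the cases of
  fewer roots are excluded one by one.\<close>

lemma torsion_image_elliptic:
  fixes E :: "'k::{alg_closed_field, field_char_0} \<Rightarrow> 'e::field"
  assumes Z: "point E Z" and neg: "negation E Z v"
    and g: "morphism E P1 g" "range g = {z. v z = z}"
    and t0: "t0 \<notin> range g" "\<And>z. \<exists>a b. z = g a + g b * t0"
    and card: "card (torsion_image E Z g) = 4" and inf: "ord_inf \<in> torsion_image E Z g"
  obtains A t where "finite A" "card A = 3" "torsion_image E Z g = insert ord_inf (ord_at ` A)"
    "t\<^sup>2 = g (\<Prod>a\<in>A. X - P1 a)" "v t = - t"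
proof -
  have v: "morphism E E v" using neg by (auto simp: negation_def)
  note ge = morphism_emb[OF g(1)] and E = morphism_base_emb[OF g(1)]
  obtain A t where A: "finite A" and t: "t \<notin> range g" "t\<^sup>2 = g (\<Prod>a\<in>A. X - P1 a)" "v t = - t"
    "\<And>z. \<exists>a b. z = g a + g b * t"
    by (rule double_cover_generator[OF g(1) v g(2) t0]) blast
  let ?B = "torsion_image E Z g" and ?G = "\<Prod>a\<in>A. X - P1 a"
  have ram: "Q \<in> ?B" if Q: "point P1 Q" "odd (Q ?G)" for Q
  proof -
    obtain P where P: "point E P" "lies_over g 2 P Q" "P \<circ> v = P"
      by (rule ramified_point[OF g(1) v g(2) t(2-4) Q]) blast
    have "point_sum E Z P (P \<circ> v) Z" using neg P(1) by (auto simp: negation_def)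
    then show ?thesis using P Q by (auto simp: torsion_image_def two_torsion_def fiber_def)
  qed
  have fin: "ord_at a ?G = (if a \<in> A then 1 else 0)" for a
    using A by (subst val_prod[OF ord_at_valuation P1_emb]) (auto simp: ord_at_linear sum.delta)
  have inf_G: "ord_inf ?G = - int (card A)"
    by (subst val_prod[OF ord_inf_valuation P1_emb]) (auto simp: ord_inf_linear)
  have finB: "finite ?B" using card card.infinite by fastforce
  have sub: "ord_at ` A \<subseteq> ?B" using ram[OF ord_at_point] fin by auto
  have cardA: "card (ord_at ` A) = card A" by (intro card_image) (auto intro: inj_onI)
  have ninf: "ord_inf \<notin> ord_at ` A" by auto
  then have "insert ord_inf (ord_at ` A) \<subseteq> ?B" using sub inf by auto
  from card_mono[OF finB this] have le: "card A \<le> 3"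
    using A cardA ninf card by simp
  have "card A \<noteq> 0"
  proof
    assume "card A = 0"
    then have "t\<^sup>2 = 1" using A t by (simp add: emb_one[OF ge])
    then have "t = 1 \<or> t = - 1" by (simp add: power2_eq_1_iff)
    then have "t = g 1 \<or> t = g (- 1)" by (simp add: emb_one[OF ge] emb_uminus[OF ge])
    then show False using t(1) by auto
  qed
  \<comment> \<open>With a single root x = t^2 + a, so t generates the function field.\<close>
  moreover have "card A \<noteq> 1"
  proof
    assume "card A = 1"
    then obtain a where a: "A = {a}" by (auto simp: card_1_singleton_iff)
    have tE: "transcendental E t"
      using t(1) morphism_const[OF g(1)] by (intro transcendentalI[OF E]) (metis rangeE rangeI)
    note hm = subst_morphism[OF E tE]
    have "g X = subst E t (X\<^sup>2 + P1 a)"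
      using t(2) by (simp add: a emb_simps[OF morphism_emb[OF hm]] subst_X[OF E tE] morphism_const[OF hm]
          emb_diff[OF ge] morphism_const[OF g(1)])
    moreover have "t = subst E t X" by (simp add: subst_X[OF E tE])
    ultimately have "g X \<in> range (subst E t)" "t \<in> range (subst E t)" by auto
    note r = rational_generator[OF g(1) t(4) t(1) this]
    have "(subst E t X)\<^sup>2 = g ?G" using r(3) t(2) by simp
    from rational_torsion_image_infinite[OF r(1,2) Z g(1) this] finB show False by simp
  qed
  \<comment> \<open>The conic t^2 = (x - a)(x - b) is parametrized by s = t / (x - a), with s^2 = (x
    - b) / (x - a).\<close>
  moreover have "card A \<noteq> 2"
  proof
    assume "card A = 2"
    then obtain a b where ab: "A = {a, b}" "a \<noteq> b" by (auto simp: card_2_iff)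
    define s where "s = t / g (X - P1 a)"
    have ga: "g (X - P1 a) \<noteq> 0" by (simp add: emb_eq_zero_iff[OF ge])
    have st: "t = s * g (X - P1 a)" using ga by (simp add: s_def)
    have s_r: "s \<notin> range g"
    proof
      assume "s \<in> range g"
      then obtain c where "s = g c" by auto
      then have "t = g (c * (X - P1 a))" using st by (simp add: emb_mult[OF ge])
      then show False using t(1) by auto
    qed
    have s2: "s\<^sup>2 = g ((X - P1 b) / (X - P1 a))"
      using t(2) ga ab(2) by (simp add: s_def ab(1) power_divide emb_mult[OF ge] emb_divide[OF ge] power2_eq_square)
    have sE: "transcendental E s"
      using s_r morphism_const[OF g(1)] by (intro transcendentalI[OF E]) (metis rangeE rangeI)
    note hm = subst_morphism[OF E sE]
    note he = morphism_emb[OF hm]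
    have s1: "s\<^sup>2 \<noteq> 1"
    proof
      assume "s\<^sup>2 = 1"
      then have "g ((X - P1 b) / (X - P1 a)) = g 1" using s2 by (simp add: emb_one[OF ge])
      then have "(X - P1 b) / (X - P1 a) = 1" by (simp only: emb_eq_iff[OF ge])
      then have "P1 a = P1 b" by (simp add: field_simps)
      then show False using ab(2) emb_eq_iff[OF P1_emb] by blast
    qed
    have "s\<^sup>2 * (g X - E a) = g X - E b"
      using s2 ga by (simp add: emb_divide[OF ge] emb_diff[OF ge] morphism_const[OF g(1)])
    then have gX: "g X = (E a * s\<^sup>2 - E b) / (s\<^sup>2 - 1)"
      using s1 by (simp add: field_simps)
    then have gX: "g X = subst E s ((P1 a * X\<^sup>2 - P1 b) / (X\<^sup>2 - 1))"
      by (simp add: emb_simps[OF he] emb_one[OF he] subst_X[OF E sE] morphism_const[OF hm])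
    have "t = subst E s (X * ((P1 a * X\<^sup>2 - P1 b) / (X\<^sup>2 - 1) - P1 a))"
      by (subst st) (simp only: emb_mult[OF he] emb_diff[OF he] emb_diff[OF ge] subst_X[OF E sE]
          morphism_const[OF hm] morphism_const[OF g(1)] gX)
    then have "g X \<in> range (subst E s)" "t \<in> range (subst E s)" using gX by auto
    note r = rational_generator[OF g(1) t(4) s_r this]
    have "(subst E s X)\<^sup>2 = g ((X - P1 b) / (X - P1 a))" using r(3) s2 by simp
    from rational_torsion_image_infinite[OF r(1,2) Z g(1) this] finB show False by simp
  qed
  ultimately have A3: "card A = 3" using le by linarith
  have "insert ord_inf (ord_at ` A) = ?B"
    using sub inf A cardA ninf card A3 by (intro card_subset_eq[OF finB]) auto
  then show thesis using that A A3 t by metis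
qed

section \<open>Ramification data of the induced map\<close>

lemma transcendental_P1I:
  fixes s :: "'k::alg_closed_field poly fract"
  assumes "ord_at a s \<noteq> 0"
  shows "transcendental P1 s"
  using assms val_const[OF ord_at_valuation P1_emb] by (intro transcendentalI[OF P1_emb]) auto

lemma morphism_id: "field_embedding C \<Longrightarrow> morphism C C id"
  by (simp add: morphism_def field_embedding_def)

lemma ord_at_X_nonneg: "ord_at a X \<ge> 0"
  using ord_at_linear[of a 0] by (simp add: emb_zero[OF P1_emb])

lemma ord_inf_X: "ord_inf X = - 1"
  using ord_inf_linear[of 0] by (simp add: emb_zero[OF P1_emb])

text \<open>For a finite point a the coordinate change is 1 / (x - a). Its result is recognized as
  infinity because no finite point gives x a negative value.\<close>

lemma automorphism_to_infinity:
  fixes Q :: "'k::alg_closed_field poly fract \<Rightarrow> int"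
  assumes Q: "point P1 Q"
  obtains M where "morphism P1 P1 M" "bij M" "Q \<circ> M = ord_inf"
  using Q
proof (cases rule: point_P1_cases)
  case infinite
  then show ?thesis using that[of id] by (simp add: morphism_id P1_emb)
next
  case (finite a)
  have "ord_at a (inverse (X - P1 a)) = - 1"
    by (subst val_inverse[OF ord_at_valuation P1_emb]) (simp add: ord_at_linear)
  then have v1: "ord_at a (1 / (X - P1 a)) = - 1" by (simp add: inverse_eq_divide)
  then have s1: "transcendental P1 (1 / (X - P1 a))" by (intro transcendental_P1I[of a]) simp
  have s2: "transcendental P1 (1 / X + P1 a)"
  proof (rule transcendentalI[OF P1_emb], rule notI)
    assume "1 / X + P1 a \<in> range P1"
    then obtain c where "1 / X + P1 a = P1 c" by auto
    then have "inverse X = P1 (c - a)" by (simp add: emb_diff[OF P1_emb] field_simps)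
    from arg_cong[OF this, of ord_inf] show False
      by (simp add: val_inverse[OF ord_inf_valuation P1_emb] ord_inf_X val_const[OF ord_inf_valuation P1_emb])
  qed
  let ?M = "subst P1 (1 / (X - P1 a))" and ?N = "subst P1 (1 / X + P1 a)"
  note M = subst_morphism[OF P1_emb s1] and N = subst_morphism[OF P1_emb s2]
  note simps = emb_simps[OF morphism_emb[OF M]] emb_simps[OF morphism_emb[OF N]]
    subst_X[OF P1_emb s1] subst_X[OF P1_emb s2] morphism_const[OF M] morphism_const[OF N]
  have 1: "?M \<circ> ?N = id"
    by (rule morphism_eqI[OF morphism_comp[OF M N] morphism_id[OF P1_emb]]) (simp add: simps)
  have 2: "?N \<circ> ?M = id"
    by (rule morphism_eqI[OF morphism_comp[OF N M] morphism_id[OF P1_emb]]) (simp add: simps)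
  have bij: "bij ?M" using 1 2 by (rule o_bij[rotated])
  have pt: "point P1 (Q \<circ> ?M)" by (rule point_comp_surj[OF Q M bij_is_surj[OF bij]])
  have "(Q \<circ> ?M) X = - 1" using finite v1 by (simp add: simps)
  then have "Q \<circ> ?M = ord_inf"
    using pt ord_at_X_nonneg by (metis point_P1_cases neg_0_le_iff_le not_one_le_zero)
  then show ?thesis using that M bij by blast
qed

section \<open>Fibres with prescribed ramification type\<close>

lemma lies_over_unique:
  assumes "point E Q" "lies_over h e P Q" "lies_over h e' P Q"
  shows "e = e'"
proof -
  obtain f where "Q f = 1" using assms by (auto simp: point_def)
  then show ?thesis using assms(2,3) unfolding lies_over_def by (metis mult.right_neutral of_nat_eq_iff)
qed

lemma lies_over_ramification_index:
  assumes "point E Q" "P \<in> fiber C h Q"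
  shows "lies_over h (ramification_index h P Q) P Q"
proof -
  obtain e where e: "lies_over h e P Q" using assms by (auto simp: fiber_def)
  then have "ramification_index h P Q = e"
    unfolding ramification_index_def using lies_over_unique[OF assms(1)] by blast
  then show ?thesis using e by simp
qed

lemma image_mset_set_eq_add_mset:
  assumes "finite F" "image_mset f (mset_set F) = add_mset x M"
  obtains P where "P \<in> F" "f P = x" "image_mset f (mset_set (F - {P})) = M"
proof -
  have "x \<in># image_mset f (mset_set F)" by (simp only: assms(2) union_single_eq_member)
  then obtain P where P: "P \<in> F" "f P = x" using assms(1) by auto
  then have "mset_set F = add_mset P (mset_set (F - {P}))" using assms by (simp add: mset_set.remove)
  then show thesis using assms P by (intro that[of P]) auto
qed

lemma fiber_of_type_4:
  assumes Q: "point E Q" and "ramification_type C h Q = {#4#}"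
  obtains P where "point C P" "lies_over h 4 P Q"
    "\<And>P' e. point C P' \<Longrightarrow> lies_over h e P' Q \<Longrightarrow> P' = P"
proof -
  \<comment> \<open>\<open>mset_set\<close> of an infinite set is empty by default, so a nonempty
    ramification type forces a finite fibre.\<close>
  have fin: "finite (fiber C h Q)"
    using assms(2) unfolding ramification_type_def by (metis mset_set.infinite image_mset_empty multi_self_add_other_not_self add_mset_not_empty)
  obtain P where P: "P \<in> fiber C h Q" "ramification_index h P Q = 4"
    "image_mset (\<lambda>P. ramification_index h P Q) (mset_set (fiber C h Q - {P})) = {#}"
    using assms(2) unfolding ramification_type_def by (rule image_mset_set_eq_add_mset[OF fin]) blast
  then have "fiber C h Q = {P}" using fin by (auto simp: mset_set_empty_iff)
  then show thesis
    using P lies_over_ramification_index[OF Q P(1)] by (intro that[of P]) (auto simp: fiber_def)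
qed

lemma fiber_of_type_211:
  assumes Q: "point E Q" and "ramification_type C h Q = {#2, 1, 1#}"
  obtains R1 R2 R3 where "point C R1" "point C R2" "point C R3"
    "lies_over h 2 R1 Q" "lies_over h 1 R2 Q" "lies_over h 1 R3 Q" "R1 \<noteq> R2" "R1 \<noteq> R3" "R2 \<noteq> R3"
proof -
  let ?F = "fiber C h Q" and ?f = "\<lambda>P. ramification_index h P Q"
  have fin: "finite ?F"
    using assms(2) unfolding ramification_type_def by (metis mset_set.infinite image_mset_empty add_mset_not_empty)
  obtain R1 where R1: "R1 \<in> ?F" "?f R1 = 2" "image_mset ?f (mset_set (?F - {R1})) = {#1, 1#}"
    using assms(2) unfolding ramification_type_def by (rule image_mset_set_eq_add_mset[OF fin]) blast
  obtain R2 where R2: "R2 \<in> ?F - {R1}" "?f R2 = 1" "image_mset ?f (mset_set (?F - {R1} - {R2})) = {#1#}"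
    by (rule image_mset_set_eq_add_mset[OF _ R1(3)]) (use fin in auto)
  obtain R3 where R3: "R3 \<in> ?F - {R1} - {R2}" "?f R3 = 1"
    by (rule image_mset_set_eq_add_mset[OF _ R2(3)]) (use fin in auto)
  have *: "point C R" "lies_over h (?f R) R Q" if "R \<in> ?F" for R
    using that lies_over_ramification_index[OF Q that] by (auto simp: fiber_def)
  show thesis
    using *[of R1] *[of R2] *[of R3] R1 R2 R3 by (intro that[of R1 R2 R3]) auto
qed

lemma bij_inv_comp:
  assumes "bij M"
  shows "M \<circ> inv M = id" "inv M \<circ> M = id"
  by (rule surj_iff[THEN iffD1, OF bij_is_surj[OF assms]])
    (rule inv_o_cancel[OF bij_is_inj[OF assms]])

lemma range_comp_bij: "bij M \<Longrightarrow> range (g \<circ> M) = range g"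
  by (metis bij_is_surj image_comp)

lemma torsion_image_comp:
  assumes "morphism P1 P1 M" "bij M" "Q \<in> torsion_image E Z g"
  shows "Q \<circ> M \<in> torsion_image E Z (g \<circ> M)"
proof -
  obtain P e where "point P1 Q" and P: "P \<in> two_torsion E Z" "point E P" "lies_over g e P Q"
    using assms(3) by (auto simp: torsion_image_def fiber_def)
  then have "point P1 (Q \<circ> M)" using assms by (intro point_comp_surj bij_is_surj)
  moreover have "lies_over (g \<circ> M) e P (Q \<circ> M)" using P by (simp add: lies_over_def)
  ultimately show ?thesis using P by (auto simp: torsion_image_def fiber_def)
qed

lemma card_torsion_image_comp:
  assumes M: "morphism P1 P1 M" "bij M"
  shows "card (torsion_image E Z (g \<circ> M)) = card (torsion_image E Z g)"
proof -
  note id = bij_inv_comp[OF M(2)]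
  have "bij_betw (\<lambda>Q. Q \<circ> M) (torsion_image E Z g) (torsion_image E Z (g \<circ> M))"
  proof (rule bij_betwI)
    show "(\<lambda>Q. Q \<circ> inv M) \<in> torsion_image E Z (g \<circ> M) \<rightarrow> torsion_image E Z g"
      using torsion_image_comp[OF morphism_inv[OF M] bij_imp_bij_inv[OF M(2)], of _ E Z "g \<circ> M"]
      by (simp add: comp_assoc id)
  qed (use torsion_image_comp[OF M] in \<open>auto simp: comp_assoc id\<close>)
  then show ?thesis by (simp add: bij_betw_same_card)
qed

section \<open>The quartic polynomial of a degenerate covering\<close>

text \<open>Without a pole, each root of the denominator is also a root of the numerator and can be
  cancelled.\<close>

lemma polynomial_if_no_pole:
  fixes z :: "'k::alg_closed_field poly fract"
  assumes "\<And>a. ord_at a z \<ge> 0"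
  shows "\<exists>U. z = to_fract U"
proof -
  have "\<exists>U. to_fract p / to_fract q = to_fract U"
    if "q \<noteq> 0" "\<And>a. ord_at a (to_fract p / to_fract q) \<ge> 0" for p q :: "'k poly"
    using that
  proof (induction "degree q" arbitrary: p q)
    case 0
    then obtain c where c: "q = [:c:]" "c \<noteq> 0" by (auto elim!: degree_eq_zeroE)
    then have "to_fract p = to_fract (smult (1 / c) p) * to_fract q"
      by (simp flip: to_fract_mult)
    then have "to_fract p / to_fract q = to_fract (smult (1 / c) p)"
      using 0 by (simp add: field_simps)
    then show ?case by blast
  next
    case (Suc n)
    then obtain a where a: "poly q a = 0"
      using alg_closed_imp_poly_has_root[of q] by auto
    show ?case
    proof (cases "p = 0")
      case True
      then show ?thesis by (intro exI[of _ 0]) simp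
    next
      case False
      have "int (order a p) - int (order a q) \<ge> 0"
        using Suc.prems(2)[of a] Suc.prems(1) False
        by (simp add: val_divide[OF ord_at_valuation P1_emb] ord_at_to_fract)
      moreover have "order a q \<noteq> 0" using a Suc.prems(1) order_root by blast
      ultimately have "poly p a = 0" using order_root by force
      then obtain p' q' where pq: "p = [:-a, 1:] * p'" "q = [:-a, 1:] * q'"
        using a by (metis poly_eq_0_iff_dvd dvdE)
      then have q': "q' \<noteq> 0" "n = degree q'"
        using Suc.prems(1) Suc.hyps(2) by (auto simp: degree_mult_eq simp del: mult_pCons_left)
      have "to_fract [:-a, 1:] \<noteq> 0" by (simp add: to_fract_eq_0_iff)
      then have "to_fract p / to_fract q = to_fract p' / to_fract q'"
        unfolding pq to_fract_mult by simp
      then show ?thesis using Suc.hyps(1)[OF q'(2,1)] Suc.prems(2) by simp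
    qed
  qed
  moreover obtain p q where "z = to_fract p / to_fract q" "q \<noteq> 0" by (rule fract_cases_poly)
  ultimately show ?thesis using assms by blast
qed

lemma quartic_factorization:
  fixes p :: "'k::field poly"
  assumes "degree p = 4" "order c p = 2" "order d p = 1" "order e p = 1" "c \<noteq> d" "c \<noteq> e" "d \<noteq> e"
  shows "p = smult (lead_coeff p) ([:-c, 1:]\<^sup>2 * [:-d, 1:] * [:-e, 1:])"
proof -
  have p0: "p \<noteq> 0" using assms by auto
  have rt: "poly p d = 0" "poly p e = 0" using assms order_root by (metis zero_neq_one)+
  have "[:-c, 1:]\<^sup>2 dvd p" using order_1[of c p] assms by simp
  then obtain p1 where p1: "p = [:-c, 1:]\<^sup>2 * p1" by (auto elim: dvdE)
  have "poly p1 d = 0" using rt assms by (simp add: p1)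
  then obtain p2 where p2: "p1 = [:-d, 1:] * p2" by (metis poly_eq_0_iff_dvd dvdE)
  have "poly p2 e = 0" using rt assms by (simp add: p1 p2)
  then obtain p3 where p3: "p2 = [:-e, 1:] * p3" by (metis poly_eq_0_iff_dvd dvdE)
  let ?q = "[:-c, 1:]\<^sup>2 * [:-d, 1:] * [:-e, 1:]"
  have p: "p = ?q * p3" by (simp only: p1 p2 p3 ac_simps)
  have "lead_coeff [:- a, 1:] = 1" for a :: 'k by simp
  then have q1: "lead_coeff ?q = 1" by (simp only: lead_coeff_mult lead_coeff_power power_one mult_1)
  have q: "degree ?q = 4" "?q \<noteq> 0"
    by (simp_all add: degree_mult_eq degree_power_eq del: mult_pCons_left mult_pCons_right)
  have p30: "p3 \<noteq> 0" using p p0 by auto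
  have "degree p = degree ?q + degree p3"
    unfolding p using q(2) p30 by (rule degree_mult_eq)
  then have "degree p3 = 0" using assms(1) q(1) by linarith
  then obtain k where k: "p3 = [:k:]" by (auto elim!: degree_eq_zeroE)
  have "lead_coeff p = lead_coeff ?q * lead_coeff p3" unfolding p by (rule lead_coeff_mult)
  then have "lead_coeff p = k" using q1 k by simp
  moreover have "p = smult k ?q" by (subst p) (simp only: k mult.commute[of ?q] mult_pCons_left pCons_0_0 add_0_right mult_zero_left)
  ultimately show ?thesis by metis
qed

lemma hyperelliptic_normal_form:
  fixes C :: "'k::{alg_closed_field, field_char_0} \<Rightarrow> 'c::field"
  assumes psi: "morphism C E psi" and deg: "degenerate C E psi"
  obtains A U L c d e where "finite A" "card A = 3" "L \<noteq> 0"
    "\<And>q. q \<in> A \<Longrightarrow> U - [:q:] = smult L ([:- c q, 1:]\<^sup>2 * [:- d q, 1:] * [:- e q, 1:])"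
    "\<And>q. q \<in> A \<Longrightarrow> c q \<noteq> d q \<and> c q \<noteq> e q \<and> d q \<noteq> e q"
    "isomorphic_to_hyperelliptic C (\<Prod>q\<in>A. [:- d q, 1:] * [:- e q, 1:])"
proof -
  obtain w Z v piC piE phi where
    w: "hyperelliptic_involution C w" and Z: "point E Z" and neg: "negation E Z v" and
    wv: "w \<circ> psi = psi \<circ> v" and qC: "quotient_to_P1 C w piC" and qE: "quotient_to_P1 E v piE" and
    phi: "morphism P1 P1 phi" and comm: "piC \<circ> phi = psi \<circ> piE" and
    ram: "degenerate_ramification phi (torsion_image E Z piE)"
    using deg unfolding degenerate_def torsion_image_def by blast
  obtain Q0 where Q0: "Q0 \<in> torsion_image E Z piE" "ramification_type P1 phi Q0 = {#4#}"
    and Qs: "\<And>Q. Q \<in> torsion_image E Z piE - {Q0} \<Longrightarrow> ramification_type P1 phi Q = {#2, 1, 1#}"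
    and card: "card (torsion_image E Z piE) = 4"
    using ram unfolding degenerate_ramification_def by blast
  have ptQ: "point P1 Q" if "Q \<in> torsion_image E Z piE" for Q
    using that by (simp add: torsion_image_def)
  obtain P0 where P0: "point P1 P0" "lies_over phi 4 P0 Q0"
    "\<And>P' e. point P1 P' \<Longrightarrow> lies_over phi e P' Q0 \<Longrightarrow> P' = P0"
    by (rule fiber_of_type_4[OF ptQ[OF Q0(1)] Q0(2)]) blast
  \<comment> \<open>\<open>M\<close> and \<open>N\<close> move the totally ramified value and the
    point above it to infinity, in the target and in the source of phi.\<close>
  obtain M where M: "morphism P1 P1 M" "bij M" "Q0 \<circ> M = ord_inf"
    by (rule automorphism_to_infinity[OF ptQ[OF Q0(1)]])
  obtain N where N: "morphism P1 P1 N" "bij N" "P0 \<circ> N = ord_inf"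
    by (rule automorphism_to_infinity[OF P0(1)])
  note NN = bij_inv_comp[OF N(2)] and MM = bij_inv_comp[OF M(2)]
  define h g f where "h = piC \<circ> N" and "g = piE \<circ> M" and "f = inv N \<circ> phi \<circ> M"
  have hC: "morphism C P1 h" and range_h: "range h = {z. w z = z}"
    using qC N morphism_comp[of C P1 piC P1 N]
    by (simp_all only: h_def quotient_to_P1_def range_comp_bij[OF N(2)])
  have gE: "morphism E P1 g" and range_g: "range g = {z. v z = z}"
    using qE M morphism_comp[of E P1 piE P1 M]
    by (simp_all only: g_def quotient_to_P1_def range_comp_bij[OF M(2)])
  obtain t0 where t0: "t0 \<notin> range piE" "\<And>z. \<exists>a b. z = piE a + piE b * t0"
    using morphism_degree_2[of piE] qE morphism_emb[of E P1 piE] unfolding quotient_to_P1_def by metis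
  have piE: "piE a = g (inv M a)" for a
    using M(2) by (simp add: g_def bij_is_surj surj_f_inv_f)
  have t0': "t0 \<notin> range g" "\<exists>a b. z = g a + g b * t0" for z
    using t0(1) t0(2)[of z] piE unfolding g_def range_comp_bij[OF M(2)] by metis+
  have f: "morphism P1 P1 f"
    unfolding f_def by (intro morphism_comp[OF morphism_comp[OF morphism_inv[OF N(1,2)] phi] M(1)])
  have comm': "h \<circ> f = psi \<circ> g"
  proof -
    have "h \<circ> f = piC \<circ> (N \<circ> inv N) \<circ> phi \<circ> M" by (simp only: h_def f_def comp_assoc)
    then show ?thesis using comm by (simp add: NN g_def comp_assoc)
  qed
  have over: "lies_over f e P (Q \<circ> M) \<longleftrightarrow> lies_over phi e (P \<circ> inv N) Q" for e P Q
    unfolding lies_over_def f_def using M(2) by (auto simp: comp_def) (metis bij_pointE)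
  have over_inf: "P = ord_inf" if P: "point P1 P" "lies_over f e P ord_inf" for P e
  proof -
    have "point P1 (P \<circ> inv N)"
      using point_comp_surj[OF P(1) morphism_inv[OF N(1,2)]] N(2) by (simp add: bij_imp_bij_inv bij_is_surj)
    then have "P \<circ> inv N = P0" using P0(3)[of "P \<circ> inv N" e] over[of e P Q0] P(2) M(3) by simp
    then have "P \<circ> (inv N \<circ> N) = ord_inf" using N(3) by (simp add: comp_assoc[symmetric])
    then show ?thesis by (simp add: NN)
  qed
  have inf4: "ord_inf (f z) = 4 * ord_inf z" for z
  proof -
    have "ord_inf \<circ> inv N = P0" unfolding N(3)[symmetric] comp_assoc NN by simp
    then have "lies_over f 4 ord_inf ord_inf"
      using over[of 4 ord_inf Q0] P0(2) unfolding M(3) by simp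
    then show ?thesis by (simp add: lies_over_def)
  qed
  have inf_in: "ord_inf \<in> torsion_image E Z g"
    using torsion_image_comp[OF M(1,2) Q0(1)] M(3) by (simp add: g_def)
  have card': "card (torsion_image E Z g) = 4"
    using card_torsion_image_comp[OF M(1,2), of E Z piE] card by (simp add: g_def)
  obtain A t where A: "finite A" "card A = 3" "torsion_image E Z g = insert ord_inf (ord_at ` A)"
    and t: "t\<^sup>2 = g (\<Prod>a\<in>A. X - P1 a)" "v t = - t"
    by (rule torsion_image_elliptic[OF Z neg gE range_g t0' card' inf_in]) blast
  \<comment> \<open>A finite pole of \<open>f X\<close> would be a second point over infinity, but
    the fibre there is a single point. Hence \<open>f X\<close> is a polynomial.\<close>
  have no_pole: "ord_at a (f X) \<ge> 0" for a
  proof (rule ccontr)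
    assume neg: "\<not> ord_at a (f X) \<ge> 0"
    define V where "V = ord_at a \<circ> f"
    have "valuation P1 V" unfolding V_def by (rule valuation_comp[OF ord_at_valuation f])
    then show False
    proof (cases rule: valuation_P1_cases)
      case trivial
      then have "V X = 0" by blast
      then show False using neg by (simp add: V_def)
    next
      case (finite b)
      have "V X \<ge> 0" using finite(1) finite(2)[of X] ord_at_X_nonneg[of b] by simp
      then show False using neg by (simp add: V_def)
    next
      case infinite
      obtain n where n: "- V X = int n" "0 < n"
        using infinite(1) by (metis nat_0_le less_imp_le neg_0_less_iff_less zero_less_nat_eq)
      have "ord_at a (f z) = int n * ord_inf z" for z
        using infinite(2)[of z] unfolding n(1) by (simp add: V_def)
      then have "lies_over f n (ord_at a) ord_inf"
        using n(2) unfolding lies_over_def by blast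
      from over_inf[OF ord_at_point this] show False by simp
    qed
  qed
  obtain U where U: "f X = to_fract U" using polynomial_if_no_pole[OF no_pole] by blast
  have fq: "f (X - P1 q) = to_fract (U - [:q:])" for q
    by (simp add: emb_diff[OF morphism_emb[OF f]] morphism_const[OF f] U) (simp add: P1_def)
  have Uq: "degree (U - [:q:]) = 4" "U - [:q:] \<noteq> 0" for q
  proof -
    have "f (X - P1 q) \<noteq> 0" by (simp add: emb_eq_zero_iff[OF morphism_emb[OF f]])
    then show nz: "U - [:q:] \<noteq> 0" by (auto simp only: fq to_fract_0)
    show "degree (U - [:q:]) = 4"
      using inf4[of "X - P1 q"] unfolding fq ord_inf_to_fract[OF nz] ord_inf_linear by simp
  qed
  have U4: "degree U = 4" using Uq(1)[of 0] by simp
  have L: "lead_coeff (U - [:q:]) = lead_coeff U" for q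
    using Uq(1)[of q] U4 by (simp add: coeff_pCons)
  \<comment> \<open>The three points of the fibre over q are finite, and their ramification indices
    2, 1, 1 are the orders of U - q.\<close>
  have "\<exists>c d e. U - [:q:] = smult (lead_coeff U) ([:- c, 1:]\<^sup>2 * [:- d, 1:] * [:- e, 1:]) \<and>
      c \<noteq> d \<and> c \<noteq> e \<and> d \<noteq> e" if q: "q \<in> A" for q
  proof -
    have "ord_at q \<in> torsion_image E Z g" using A(3) q by auto
    then have "ord_at q \<circ> inv M \<in> torsion_image E Z (g \<circ> inv M)"
      using M by (intro torsion_image_comp morphism_inv bij_imp_bij_inv)
    then have Q: "ord_at q \<circ> inv M \<in> torsion_image E Z piE" by (simp add: g_def comp_assoc MM)
    have qM: "ord_at q \<circ> inv M \<circ> M = ord_at q" by (simp add: comp_assoc MM)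
    have "ord_at q \<circ> inv M \<noteq> Q0" using qM M(3) by auto
    then have "ramification_type P1 phi (ord_at q \<circ> inv M) = {#2, 1, 1#}" using Qs Q by blast
    then obtain R1 R2 R3 where R: "point P1 R1" "point P1 R2" "point P1 R3"
      "lies_over phi 2 R1 (ord_at q \<circ> inv M)" "lies_over phi 1 R2 (ord_at q \<circ> inv M)"
      "lies_over phi 1 R3 (ord_at q \<circ> inv M)" "R1 \<noteq> R2" "R1 \<noteq> R3" "R2 \<noteq> R3"
      by (rule fiber_of_type_211[OF ptQ[OF Q]])
    have *: "\<exists>c. R \<circ> N = ord_at c \<and> order c (U - [:q:]) = e"
      if R: "point P1 R" "lies_over phi e R (ord_at q \<circ> inv M)" for R e
    proof -
      have "lies_over f e (R \<circ> N) (ord_at q)"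
        using over[of e "R \<circ> N" "ord_at q \<circ> inv M"] R(2) by (simp add: qM comp_assoc NN MM)
      then have "e > 0" and "(R \<circ> N) (f (X - P1 q)) = int e * ord_at q (X - P1 q)"
        unfolding lies_over_def by blast+
      then have v: "(R \<circ> N) (to_fract (U - [:q:])) = int e" "e > 0"
        unfolding fq by (simp_all add: ord_at_linear del: to_fract_diff)
      have "point P1 (R \<circ> N)" using point_comp_surj[OF R(1) N(1)] N(2) by (simp add: bij_is_surj)
      then show ?thesis
      proof (cases rule: point_P1_cases)
        case (finite c)
        then show ?thesis using v(1) unfolding finite ord_at_to_fract[OF Uq(2)] by auto
      next
        case infinite
        then show ?thesis using v unfolding infinite ord_inf_to_fract[OF Uq(2)] by simp
      qed
    qed
    obtain c where c: "R1 \<circ> N = ord_at c" "order c (U - [:q:]) = 2" using *[OF R(1,4)] by blast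
    obtain d where d: "R2 \<circ> N = ord_at d" "order d (U - [:q:]) = 1" using *[OF R(2,5)] by blast
    obtain e where e: "R3 \<circ> N = ord_at e" "order e (U - [:q:]) = 1" using *[OF R(3,6)] by blast
    have inj: "R = S" if "R \<circ> N = S \<circ> N" for R S :: "'k poly fract \<Rightarrow> int"
      using arg_cong[OF that, of "\<lambda>F. F \<circ> inv N"] by (simp add: comp_assoc NN)
    have ne: "c \<noteq> d" "c \<noteq> e" "d \<noteq> e" using c d e R(7-9) inj by metis+
    have "U - [:q:] = smult (lead_coeff U) ([:- c, 1:]\<^sup>2 * [:- d, 1:] * [:- e, 1:])"
      using quartic_factorization[OF Uq(1)[of q] c(2) d(2) e(2) ne] unfolding L .
    then show ?thesis using ne by blast
  qed
  then obtain c d e where cde: "\<And>q. q \<in> A \<Longrightarrow>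
      U - [:q:] = smult (lead_coeff U) ([:- c q, 1:]\<^sup>2 * [:- d q, 1:] * [:- e q, 1:])"
    "\<And>q. q \<in> A \<Longrightarrow> c q \<noteq> d q \<and> c q \<noteq> e q \<and> d q \<noteq> e q"
    by metis
  define F where "F = (\<Prod>q\<in>A. [:- d q, 1:] * [:- e q, 1:])"
  \<comment> \<open>The leading factor L^3 of the product is a square in k; its root and the double
    roots go into \<open>K\<close> and will be absorbed by y.\<close>
  obtain r where r: "r ^ 2 = lead_coeff U ^ 3" using nth_root_exists[of 2 "lead_coeff U ^ 3"] by auto
  have LU: "lead_coeff U \<noteq> 0" using U4 by (metis degree_0 leading_coeff_0_iff zero_neq_numeral)
  define K where "K = smult r (\<Prod>q\<in>A. [:- c q, 1:])"
  have K0: "K \<noteq> 0" using r LU A(1) by (auto simp: K_def)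
  have "f (\<Prod>a\<in>A. X - P1 a) = to_fract (\<Prod>q\<in>A. U - [:q:])"
    unfolding emb_prod[OF morphism_emb[OF f]] fq by (induction A rule: infinite_finite_induct) auto
  also have "(\<Prod>q\<in>A. U - [:q:]) = smult (lead_coeff U ^ 3) ((\<Prod>q\<in>A. [:- c q, 1:])\<^sup>2 * F)"
  proof -
    have "(\<Prod>q\<in>A. U - [:q:]) = (\<Prod>q\<in>A. smult (lead_coeff U) ([:- c q, 1:]\<^sup>2 * [:- d q, 1:] * [:- e q, 1:]))"
      using cde(1) by (rule prod.cong[OF refl])
    also have "\<dots> = smult (lead_coeff U ^ 3) (\<Prod>q\<in>A. [:- c q, 1:]\<^sup>2 * [:- d q, 1:] * [:- e q, 1:])"
      by (simp only: prod_smult prod_constant A(2))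
    also have "(\<Prod>q\<in>A. [:- c q, 1:]\<^sup>2 * [:- d q, 1:] * [:- e q, 1:]) = (\<Prod>q\<in>A. [:- c q, 1:])\<^sup>2 * F"
      by (simp only: F_def prod.distrib prod_power_distrib mult.assoc)
    finally show ?thesis .
  qed
  also have "\<dots> = K\<^sup>2 * F" by (simp add: K_def power_mult_distrib smult_power r[symmetric])
  finally have fG: "f (\<Prod>a\<in>A. X - P1 a) = (to_fract K)\<^sup>2 * to_fract F"
    by (simp add: power2_eq_square)
  note he = morphism_emb[OF hC]
  have we: "field_embedding w" "w (w z) = z" for z
    using w by (auto simp: hyperelliptic_involution_def morphism_emb fun_eq_iff)
  \<comment> \<open>The pullback of t is negated by the hyperelliptic involution, since
    \<open>psi\<close> intertwines it with negation; hence it is a generator over k(x).\<close>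
  define y0 where "y0 = psi t"
  have wy0: "w y0 = - y0"
    using fun_cong[OF wv, of t] t(2) by (simp add: y0_def emb_uminus[OF morphism_emb[OF psi]])
  have hK: "h (to_fract K) \<noteq> 0" using K0 by (simp add: emb_eq_zero_iff[OF he])
  have "y0\<^sup>2 = h ((to_fract K)\<^sup>2 * to_fract F)"
    using fun_cong[OF comm', of "\<Prod>a\<in>A. X - P1 a"] t(1) fG
    by (simp add: y0_def flip: emb_power[OF morphism_emb[OF psi]])
  then have y0: "y0\<^sup>2 = (h (to_fract K))\<^sup>2 * h (to_fract F)"
    by (simp add: emb_mult[OF he] emb_power[OF he])
  have F0: "F \<noteq> 0" using A(1) by (auto simp: F_def)
  then have y00: "y0 \<noteq> 0" using y0 hK by (auto simp: emb_eq_zero_iff[OF he])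
  have two: "(2 :: 'c) \<noteq> 0"
    using emb_eq_zero_iff[OF morphism_base_emb[OF hC], of 2] by (simp add: emb_numeral[OF morphism_base_emb[OF hC]])
  define y where "y = y0 / h (to_fract K)"
  have wh: "w (h z) = h z" for z using range_h by auto
  have "isomorphic_to_hyperelliptic C F"
    unfolding isomorphic_to_hyperelliptic_def
  proof (intro exI[of _ h] exI[of _ y] conjI allI)
    show "morphism C P1 h" by (rule hC)
    show "y \<notin> range h"
    proof
      assume "y \<in> range h"
      then have "w y = y" using range_h by auto
      then have "- y0 = y0" using hK by (simp add: y_def emb_divide[OF we(1)] wy0 wh)
      then have "2 * y0 = 0" by (simp only: mult_2) (metis add.left_inverse)
      then show False using two y00 by simp
    qed
    show "y\<^sup>2 = h (to_fract F)" using y0 hK by (simp add: y_def power_divide)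
    fix z
    \<comment> \<open>Every function is the sum of its even and odd parts under \<open>w\<close>;
      the odd part divided by y is again even.\<close>
    have "w ((z + w z) / 2) = (z + w z) / 2"
      by (simp add: emb_simps[OF we(1)] emb_numeral[OF we(1)] we(2) add.commute)
    then have "(z + w z) / 2 \<in> range h" using range_h by auto
    then obtain a where a: "(z + w z) / 2 = h a" by auto
    have y_0: "y \<noteq> 0" using y00 hK by (simp add: y_def)
    have wy: "w y = - y" by (simp add: emb_divide[OF we(1)] y_def wy0 wh)
    have "w ((z - w z) / (2 * y)) = (w z - z) / (2 * - y)"
      by (simp only: emb_divide[OF we(1)] emb_diff[OF we(1)] emb_mult[OF we(1)] emb_numeral[OF we(1)] we(2) wy)
    also have "\<dots> = (z - w z) / (2 * y)" using two y_0 by (simp add: divide_simps)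
    finally have "(z - w z) / (2 * y) \<in> range h" using range_h by auto
    then obtain b where b: "(z - w z) / (2 * y) = h b" by auto
    have "h a + h b * y = (z + w z) / 2 + (z - w z) / 2"
      using y_0 by (simp add: a[symmetric] b[symmetric])
    also have "\<dots> = z" using two by (simp flip: add_divide_distrib)
    finally have "z = h a + h b * y" by simp
    then show "\<exists>a b. z = h a + h b * y" by blast
  qed
  then show thesis using that[OF A(1,2) LU] cde unfolding F_def by blast
qed

section \<open>Uniqueness of the hyperelliptic equation\<close>

text \<open>
  Polynomials in two variables are elements of \<open>'k poly poly\<close>; the inner variable is $x = h(X)$, the
  outer one $z$. If $z \notin k(x)$, its minimal polynomial over $k(x)$ has degree at most 2 in $x$ as
  well, because $x$ is at most quadratic over $k(z)$. Its discriminant then has degree at most 4 but is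
  a square times the sextic.
\<close>

definition spec :: "'k::field \<Rightarrow> 'k poly poly \<Rightarrow> 'k poly" where
  "spec a = ev (\<lambda>p. [:poly p a:]) [:0, 1:]"

definition bev :: "('k::field poly fract \<Rightarrow> 'c::field) \<Rightarrow> 'c \<Rightarrow> 'k poly poly \<Rightarrow> 'c" where
  "bev h z = ev (\<lambda>p. h (to_fract p)) z"

lemma spec_hom: "ring_embedding (\<lambda>p. [:poly p a:])"
  by (auto simp: ring_embedding_def one_pCons)

lemma bev_hom: "field_embedding h \<Longrightarrow> ring_embedding (\<lambda>p. h (to_fract p))"
  by (auto simp: ring_embedding_def emb_simps)

lemma spec_simps:
  "spec a 0 = 0" "spec a (pCons p F) = pCons (poly p a) (spec a F)"
  "spec a (F * G) = spec a F * spec a G" "spec a (smult p F) = smult (poly p a) (spec a F)"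
  by (simp_all add: spec_def hom_ev_simps[OF spec_hom])

lemma bev_simps:
  assumes "field_embedding h"
  shows "bev h z 0 = 0" "bev h z (pCons p F) = h (to_fract p) + z * bev h z F"
    "bev h z (F + G) = bev h z F + bev h z G" "bev h z (F * G) = bev h z F * bev h z G"
    "bev h z (smult p F) = h (to_fract p) * bev h z F"
  by (simp_all add: bev_def hom_ev_simps[OF bev_hom[OF assms]])

lemma to_fract_numeral: "to_fract (numeral n :: 'k::field poly) = numeral n"
  using emb_numeral[OF P1_emb, of n] by (simp add: P1_def numeral_poly)

lemma coeff_spec: "coeff (spec a F) i = poly (coeff F i) a"
proof (induction F arbitrary: i)
  case (pCons p F)
  then show ?case by (cases i) (auto simp: spec_simps coeff_pCons)
qed (simp add: spec_simps)

lemma spec_eq_0D: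
  assumes "spec a F = 0"
  obtains G where "F = smult [:-a, 1:] G"
proof
  have "[:-a, 1:] dvd coeff F i" for i
    using coeff_spec[of a F i] assms by (simp add: poly_eq_0_iff_dvd)
  then show "F = smult [:-a, 1:] (map_poly (\<lambda>p. p div [:-a, 1:]) F)"
    by (intro poly_eqI) (simp add: coeff_map_poly del: mult_pCons_left)
qed

text \<open>That no specialization of \<open>G\<close> vanishes means that its coefficients have no
  common root, hence content 1 over an algebraically closed field. Each common root split off lowers
  the degree of the leading coefficient.\<close>

lemma primitive_part:
  fixes F :: "'k::alg_closed_field poly poly"
  assumes "F \<noteq> 0"
  shows "\<exists>d G. d \<noteq> 0 \<and> F = smult d G \<and> (\<forall>a. spec a G \<noteq> 0)"
  using assms
proof (induction "degree (lead_coeff F)" arbitrary: F rule: less_induct)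
  case less
  show ?case
  proof (cases "\<forall>a. spec a F \<noteq> 0")
    case True
    then show ?thesis by (intro exI[of _ 1] exI[of _ F]) auto
  next
    case False
    then obtain a G where G: "F = smult [:-a, 1:] G" using spec_eq_0D by blast
    then have G0: "G \<noteq> 0" using less.prems by auto
    have "lead_coeff F = [:-a, 1:] * lead_coeff G" using G by (simp add: lead_coeff_smult)
    then have "degree (lead_coeff G) < degree (lead_coeff F)"
      using G0 by (simp add: degree_mult_eq del: mult_pCons_left)
    then obtain d H where H: "d \<noteq> 0" "G = smult d H" "\<forall>a. spec a H \<noteq> 0"
      using less.hyps G0 by blast
    then show ?thesis using G
      by (intro exI[of _ "[:-a, 1:] * d"] exI[of _ H]) (simp del: mult_pCons_left)
  qed
qed

text \<open>Gauss's lemma, by cancelling the roots of \<open>m\<close> one at a time.\<close>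

lemma primitive_dvd:
  fixes F :: "'k::alg_closed_field poly poly"
  assumes "\<And>a. spec a F \<noteq> 0" "m \<noteq> 0" "smult m P = F * Q"
  shows "\<exists>Q. P = F * Q"
  using assms(2,3)
proof (induction "degree m" arbitrary: m Q)
  case 0
  then obtain c where c: "m = [:c:]" "c \<noteq> 0" by (auto elim!: degree_eq_zeroE)
  have "P = smult [:1 / c:] (smult m P)" using c by (simp flip: one_pCons)
  also have "\<dots> = F * smult [:1 / c:] Q" using 0 by simp
  finally show ?case by blast
next
  case (Suc n)
  then obtain a where "poly m a = 0"
    using alg_closed_imp_poly_has_root[of m] by auto
  then obtain k where k: "m = [:-a, 1:] * k" by (metis poly_eq_0_iff_dvd dvdE)
  then have k0: "k \<noteq> 0" using Suc.prems by auto
  then have "n = degree k"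
    using Suc.hyps(2) by (auto simp: k degree_mult_eq simp del: mult_pCons_left)
  have "spec a (smult m P) = 0"
    using \<open>poly m a = 0\<close> by (simp add: spec_simps)
  then have "spec a Q = 0" using Suc.prems(2) assms(1)[of a] by (simp add: spec_simps)
  then obtain R where R: "Q = smult [:-a, 1:] R" by (rule spec_eq_0D)
  have "smult [:-a, 1:] (smult k P) = smult [:-a, 1:] (F * R)"
    using Suc.prems(2) by (simp only: k R smult_smult mult_smult_right)
  then have "smult [:-a, 1:] (smult k P - F * R) = 0" by (simp only: smult_diff_right diff_self)
  then have "smult k P = F * R" by simp
  then show ?case using Suc.hyps(1)[OF \<open>n = degree k\<close> k0] by blast
qed

text \<open>\<open>F\<close> is a primitive minimal polynomial of z over k(x), so by Gauss's lemma
  it divides every polynomial relation \<open>P\<close>, and a factor cannot have larger degree in x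
  than the product.\<close>

lemma coeff_degree_bound:
  fixes F :: "'k::{alg_closed_field, field_char_0} poly poly"
  assumes h: "field_embedding h"
    and prim: "\<And>a. spec a F \<noteq> 0"
    and F: "bev h z F = 0"
    and min: "\<And>R. degree R < degree F \<Longrightarrow> bev h z R = 0 \<Longrightarrow> R = 0"
    and P: "P \<noteq> 0" "bev h z P = 0" "\<And>i. degree (coeff P i) \<le> n"
  shows "degree (coeff F i) \<le> n"
proof (rule ccontr)
  define N where "N = degree (coeff F i)"
  assume "\<not> degree (coeff F i) \<le> n"
  then have N: "N > n" by (simp add: N_def)
  have F0: "F \<noteq> 0" using prim[of 0] by (auto simp: spec_simps)
  \<comment> \<open>Pseudo-division stays in k[x][z]; minimality of \<open>F\<close> makes the
    remainder zero.\<close>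
  obtain Q R where QR: "pseudo_divmod P F = (Q, R)" by (metis surj_pair)
  define m where "m = coeff F (degree F) ^ (Suc (degree P) - degree F)"
  have div: "smult m P = F * Q + R" "R = 0 \<or> degree R < degree F"
    using pseudo_divmod[OF F0 QR] by (auto simp: m_def)
  have "bev h z (smult m P) = bev h z (F * Q + R)" by (simp only: div(1))
  then have "bev h z R = 0" using F P(2) by (simp add: bev_simps[OF h])
  then have "R = 0" using div(2) min by blast
  moreover have "m \<noteq> 0" using F0 by (simp add: m_def)
  ultimately obtain Q' where Q': "P = F * Q'"
    using primitive_dvd[OF prim, of m P Q] div(1) by auto
  \<comment> \<open>\<open>G\<close> collects the coefficients of x^N. At a constant z = b that is a
    root of neither \<open>G\<close> nor \<open>P\<close>, the degrees in x can be compared for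
    polynomials in one variable.\<close>
  define G where "G = map_poly (\<lambda>p. coeff p N) F"
  have "coeff F i \<noteq> 0" using N unfolding N_def by (metis degree_0 not_less_zero)
  then have "coeff G i \<noteq> 0" by (simp add: G_def coeff_map_poly N_def)
  then have "G \<noteq> 0" by auto
  then have fin1: "finite {b. poly G b = 0}" by (rule poly_roots_finite)
  have "finite {b. poly P b = 0}" using P(1) by (rule poly_roots_finite)
  then have fin2: "finite ((\<lambda>b. [:b:]) -` {b. poly P b = 0})"
    by (rule finite_vimageI) (auto intro: injI)
  have "infinite (UNIV :: 'k set)" by (rule infinite_UNIV_char_0)
  then obtain b where b: "poly G b \<noteq> 0" "poly P [:b:] \<noteq> 0"
    using fin1 fin2 ex_new_if_finite[of "{b. poly G b = 0} \<union> (\<lambda>b. [:b:]) -` {b. poly P b = 0}"] by auto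
  have "coeff (poly H [:b:]) N = poly (map_poly (\<lambda>p. coeff p N) H) b" for H
    by (induction H) (auto simp: map_poly_pCons)
  then have "coeff (poly F [:b:]) N \<noteq> 0" using b by (simp add: G_def)
  then have "N \<le> degree (poly F [:b:])" by (rule le_degree)
  have deg: "degree (poly H [:b:]) \<le> n" if "\<And>i. degree (coeff H i) \<le> n" for H
    using that
  proof (induction H)
    case (pCons p H)
    have "degree p \<le> n" using pCons.prems[of 0] by simp
    moreover have "degree (poly H [:b:]) \<le> n" using pCons.prems[of "Suc i" for i] by (intro pCons.IH) simp
    ultimately show ?case by (auto intro!: degree_add_le order_trans[OF degree_smult_le])
  qed simp
  have "poly P [:b:] = poly F [:b:] * poly Q' [:b:]" by (simp add: Q')
  then have "degree (poly F [:b:]) \<le> degree (poly P [:b:])"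
    using b(2) by (simp add: degree_mult_eq)
  then show False using deg[OF P(3)] N \<open>N \<le> degree (poly F [:b:])\<close> by linarith
qed

definition lift :: "'k::field poly \<Rightarrow> 'k poly poly" where
  "lift = map_poly (\<lambda>c. [:c:])"

text \<open>The relation c0(z) + c1(z) x + c2(z) x^2, rearranged by powers of z: it regards an
  equation for x over k(z) as one for z over k(x).\<close>

definition quad_rel :: "'k::field poly \<Rightarrow> 'k poly \<Rightarrow> 'k poly \<Rightarrow> 'k poly poly" where
  "quad_rel c0 c1 c2 = lift c0 + smult [:0, 1:] (lift c1) + smult [:0, 0, 1:] (lift c2)"

lemma coeff_quad_rel: "coeff (quad_rel c0 c1 c2) i = [:coeff c0 i, coeff c1 i, coeff c2 i:]"
  by (simp add: quad_rel_def lift_def coeff_map_poly)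

lemma quad_rel_eq_0_iff: "quad_rel c0 c1 c2 = 0 \<longleftrightarrow> c0 = 0 \<and> c1 = 0 \<and> c2 = 0"
  by (auto simp: poly_eq_iff[of "quad_rel c0 c1 c2"] coeff_quad_rel) (auto simp: poly_eq_iff)

lemma bev_quad_rel:
  assumes "morphism C P1 h"
  shows "bev h z (quad_rel c0 c1 c2) = ev C z c0 + h X * ev C z c1 + (h X)\<^sup>2 * ev C z c2"
proof -
  note h = morphism_emb[OF assms]
  have "C 0 = 0" using morphism_const[OF assms, of 0] by (simp add: P1_def emb_zero[OF h])
  then have "bev h z (lift c) = ev C z c" for c
    using morphism_const[OF assms]
    by (induction c) (auto simp: lift_def map_poly_pCons bev_simps[OF h] ev_def P1_def)
  moreover have "h (to_fract [:0, 0, 1:]) = (h X)\<^sup>2"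
    by (simp add: power2_eq_square flip: emb_mult[OF h] to_fract_mult)
  ultimately show ?thesis
    by (simp add: quad_rel_def bev_simps[OF h])
qed

lemma order_prod:
  assumes "\<And>i. i \<in> S \<Longrightarrow> f i \<noteq> (0 :: 'k::field poly)"
  shows "order a (prod f S) = (\<Sum>i\<in>S. order a (f i))"
proof -
  have "int (order a (prod f S)) = ord_at a (\<Prod>i\<in>S. to_fract (f i))"
  proof (cases "finite S")
    case True
    then have "prod f S \<noteq> 0" using assms by auto
    moreover have "to_fract (prod f S) = (\<Prod>i\<in>S. to_fract (f i))"
      by (induction S rule: infinite_finite_induct) auto
    ultimately show ?thesis by (simp add: ord_at_to_fract flip: ord_at_to_fract)
  next
    case False
    then show ?thesis using val_1[OF ord_at_valuation P1_emb, of a] order_0I[of 1 a] by simp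
  qed
  also have "\<dots> = (\<Sum>i\<in>S. ord_at a (to_fract (f i)))"
    using assms
    by (induction S rule: infinite_finite_induct)
      (auto simp: val_1[OF ord_at_valuation P1_emb] val_mult[OF ord_at_valuation P1_emb])
  also have "\<dots> = int (\<Sum>i\<in>S. order a (f i))" using assms by (simp add: ord_at_to_fract)
  finally show ?thesis by linarith
qed

lemma order_sextic_root:
  assumes "a \<noteq> 0" "inj_on r {1..6}" "i \<in> {1..6}"
  shows "order (r i) (sextic a r) = 1"
proof -
  have "order (r i) (sextic a r) = (\<Sum>j = 1..6. order (r i) [:- r j, 1:])"
    using assms(1) by (simp add: sextic_def order_smult order_prod)
  also have "\<dots> = (\<Sum>j = 1..6. if j = i then 1 else 0)"
    using assms(2,3) by (intro sum.cong) (auto simp: order_linear inj_on_eq_iff)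
  finally show ?thesis using assms(3) by simp
qed

lemma sextic_neq_0: "a \<noteq> 0 \<Longrightarrow> sextic a r \<noteq> 0"
  by (simp add: sextic_def)

lemma common_denominator:
  obtains p q m where "m \<noteq> (0 :: 'k::field poly)" "a = to_fract p / to_fract m" "b = to_fract q / to_fract m"
proof -
  obtain p k where a: "a = to_fract p / to_fract k" "k \<noteq> 0" by (rule fract_cases_poly)
  obtain q l where b: "b = to_fract q / to_fract l" "l \<noteq> 0" by (rule fract_cases_poly)
  show thesis using a b by (intro that[of "k * l" "p * l" "q * k"]) auto
qed

text \<open>From m x - p = q u with p, q, m in k[z], squaring gives (m x - p)^2 = q^2 g(z), of
  degree 2 in x.\<close>

lemma hyperelliptic_relation:
  assumes h: "morphism C P1 h" and k: "morphism C P1 k" and u: "u\<^sup>2 = k (to_fract g)"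
    and span: "\<And>z. \<exists>a b. z = k a + k b * u"
  obtains P where "P \<noteq> 0" "bev h (k X) P = 0" "\<And>i. degree (coeff P i) \<le> 2"
proof -
  note ke = morphism_emb[OF k]
  obtain a b where ab: "h X = k a + k b * u" using span by blast
  obtain p q m where m: "m \<noteq> 0" "a = to_fract p / to_fract m" "b = to_fract q / to_fract m"
    by (rule common_denominator)
  have km: "k (to_fract m) \<noteq> 0" using m by (simp add: emb_eq_zero_iff[OF ke])
  have "k (to_fract m) * h X - k (to_fract p) = k (to_fract q) * u"
    using km by (simp add: ab m emb_divide[OF ke] field_simps)
  then have "(k (to_fract m) * h X - k (to_fract p))\<^sup>2 = (k (to_fract q))\<^sup>2 * k (to_fract g)"
    by (simp add: power_mult_distrib u)
  then have eq: "(k (to_fract p))\<^sup>2 - (k (to_fract q))\<^sup>2 * k (to_fract g)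
      + h X * (- 2 * k (to_fract p) * k (to_fract m)) + (h X)\<^sup>2 * (k (to_fract m))\<^sup>2 = 0"
    by (simp add: power2_diff power_mult_distrib algebra_simps)
  have C: "field_embedding C"
    using field_embedding_comp[OF ke P1_emb] morphism_const[OF k] by (simp add: comp_def)
  let ?P = "quad_rel (p\<^sup>2 - q\<^sup>2 * g) (smult (- 2) (p * m)) (m\<^sup>2)"
  show thesis
  proof (rule that[of ?P])
    show "?P \<noteq> 0" using m by (simp add: quad_rel_eq_0_iff)
    show "degree (coeff ?P i) \<le> 2" for i
      by (simp add: coeff_quad_rel degree_pCons_eq_if)
    have C2: "C (- 2) = - 2" by (simp add: emb_uminus[OF C] emb_numeral[OF C])
    show "bev h (k X) ?P = 0"
      unfolding bev_quad_rel[OF h] ev_simps[OF C] C2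
      unfolding morphism_to_fract[OF k, symmetric]
      using eq by (simp add: mult.assoc)
  qed
qed

lemma hyperelliptic_X_in_range:
  fixes C :: "'k::{alg_closed_field, field_char_0} \<Rightarrow> 'c::field"
  assumes h: "morphism C P1 h" and y: "y\<^sup>2 = h (to_fract (sextic a r))" "\<And>z. \<exists>a b. z = h a + h b * y"
    and a: "a \<noteq> 0" "inj_on r {1..6}"
    and k: "morphism C P1 k" and u: "u\<^sup>2 = k (to_fract g)" "\<And>z. \<exists>a b. z = k a + k b * u"
  shows "k X \<in> range h"
proof (rule ccontr)
  assume zr: "k X \<notin> range h"
  note he = morphism_emb[OF h]
  define f where "f = sextic a r"
  obtain c b where cb: "k X = h c + h b * y" using y(2) by blast
  obtain p q m where m: "m \<noteq> 0" "c = to_fract p / to_fract m" "b = to_fract q / to_fract m"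
    by (rule common_denominator)
  have q0: "q \<noteq> 0"
  proof
    assume "q = 0"
    then have "k X = h c" using cb m by (simp add: emb_zero[OF he])
    then show False using zr by auto
  qed
  have hm: "h (to_fract m) \<noteq> 0" using m by (simp add: emb_eq_zero_iff[OF he])
  have "h (to_fract m) * k X - h (to_fract p) = h (to_fract q) * y"
    using hm by (simp add: cb m emb_divide[OF he] field_simps)
  then have "(h (to_fract m) * k X - h (to_fract p))\<^sup>2 = (h (to_fract q))\<^sup>2 * h (to_fract f)"
    by (simp add: power_mult_distrib y f_def)
  then have eq: "(h (to_fract p))\<^sup>2 - (h (to_fract q))\<^sup>2 * h (to_fract f)
      + k X * (- 2 * h (to_fract p) * h (to_fract m) + k X * (h (to_fract m))\<^sup>2) = 0"
    by (simp add: power2_diff power_mult_distrib power2_eq_square algebra_simps)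
  \<comment> \<open>The expansion of (m z - p)^2 = q^2 f in powers of z.\<close>
  define F0 where "F0 = [:p\<^sup>2 - q\<^sup>2 * f, - 2 * p * m, m\<^sup>2:]"
  have "F0 \<noteq> 0" using m by (simp add: F0_def)
  then obtain d F where F: "d \<noteq> 0" "F0 = smult d F" "\<And>a. spec a F \<noteq> 0"
    using primitive_part by metis
  have "h (to_fract (- 2 * p * m)) = - 2 * h (to_fract p) * h (to_fract m)"
  proof -
    have "- 2 * p * m = - (2 * p * m)" by simp
    then show ?thesis
      by (simp add: emb_uminus[OF he] emb_mult[OF he] emb_numeral[OF he] to_fract_numeral)
  qed
  then have "bev h (k X) F0 = 0"
    unfolding F0_def using eq
    by (simp add: bev_simps[OF he] emb_diff[OF he] emb_mult[OF he] emb_add[OF he] power2_eq_square)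
  then have bevF: "bev h (k X) F = 0"
    using F by (simp add: bev_simps[OF he] emb_eq_zero_iff[OF he])
  have "degree F0 = 2" using m by (simp add: F0_def)
  then have degF: "degree F = 2" using F(1) unfolding F(2) by simp
  have "R = 0" if R: "degree R < degree F" "bev h (k X) R = 0" for R
  proof -
    obtain r0 R' where R': "R = pCons r0 R'" by (rule pCons_cases)
    have "degree R' = 0" using R(1) degF by (auto simp: R' degree_pCons_eq_if split: if_splits)
    then obtain r1 where "R' = [:r1:]" by (auto elim!: degree_eq_zeroE)
    then have R01: "R = [:r0, r1:]" using R' by simp
    then have e: "h (to_fract r0) + k X * h (to_fract r1) = 0"
      using R(2) by (simp add: bev_simps[OF he])
    have "r1 = 0"
    proof (rule ccontr)
      assume "r1 \<noteq> 0"
      then have "k X = h (- to_fract r0 / to_fract r1)"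
        using e by (simp add: emb_divide[OF he] emb_uminus[OF he] emb_eq_zero_iff[OF he] field_simps eq_neg_iff_add_eq_0)
      then show False using zr by auto
    qed
    moreover from this have "r0 = 0" using e by (simp add: emb_zero[OF he] emb_eq_zero_iff[OF he])
    ultimately show "R = 0" using R01 by simp
  qed
  moreover obtain P where P: "P \<noteq> 0" "bev h (k X) P = 0" "\<And>i. degree (coeff P i) \<le> 2"
    by (rule hyperelliptic_relation[OF h k u]) blast
  ultimately have cF: "degree (coeff F i) \<le> 2" for i
    using coeff_degree_bound[OF he F(3) bevF _ P] by blast
  \<comment> \<open>The discriminant of the quadratic \<open>F\<close>; its coefficients have degree
    at most 2, so it has degree at most 4.\<close>
  define D where "D = (coeff F 1)\<^sup>2 - [:4:] * (coeff F 2 * coeff F 0)"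
  have "degree (coeff F i * coeff F j) \<le> 4" for i j
    using degree_mult_le[of "coeff F i" "coeff F j"] cF[of i] cF[of j] by linarith
  then have degD: "degree D \<le> 4"
    unfolding D_def power2_eq_square
    by (intro degree_diff_le) (auto intro: order_trans[OF degree_smult_le])
  have cf: "coeff F0 i = d * coeff F i" for i by (simp add: F(2))
  have "d\<^sup>2 * D = (coeff F0 1)\<^sup>2 - [:4:] * (coeff F0 2 * coeff F0 0)"
    by (simp add: cf D_def power2_eq_square algebra_simps)
  also have "\<dots> = (smult 2 (m * q))\<^sup>2 * f"
  proof -
    have "coeff F0 0 = p\<^sup>2 - q\<^sup>2 * f" "coeff F0 1 = - 2 * p * m" "coeff F0 2 = m\<^sup>2"
      by (simp_all add: F0_def numeral_2_eq_2)
    moreover have "[:4:] = (4 :: 'k poly)" "[:2:] = (2 :: 'k poly)"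
      by (simp_all add: numeral_poly)
    moreover have "smult 2 (m * q) = [:2:] * (m * q)" by simp
    ultimately show ?thesis by (simp only:) (simp add: power2_eq_square algebra_simps)
  qed
  finally have key: "d\<^sup>2 * D = (smult 2 (m * q))\<^sup>2 * f" .
  have f0: "f \<noteq> 0" using a(1) by (simp add: f_def sextic_neq_0)
  then have D0: "D \<noteq> 0" using key m q0 by auto
  \<comment> \<open>\<open>D\<close> equals \<open>f\<close> up to squares, so its order at each
    simple root of \<open>f\<close> is odd. Six roots are too many for degree 4.\<close>
  have "poly D (r i) = 0" if i: "i \<in> {1..6}" for i
  proof -
    have "2 * order (r i) d + order (r i) D = 2 * order (r i) (smult 2 (m * q)) + order (r i) f"
      using arg_cong[OF key, of "order (r i)"] D0 f0 F(1) m q0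
      by (simp add: order_mult power2_eq_square order_smult)
    moreover have "order (r i) f = 1" unfolding f_def by (rule order_sextic_root[OF a i])
    ultimately have "odd (order (r i) D)" by presburger
    then have "order (r i) D \<noteq> 0" by (metis even_zero)
    then show ?thesis using order_root by blast
  qed
  then have "r ` {1..6} \<subseteq> {x. poly D x = 0}" by auto
  then have "card (r ` {1..6}) \<le> card {x. poly D x = 0}"
    by (intro card_mono poly_roots_finite D0)
  also have "\<dots> \<le> degree D" by (rule card_poly_roots_bound[OF D0])
  finally show False using degD card_image[OF a(2)] by simp
qed

lemma range_subset_if_X:
  assumes h: "morphism C P1 h" and k: "morphism C P1 k" and "k X \<in> range h"
  shows "range k \<subseteq> range h"
proof
  fix z assume "z \<in> range k"
  then obtain f where z: "z = k f" by auto
  obtain w where w: "k X = h w" using assms by auto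
  show "z \<in> range h"
  proof (cases f rule: fract_cases_poly)
    case (1 p q)
    have "z = h (ev P1 w p / ev P1 w q)"
      by (simp only: z 1 morphism_quotient[OF k] emb_divide[OF morphism_emb[OF h]]
          ev_morphism[OF P1_emb h] w)
    then show ?thesis by blast
  qed
qed

text \<open>Write z = p(x) / q(x) in lowest terms: the linear polynomial q z - p is then primitive.
  Since x is also rational in z, there is a relation linear in x, which bounds the degrees of p and
  q by 1.\<close>

lemma moebius_if_ranges_eq:
  fixes C :: "'k::{alg_closed_field, field_char_0} \<Rightarrow> 'c::field"
  assumes h: "morphism C P1 h" and k: "morphism C P1 k"
    and kh: "k X \<in> range h" and hk: "h X \<in> range k"
  obtains p0 p1 q0 q1 where "p1 * q0 - p0 * q1 \<noteq> 0"
    "k X * h (to_fract [:q0, q1:]) = h (to_fract [:p0, p1:])"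
proof -
  note he = morphism_emb[OF h] and ke = morphism_emb[OF k]
  obtain c where c: "k X = h c" using kh by auto
  obtain p q where pq: "c = to_fract p / to_fract q" "q \<noteq> 0" by (rule fract_cases_poly)
  have "[:- p, q:] \<noteq> 0" using pq by simp
  then obtain d F where F: "d \<noteq> 0" "[:- p, q:] = smult d F" "\<And>a. spec a F \<noteq> 0"
    using primitive_part by metis
  have degF: "degree F = 1" using pq(2) F(1) arg_cong[OF F(2), of degree] by simp
  have hq: "h (to_fract q) \<noteq> 0" using pq by (simp add: emb_eq_zero_iff[OF he])
  have "bev h (k X) [:- p, q:] = 0"
    using hq by (simp add: bev_simps[OF he] c pq emb_divide[OF he] emb_uminus[OF he])
  then have bevF: "bev h (k X) F = 0"
    using F by (simp add: bev_simps[OF he] emb_eq_zero_iff[OF he])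
  have min: "R = 0" if R: "degree R < degree F" "bev h (k X) R = 0" for R
    using R degF by (auto elim!: degree_eq_zeroE simp: bev_simps[OF he] emb_eq_zero_iff[OF he])
  obtain c' where c': "h X = k c'" using hk by auto
  obtain p' q' where pq': "c' = to_fract p' / to_fract q'" "q' \<noteq> 0" by (rule fract_cases_poly)
  have kq: "k (to_fract q') \<noteq> 0" using pq' by (simp add: emb_eq_zero_iff[OF ke])
  have C: "field_embedding C"
    using field_embedding_comp[OF ke P1_emb] morphism_const[OF k] by (simp add: comp_def)
  \<comment> \<open>The relation q'(z) x - p'(z) = 0.\<close>
  let ?P = "quad_rel (- p') q' 0"
  have "bev h (k X) ?P = 0"
    unfolding bev_quad_rel[OF h] ev_simps[OF C] morphism_to_fract[OF k, symmetric]
    using kq by (simp add: c' pq' emb_divide[OF ke])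
  moreover have "?P \<noteq> 0" using pq' by (simp add: quad_rel_eq_0_iff)
  moreover have "degree (coeff ?P i) \<le> 1" for i by (simp add: coeff_quad_rel)
  ultimately have cF: "degree (coeff F i) \<le> 1" for i
    using coeff_degree_bound[OF he F(3) bevF min, of ?P 1] by blast
  have lin: "\<exists>a b. u = [:a, b:]" if "degree u \<le> 1" for u :: "'k poly"
  proof -
    obtain a v where v: "u = pCons a v" by (rule pCons_cases)
    then have "degree v = 0" using that by (auto simp: degree_pCons_eq_if split: if_splits)
    then show ?thesis using v by (auto elim!: degree_eq_zeroE)
  qed
  obtain p0 p1 where p01: "coeff F 0 = - [:p0, p1:]" using lin[of "- coeff F 0"] cF[of 0] by (metis degree_minus minus_minus)
  obtain q0 q1 where q01: "coeff F 1 = [:q0, q1:]" using lin cF[of 1] by blast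
  have Feq: "F = [:- [:p0, p1:], [:q0, q1:]:]"
  proof -
    obtain a v where v: "F = pCons a v" by (rule pCons_cases)
    then have "degree v = 0" using degF by (auto simp: degree_pCons_eq_if split: if_splits)
    then obtain b where "v = [:b:]" by (auto elim!: degree_eq_zeroE)
    then show ?thesis using v p01 q01 by simp
  qed
  have eq: "k X * h (to_fract [:q0, q1:]) = h (to_fract [:p0, p1:])"
    using bevF unfolding Feq by (simp only: bev_simps[OF he] to_fract_uminus emb_uminus[OF he]) simp
  have q: "[:q0, q1:] \<noteq> 0"
  proof
    assume "[:q0, q1:] = 0"
    then have "degree F = 0" unfolding Feq by simp
    then show False using degF by simp
  qed
  \<comment> \<open>Proportional numerator and denominator would make the coordinate z
    constant.\<close>
  have "p1 * q0 - p0 * q1 \<noteq> 0"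
  proof
    assume det: "p1 * q0 - p0 * q1 = 0"
    obtain e where e: "[:p0, p1:] = smult e [:q0, q1:]"
    proof (cases "q1 = 0")
      case True
      then show ?thesis using q det by (intro that[of "p0 / q0"]) auto
    next
      case False
      then show ?thesis using det by (intro that[of "p1 / q1"]) (auto simp: field_simps)
    qed
    have "h (to_fract [:p0, p1:]) = C e * h (to_fract [:q0, q1:])"
    proof -
      have "to_fract [:p0, p1:] = P1 e * to_fract [:q0, q1:]"
        unfolding e P1_def by (simp flip: to_fract_mult)
      then show ?thesis by (simp add: emb_mult[OF he] morphism_const[OF h])
    qed
    then have "k X = k (P1 e)"
      using eq q by (auto simp: emb_eq_zero_iff[OF he] morphism_const[OF k])
    then show False by (simp add: emb_eq_iff[OF ke])
  qed
  then show thesis using eq by (rule that)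
qed

text \<open>Both coordinates generate the same subfield k(x), so they differ by a Moebius
  transformation, and the two square roots differ by a factor in k(x). The sextics thus agree up to
  squares, and the parity of orders matches their roots.\<close>

lemma sextic_models_moebius:
  fixes C :: "'k::{alg_closed_field, field_char_0} \<Rightarrow> 'c::field"
  assumes "sextic_model C a r" "sextic_model C a' r'"
  obtains p0 p1 q0 q1 \<sigma> where "p1 * q0 - p0 * q1 \<noteq> 0" "\<sigma> permutes {1..6}"
    "\<And>i. i \<in> {1..6} \<Longrightarrow> q0 + q1 * r i \<noteq> 0 \<and> r' (\<sigma> i) = (p0 + p1 * r i) / (q0 + q1 * r i)"
proof -
  obtain h y where a: "a \<noteq> 0" "inj_on r {1..6}" and h: "morphism C P1 h"
    and y: "y \<notin> range h" "y\<^sup>2 = h (to_fract (sextic a r))" "\<And>z. \<exists>a b. z = h a + h b * y"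
    using assms(1) unfolding sextic_model_def isomorphic_to_hyperelliptic_def by blast
  obtain k u where a': "a' \<noteq> 0" "inj_on r' {1..6}" and k: "morphism C P1 k"
    and u: "u \<notin> range k" "u\<^sup>2 = k (to_fract (sextic a' r'))" "\<And>z. \<exists>a b. z = k a + k b * u"
    using assms(2) unfolding sextic_model_def isomorphic_to_hyperelliptic_def by blast
  note he = morphism_emb[OF h] and ke = morphism_emb[OF k]
  have kh: "k X \<in> range h" by (rule hyperelliptic_X_in_range[OF h y(2,3) a k u(2,3)])
  have hk: "h X \<in> range k" by (rule hyperelliptic_X_in_range[OF k u(2,3) a' h y(2,3)])
  have range: "range k = range h"
    using range_subset_if_X[OF h k kh] range_subset_if_X[OF k h hk] by blast
  obtain p0 p1 q0 q1 where det: "p1 * q0 - p0 * q1 \<noteq> 0"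
    and eq: "k X * h (to_fract [:q0, q1:]) = h (to_fract [:p0, p1:])"
    by (rule moebius_if_ranges_eq[OF h k kh hk])
  let ?p = "[:p0, p1:]" and ?q = "[:q0, q1:]"
  have two: "(2 :: 'c) \<noteq> 0"
  proof -
    have "h (P1 2) \<noteq> 0" by (simp add: emb_eq_zero_iff[OF he] emb_eq_zero_iff[OF P1_emb])
    then show ?thesis by (simp add: emb_numeral[OF P1_emb] emb_numeral[OF he])
  qed
  obtain s t where st: "u = h s + h t * y" using y(3) by blast
  have "u\<^sup>2 \<in> range h" using u(2) range by auto
  then obtain v where v: "u\<^sup>2 = h v" by auto
  \<comment> \<open>Both u^2 and y^2 lie in k(x), so the cross term 2 s t y of u^2 must vanish. As u
    itself is not in k(x), it is a multiple of y.\<close>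
  have "h (s * t) = 0"
  proof (rule ccontr)
    assume nz: "h (s * t) \<noteq> 0"
    have "2 * h (s * t) * y = h (v - s\<^sup>2 - t\<^sup>2 * to_fract (sextic a r))"
      using v by (simp add: st power2_sum y(2) emb_add[OF he] emb_diff[OF he] emb_mult[OF he] emb_power[OF he] power_mult_distrib algebra_simps)
    then have "y = h ((v - s\<^sup>2 - t\<^sup>2 * to_fract (sextic a r)) / (2 * (s * t)))"
      using two nz unfolding emb_divide[OF he] emb_mult[OF he, of 2] emb_numeral[OF he]
      by (simp add: field_simps)
    then show False using y(1) by auto
  qed
  then have "s = 0 \<or> t = 0" by (simp add: emb_eq_zero_iff[OF he])
  moreover have "t \<noteq> 0"
  proof
    assume "t = 0"
    then have "u = h s" using st by (simp add: emb_zero[OF he])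
    then show False using u(1) range by auto
  qed
  ultimately have "u = h t * y" using st by (simp add: emb_zero[OF he])
  then have u2: "k (to_fract (sextic a' r')) = h (t\<^sup>2 * to_fract (sextic a r))"
    using u(2) y(2) by (simp add: power_mult_distrib emb_mult[OF he] emb_power[OF he])
  have C: "field_embedding C"
    using field_embedding_comp[OF ke P1_emb] morphism_const[OF k] by (simp add: comp_def)
  \<comment> \<open>The second sextic at p / q, multiplied by q^6.\<close>
  define G where "G = smult a' (\<Prod>j = 1..6. ?p - smult (r' j) ?q)"
  have hc: "h (to_fract [:c:]) = C c" for c
    using morphism_const[OF h, of c] by (simp add: P1_def)
  have fac: "(k X - C c) * h (to_fract ?q) = h (to_fract (?p - smult c ?q))" for c
  proof -
    have "to_fract (?p - smult c ?q) = to_fract ?p - P1 c * to_fract ?q"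
      by (simp add: P1_def flip: to_fract_mult to_fract_diff)
    then show ?thesis
      by (simp only: emb_diff[OF he] emb_mult[OF he] morphism_const[OF h] eq[symmetric]) (simp add: algebra_simps)
  qed
  have "k (to_fract (sextic a' r')) = C a' * (\<Prod>j = 1..6. k X - C (r' j))"
    by (subst morphism_to_fract[OF k])
      (simp add: sextic_def ev_simps[OF C] emb_uminus[OF C] emb_one[OF C] algebra_simps)
  then have "k (to_fract (sextic a' r')) * h (to_fract ?q) ^ 6
      = C a' * (\<Prod>j = 1..6. (k X - C (r' j)) * h (to_fract ?q))"
    by (simp add: prod.distrib)
  also have "\<dots> = h (to_fract G)"
  proof -
    have "to_fract G = P1 a' * (\<Prod>j = 1..6. to_fract (?p - smult (r' j) ?q))"
    proof -
      have "to_fract (prod w S) = (\<Prod>j\<in>S. to_fract (w j))" for w :: "nat \<Rightarrow> 'k poly" and S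
        by (induction S rule: infinite_finite_induct) auto
      moreover have "to_fract (smult c w) = P1 c * to_fract w" for c :: 'k and w
        by (simp add: P1_def flip: to_fract_mult)
      ultimately show ?thesis by (simp only: G_def)
    qed
    then show ?thesis by (simp only: fac emb_mult[OF he] emb_prod[OF he] morphism_const[OF h])
  qed
  finally have hG: "t\<^sup>2 * to_fract (sextic a r) * to_fract ?q ^ 6 = to_fract G"
    by (simp only: u2 emb_mult[OF he, symmetric] emb_power[OF he, symmetric] emb_eq_iff[OF he])
  obtain b m where bm: "t = to_fract b / to_fract m" "m \<noteq> 0" by (rule fract_cases_poly)
  have b0: "b \<noteq> 0" using bm \<open>t \<noteq> 0\<close> by auto
  have tm: "t * to_fract m = to_fract b" using bm by simp
  have "to_fract (b\<^sup>2 * sextic a r * ?q ^ 6) = to_fract (m\<^sup>2 * G)"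
  proof -
    have "to_fract (w ^ n) = to_fract w ^ n" for w :: "'k poly" and n by (induction n) auto
    then have "to_fract (b\<^sup>2 * sextic a r * ?q ^ 6) = (t * to_fract m)\<^sup>2 * to_fract (sextic a r) * to_fract ?q ^ 6"
      by (simp only: to_fract_mult tm)
    also have "\<dots> = (to_fract m)\<^sup>2 * (t\<^sup>2 * to_fract (sextic a r) * to_fract ?q ^ 6)"
      by (simp only: power_mult_distrib ac_simps)
    also have "\<dots> = to_fract (m\<^sup>2 * G)" unfolding hG by (simp add: power2_eq_square)
    finally show ?thesis .
  qed
  then have key: "b\<^sup>2 * sextic a r * ?q ^ 6 = m\<^sup>2 * G" by (simp only: to_fract_eq_iff)
  have q0: "?q \<noteq> 0" using det by auto
  have G0: "G \<noteq> 0" using key b0 a(1) q0 bm by (auto simp: sextic_neq_0)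
  \<comment> \<open>The order of \<open>G\<close> at a root of the first sextic is odd, so some
    factor p - r'_j q vanishes there. The denominator cannot vanish too, since the determinant is
    nonzero; so no root is sent to infinity.\<close>
  have ex: "\<exists>j \<in> {1..6}. q0 + q1 * r i \<noteq> 0 \<and> r' j = (p0 + p1 * r i) / (q0 + q1 * r i)"
    if i: "i \<in> {1..6}" for i
  proof -
    have op: "order (r i) (w ^ n) = n * order (r i) w" if "w \<noteq> 0" for w n
      using that by (induction n) (auto simp: order_mult order_0I)
    have "2 * order (r i) b + order (r i) (sextic a r) + 6 * order (r i) ?q = 2 * order (r i) m + order (r i) G"
      using arg_cong[OF key, of "order (r i)"] b0 a(1) q0 bm G0
      by (simp add: order_mult op sextic_neq_0 del: power_Suc)
    then have "odd (order (r i) G)" using order_sextic_root[OF a i] by presburger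
    then have "order (r i) G \<noteq> 0" by presburger
    then have "poly G (r i) = 0" using order_root by blast
    then have "\<exists>j \<in> {1..6}. poly (?p - smult (r' j) ?q) (r i) = 0"
      using a'(1) by (auto simp: G_def poly_prod)
    then obtain j where j: "j \<in> {1..6}" "p0 + p1 * r i = r' j * (q0 + q1 * r i)"
      by (auto simp: algebra_simps)
    moreover have "q0 + q1 * r i \<noteq> 0"
    proof
      assume *: "q0 + q1 * r i = 0"
      then have **: "p0 + p1 * r i = 0" using j by simp
      have "p1 * q0 - p0 * q1 = p1 * (q0 + q1 * r i) - q1 * (p0 + p1 * r i)" by (simp add: algebra_simps)
      then show False using det * ** by simp
    qed
    ultimately show ?thesis by (auto simp: field_simps)
  qed
  then obtain s where s: "\<And>i. i \<in> {1..6} \<Longrightarrow> s i \<in> {1..6} \<and> q0 + q1 * r i \<noteq> 0 \<and>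
      r' (s i) = (p0 + p1 * r i) / (q0 + q1 * r i)"
    by metis
  have "inj_on s {1..6}"
  proof (rule inj_onI)
    fix i j assume ij: "i \<in> {1..6}" "j \<in> {1..6}" "s i = s j"
    then have "(p0 + p1 * r i) / (q0 + q1 * r i) = (p0 + p1 * r j) / (q0 + q1 * r j)"
      using s by metis
    then have "(p0 + p1 * r i) * (q0 + q1 * r j) = (p0 + p1 * r j) * (q0 + q1 * r i)"
      using s ij by (simp add: frac_eq_eq)
    then have "(p1 * q0 - p0 * q1) * (r i - r j) = 0" by (simp add: algebra_simps)
    then have "r i = r j" using det by simp
    then show "i = j" using a(2) ij by (auto dest: inj_onD)
  qed
  define \<sigma> where "\<sigma> i = (if i \<in> {1..6} then s i else i)" for i
  have "s ` {1..6} = {1..6}"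
    by (rule endo_inj_surj[OF _ _ \<open>inj_on s {1..6}\<close>]) (use s in auto)
  then have "bij_betw s {1..6} {1..6}" using \<open>inj_on s {1..6}\<close> by (simp add: bij_betw_def)
  then have "bij_betw \<sigma> {1..6} {1..6}" by (rule bij_betw_cong[THEN iffD1, rotated]) (auto simp: \<sigma>_def)
  then have "\<sigma> permutes {1..6}" by (rule bij_imp_permutes) (auto simp: \<sigma>_def)
  then show thesis using det s by (intro that[of p1 q0 p0 q1 \<sigma>]) (auto simp: \<sigma>_def)
qed

section \<open>Change of coordinates\<close>

lemma ev_pcompose:
  assumes "field_embedding C"
  shows "ev C s (pcompose p q) = ev C (ev C s q) p"
  by (induction p) (auto simp: pcompose_pCons ev_simps[OF assms])

text \<open>Substituting x = x0 + D s multiplies the sextic by D^6 = (D^3)^2, which is absorbed by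
  dividing y by D^3.\<close>

lemma isomorphic_to_hyperelliptic_affine:
  fixes C :: "'k::alg_closed_field \<Rightarrow> 'c::field"
  assumes iso: "isomorphic_to_hyperelliptic C f" and D: "D \<noteq> 0"
    and f: "pcompose f [:x0, D:] = smult (D ^ 6) g"
  shows "isomorphic_to_hyperelliptic C g"
proof -
  obtain h y where h: "morphism C P1 h" and y: "y \<notin> range h" "y\<^sup>2 = h (to_fract f)"
    "\<And>z. \<exists>a b. z = h a + h b * y"
    using iso unfolding isomorphic_to_hyperelliptic_def by blast
  note he = morphism_emb[OF h] and C = morphism_base_emb[OF h]
  define s where "s = (h X - C x0) / C D"
  have CD: "C D \<noteq> 0" using D by (simp add: emb_eq_zero_iff[OF C])
  have hX: "h X = C x0 + C D * s" using CD by (simp add: s_def)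
  have "s \<notin> range C"
  proof
    assume "s \<in> range C"
    then obtain k where "s = C k" by auto
    then have "h X = h (P1 (x0 + D * k))"
      using hX by (simp add: morphism_const[OF h] emb_add[OF C] emb_mult[OF C])
    then show False by (simp add: emb_eq_iff[OF he])
  qed
  then have tr: "transcendental C s" by (rule transcendentalI[OF C])
  let ?k = "subst C s"
  note k = subst_morphism[OF C tr] and ke = morphism_emb[OF subst_morphism[OF C tr]]
  have kX: "?k X = s" by (rule subst_X[OF C tr])
  have "s = h ((X - P1 x0) / P1 D)"
    by (simp add: s_def emb_divide[OF he] emb_diff[OF he] morphism_const[OF h])
  then have "?k X \<in> range h" unfolding kX by blast
  moreover have "h X = ?k (P1 x0 + P1 D * X)"
    by (simp add: hX emb_add[OF ke] emb_mult[OF ke] morphism_const[OF k] kX)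
  then have "h X \<in> range ?k" by blast
  ultimately have range: "range ?k = range h"
    using range_subset_if_X[OF h k] range_subset_if_X[OF k h] by blast
  have "h (to_fract f) = ev C (h X) f" by (rule morphism_to_fract[OF h])
  also have "\<dots> = ev C s (pcompose f [:x0, D:])"
    by (simp add: ev_pcompose[OF C] hX ev_simps[OF C] mult.commute)
  also have "\<dots> = (C D ^ 3)\<^sup>2 * ?k (to_fract g)"
    by (simp add: f ev_simps[OF C] emb_power[OF C] subst_to_fract[OF C tr] flip: power_mult)
  finally have y2: "y\<^sup>2 = (C D ^ 3)\<^sup>2 * ?k (to_fract g)" using y(2) by simp
  define y' where "y' = y / C D ^ 3"
  have kD: "C D ^ 3 = ?k (P1 (D ^ 3))" by (simp add: morphism_const[OF k] emb_power[OF C])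
  have yy: "y = ?k (P1 (D ^ 3)) * y'" using CD by (simp add: y'_def flip: kD)
  show ?thesis
    unfolding isomorphic_to_hyperelliptic_def
  proof (intro exI[of _ ?k] exI[of _ y'] conjI allI)
    show "morphism C P1 ?k" by (rule k)
    show "y' \<notin> range ?k"
    proof
      assume "y' \<in> range ?k"
      then obtain a where "y' = ?k a" by auto
      then have "y = ?k (P1 (D ^ 3) * a)" using yy by (simp add: emb_mult[OF ke])
      then show False using y(1) range by blast
    qed
    show "y'\<^sup>2 = ?k (to_fract g)" using y2 CD by (simp add: y'_def power_divide)
    fix z
    obtain a b where ab: "z = h a + h b * y" using y(3) by blast
    obtain a' where a': "h a = ?k a'" using range by (metis rangeE rangeI)
    obtain b' where b': "h b = ?k b'" using range by (metis rangeE rangeI)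
    have "z = ?k a' + ?k (b' * P1 (D ^ 3)) * y'"
      by (simp add: ab a' b' yy emb_mult[OF ke] mult.assoc)
    then show "\<exists>a b. z = ?k a + ?k b * y'" by blast
  qed
qed

section \<open>Sextics with prescribed critical points\<close>

text \<open>
  If a monic quartic $p$ has the critical points $a, b, c$, then \<open>crit_quadratic a b c\<close> is
  $(p(x) - p(a)) / (x - a)^2$.
\<close>

definition crit_quadratic :: "'k::field_char_0 \<Rightarrow> 'k \<Rightarrow> 'k \<Rightarrow> 'k poly" where
  "crit_quadratic a b c = [:3 * a\<^sup>2 - 8 / 3 * a * (a + b + c) + 2 * (a * b + a * c + b * c),
     2 * a - 4 / 3 * (a + b + c), 1:]"

text \<open>The three decompositions share all coefficients except the constant one, and the three
  c_i are the roots of the derivative. Vieta's formulas then express the quadratic cofactor by the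
  critical points.\<close>

lemma quartic_quadratics:
  fixes c1 c2 c3 :: "'k::field_char_0"
  assumes U: "U - [:q1:] = smult L ([:- c1, 1:]\<^sup>2 * [:s1, p1, 1:])"
      "U - [:q2:] = smult L ([:- c2, 1:]\<^sup>2 * [:s2, p2, 1:])"
      "U - [:q3:] = smult L ([:- c3, 1:]\<^sup>2 * [:s3, p3, 1:])"
    and L: "L \<noteq> 0" and ne: "c1 \<noteq> c2" "c1 \<noteq> c3" "c2 \<noteq> c3"
  shows "[:s1, p1, 1:] = crit_quadratic c1 c2 c3"
proof -
  have exp: "[:- c, 1:]\<^sup>2 * [:s, p, 1:] = [:c\<^sup>2 * s, c\<^sup>2 * p - 2 * c * s, c\<^sup>2 - 2 * c * p + s, p - 2 * c, 1:]"
    for c s p :: 'k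
    by (simp add: power2_eq_square algebra_simps)
  have co: "coeff U 1 = L * (c\<^sup>2 * p - 2 * c * s)" "coeff U 2 = L * (c\<^sup>2 - 2 * c * p + s)"
    "coeff U 3 = L * (p - 2 * c)"
    if "U - [:q:] = smult L ([:- c, 1:]\<^sup>2 * [:s, p, 1:])" for q c s p
  proof -
    have U: "U = [:q:] + smult L [:c\<^sup>2 * s, c\<^sup>2 * p - 2 * c * s, c\<^sup>2 - 2 * c * p + s, p - 2 * c, 1:]"
      using that unfolding exp by (simp add: diff_eq_eq add.commute)
    show "coeff U 1 = L * (c\<^sup>2 * p - 2 * c * s)" "coeff U 2 = L * (c\<^sup>2 - 2 * c * p + s)"
      "coeff U 3 = L * (p - 2 * c)"
      by (simp_all add: U numeral_eq_Suc)
  qed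
  \<comment> \<open>\<open>m\<close>, \<open>n\<close>, \<open>l\<close> are the coefficients of
    x^3, x^2 and x in U / L.\<close>
  define m where "m = p1 - 2 * c1"
  define n where "n = c1\<^sup>2 - 2 * c1 * p1 + s1"
  define l where "l = c1\<^sup>2 * p1 - 2 * c1 * s1"
  have "p1 - 2 * c1 = m" "p2 - 2 * c2 = m" "p3 - 2 * c3 = m"
    using co(3)[OF U(1)] co(3)[OF U(2)] co(3)[OF U(3)] L by (auto simp: m_def)
  then have p: "p1 = m + 2 * c1" "p2 = m + 2 * c2" "p3 = m + 2 * c3" by (auto simp: diff_eq_eq)
  have n2: "c2\<^sup>2 - 2 * c2 * p2 + s2 = n" "c3\<^sup>2 - 2 * c3 * p3 + s3 = n"
    using co(2)[OF U(1)] co(2)[OF U(2)] co(2)[OF U(3)] L by (auto simp: n_def)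
  have l2: "c2\<^sup>2 * p2 - 2 * c2 * s2 = l" "c3\<^sup>2 * p3 - 2 * c3 * s3 = l"
    using co(1)[OF U(1)] co(1)[OF U(2)] co(1)[OF U(3)] L by (auto simp: l_def)
  \<comment> \<open>The derivative of U / L vanishes at the critical point.\<close>
  have cub: "4 * c ^ 3 + 3 * m * c\<^sup>2 + 2 * n * c + l = 0"
    if "c\<^sup>2 * p - 2 * c * s = l" "c\<^sup>2 - 2 * c * p + s = n" "p = m + 2 * c" for c s p
  proof -
    have "s = n - c\<^sup>2 + 2 * c * p" using that(2) by (auto simp: algebra_simps)
    then show ?thesis unfolding that(1)[symmetric] that(3) by algebra
  qed
  have c: "4 * c1 ^ 3 + 3 * m * c1\<^sup>2 + 2 * n * c1 + l = 0" "4 * c2 ^ 3 + 3 * m * c2\<^sup>2 + 2 * n * c2 + l = 0"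
    "4 * c3 ^ 3 + 3 * m * c3\<^sup>2 + 2 * n * c3 + l = 0"
    using cub[OF l_def[symmetric] n_def[symmetric] p(1)] cub[OF l2(1) n2(1) p(2)] cub[OF l2(2) n2(2) p(3)]
    by blast+
  \<comment> \<open>Taking divided differences twice amounts to Vieta's formulas for the
    derivative.\<close>
  have "(c1 - c2) * (4 * (c1\<^sup>2 + c1 * c2 + c2\<^sup>2) + 3 * m * (c1 + c2) + 2 * n) = 0" using c by algebra
  then have d12: "4 * (c1\<^sup>2 + c1 * c2 + c2\<^sup>2) + 3 * m * (c1 + c2) + 2 * n = 0" using ne by simp
  have "(c1 - c3) * (4 * (c1\<^sup>2 + c1 * c3 + c3\<^sup>2) + 3 * m * (c1 + c3) + 2 * n) = 0" using c by algebra
  then have d13: "4 * (c1\<^sup>2 + c1 * c3 + c3\<^sup>2) + 3 * m * (c1 + c3) + 2 * n = 0" using ne by simp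
  have "(c2 - c3) * (4 * (c1 + c2 + c3) + 3 * m) = 0" using d12 d13 by algebra
  then have "4 * (c1 + c2 + c3) + 3 * m = 0" using ne by simp
  then have m: "3 * m = - 4 * (c1 + c2 + c3)" by algebra
  then have "2 * (n - 2 * (c1 * c2 + c1 * c3 + c2 * c3)) = 0" using d12 by algebra
  then have "n - 2 * (c1 * c2 + c1 * c3 + c2 * c3) = 0" by (metis mult_eq_0_iff zero_neq_numeral)
  then have n: "n = 2 * (c1 * c2 + c1 * c3 + c2 * c3)" by (simp only: right_minus_eq)
  have m': "m = - 4 / 3 * (c1 + c2 + c3)" using m by (simp add: field_simps)
  have "p1 = 2 * c1 - 4 / 3 * (c1 + c2 + c3)" using p(1) m' by simp
  moreover have "s1 = 3 * c1\<^sup>2 - 8 / 3 * c1 * (c1 + c2 + c3) + 2 * (c1 * c2 + c1 * c3 + c2 * c3)"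
  proof -
    have "s1 = n - c1\<^sup>2 + 2 * c1 * p1" by (simp add: n_def)
    then show ?thesis unfolding p(1) n m' by (simp add: power2_eq_square algebra_simps)
  qed
  ultimately show ?thesis by (simp add: crit_quadratic_def)
qed

lemma crit_quadratic_commute: "crit_quadratic a b c = crit_quadratic a c b"
  by (simp add: crit_quadratic_def algebra_simps)

definition crit_sextic :: "'k::field_char_0 \<Rightarrow> 'k \<Rightarrow> 'k \<Rightarrow> 'k poly" where
  "crit_sextic a b c = crit_quadratic a b c * crit_quadratic b a c * crit_quadratic c a b"

lemma crit_sextic_commute:
  "crit_sextic a b c = crit_sextic b a c" "crit_sextic a b c = crit_sextic a c b"
  unfolding crit_sextic_def crit_quadratic_commute[of c b a] crit_quadratic_commute[of a c b]
  by (simp_all only: ac_simps)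

lemma crit_quadratic_affine:
  assumes "a = x + D * a'" "b = x + D * b'" "c = x + D * c'"
  shows "pcompose (crit_quadratic a b c) [:x, D:] = smult (D\<^sup>2) (crit_quadratic a' b' c')"
  unfolding crit_quadratic_def assms
  by (simp add: pcompose_pCons power2_eq_square field_simps)

lemma crit_sextic_affine:
  assumes "a = x + D * a'" "b = x + D * b'" "c = x + D * c'"
  shows "pcompose (crit_sextic a b c) [:x, D:] = smult (D ^ 6) (crit_sextic a' b' c')"
  by (simp add: crit_sextic_def pcompose_mult crit_quadratic_affine[OF assms]
      crit_quadratic_affine[OF assms(2,1,3)] crit_quadratic_affine[OF assms(3,1,2)] mult.assoc flip: power_add)

lemma crit_sextic_target:
  fixes b :: "'k::field_char_0"
  shows "[:(1 - b) / 3, 2 / 3 * (1 - b), 1:] *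
       [:1 / 12 * (b - 4) * b, 1 / 3 * (b - 4), 1:] *
       [:b, - (2 / 3 * (b + 2)), 1:] = crit_sextic 1 (b / 2) 0"
proof -
  have "[:(1 - b) / 3, 2 / 3 * (1 - b), 1:] = crit_quadratic 1 (b / 2) 0"
    "[:1 / 12 * (b - 4) * b, 1 / 3 * (b - 4), 1:] = crit_quadratic (b / 2) 1 0"
    "[:b, - (2 / 3 * (b + 2)), 1:] = crit_quadratic 0 1 (b / 2)"
    by (simp_all add: crit_quadratic_def power2_eq_square field_simps)
  then show ?thesis by (simp only: crit_sextic_def)
qed

section \<open>The two cases\<close>

lemma orbit_sum_translate: "orbit_sum (\<lambda>i. m + r i) S = orbit_sum r S"
  by (simp add: orbit_sum_def square_diff_def)

definition relation12 :: "'k::field_char_0 \<Rightarrow> 'k \<Rightarrow> 'k" where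
  "relation12 x y = 3652054494822999
     - 312800728170302145 * x
     - 247728254774362875 * x ^ 2
     + 3039113062253125 * x ^ 3
     - 522534367747902600 * y
     - 28017734537115000 * x * y
     - 238234372300000 * y ^ 2"

definition relation13 :: "'k::field_char_0 \<Rightarrow> 'k \<Rightarrow> 'k" where
  "relation13 x z = 1158391804615233525 * x
     - 17653298856896250 * x ^ 2
     + 100894442906250 * x ^ 3
     - 256292578125 * x ^ 4
     + 244140625 * x ^ 5
     - 323890167989102732668800000 * z
     - 14879672225288904960000000 * x * z
     - 40609431102258000000000 * x ^ 2 * z
     - 16677181699666569
     - 347405361918358396861440000000000 * z ^ 2"

text \<open>The first relation has weight 6 and the second weight 10, where i_1, i_2, i_3 have
  weights 2, 3, 5. Multiplication by this power of j2 clears the denominators and leaves polynomial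
  identities in \<open>A\<close> and \<open>B\<close>.\<close>

lemma model_equations:
  fixes A B :: "'k::field_char_0"
  assumes J: "j2 = - 800 * A - 5880 * B" "j4 = 64 * A\<^sup>2 + 242784 * A * B + 2055780 * B\<^sup>2"
      "j6 = - 16896 * A ^ 3 - 61576576 * A\<^sup>2 * B - 843047136 * A * B\<^sup>2 - 3048065640 * B ^ 3"
      "j10 = - 512 * B * (4 * A + 27 * B) ^ 4"
    and nz: "j2 \<noteq> 0"
    and i: "x = 144 * j4 / j2 ^ 2" "y = - 1728 * (j2 * j4 - 3 * j6) / j2 ^ 3" "z = 486 * j10 / j2 ^ 5"
  shows "relation12 x y = 0"
    and "relation13 x z = 0"
proof -
  have X: "x * j2 ^ 2 = 144 * j4" and Y: "y * j2 ^ 3 = - 1728 * (j2 * j4 - 3 * j6)"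
    and Z: "z * j2 ^ 5 = 486 * j10"
    using nz by (simp_all add: i)
  have "relation12 x y * j2 ^ 6 =
      3652054494822999 * j2 ^ 6 - 312800728170302145 * (x * j2 ^ 2) * j2 ^ 4
          - 247728254774362875 * (x * j2 ^ 2) ^ 2 * j2 ^ 2
          + 3039113062253125 * (x * j2 ^ 2) ^ 3 - 522534367747902600 * (y * j2 ^ 3) * j2 ^ 3
          - 28017734537115000 * (x * j2 ^ 2) * (y * j2 ^ 3) * j2
          - 238234372300000 * (y * j2 ^ 3) ^ 2"
    unfolding relation12_def by algebra
  also have "\<dots> = 0" unfolding X Y unfolding J by algebra
  finally show "relation12 x y = 0" using nz by simp
  have "relation13 x z * j2 ^ 10 =
      1158391804615233525 * (x * j2 ^ 2) * j2 ^ 8 - 17653298856896250 * (x * j2 ^ 2) ^ 2 * j2 ^ 6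
          + 100894442906250 * (x * j2 ^ 2) ^ 3 * j2 ^ 4
          - 256292578125 * (x * j2 ^ 2) ^ 4 * j2 ^ 2 + 244140625 * (x * j2 ^ 2) ^ 5
          - 323890167989102732668800000 * (z * j2 ^ 5) * j2 ^ 5
          - 14879672225288904960000000 * (x * j2 ^ 2) * (z * j2 ^ 5) * j2 ^ 3
          - 40609431102258000000000 * (x * j2 ^ 2) ^ 2 * (z * j2 ^ 5) * j2 - 16677181699666569 * j2 ^ 10
          - 347405361918358396861440000000000 * (z * j2 ^ 5) ^ 2"
    unfolding relation13_def by algebra
  also have "\<dots> = 0" unfolding X Z unfolding J by algebra
  finally show "relation13 x z = 0" using nz by simp
qed

text \<open>The conclusion is J_2 = 0 for the critical points 0, 1, \<mu>: after centring, e^3 =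
  -(\<mu>^2 - \<mu> + 1)^3 / 27 and f^2 = ((\<mu> + 1)(\<mu> - 2)(2 \<mu> - 1))^2 / 729, so 20 e^3 +
  147 f^2 = 0 gives the coefficients 180 and 49. The radicals solve it by Cardano's formula.\<close>

lemma critical_ratio_equation:
  fixes im rt5 alpha beta s b \<mu> :: "'k::field_char_0"
  assumes "im ^ 2 = -1" "rt5 ^ 2 = 5" and al: "alpha ^ 3 = 2837051 + 9408 * im * rt5"
    and be: "beta = 8511153 + 28224 * im * rt5"
    and s: "s ^ 2 = 429 * alpha ^ 2 + 60123 * alpha + beta"
    and b: "b = (2 * alpha + s) / (2 * alpha)" and \<mu>: "\<mu> = b / 2"
  shows "180 * (\<mu>\<^sup>2 - \<mu> + 1) ^ 3 = 49 * ((\<mu> + 1) * (\<mu> - 2) * (2 * \<mu> - 1))\<^sup>2"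
proof -
  have q: "(alpha ^ 3 - 2837051)\<^sup>2 = - 442552320" using assms(1,2) unfolding al by algebra
  \<comment> \<open>20041^3 = 2837051^2 + 442552320 is the product of alpha^3 and its conjugate, so
    (20041 / alpha)^3 is that conjugate.\<close>
  have q': "alpha ^ 6 + 20041 ^ 3 = 5674102 * alpha ^ 3"
    using q by algebra
  have a0: "alpha \<noteq> 0"
  proof
    assume "alpha = 0"
    then show False using q' by simp
  qed
  \<comment> \<open>Centring at 1/2 turns the symmetry \<mu> -> 1 - \<mu> into v -> -v and leaves a
    cubic in v^2.\<close>
  define v where "v = 2 * \<mu> - 1"
  have v: "v * (2 * alpha) = s" using a0 by (simp add: v_def \<mu> b field_simps)
  have be': "beta = 3 * alpha ^ 3" unfolding be al by (simp add: algebra_simps)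
  \<comment> \<open>This shift of v^2 removes the quadratic term of the cubic. Its root is k = alpha
    + 20041 / alpha, and 60123 = 3 * 20041, 5674102 = 2 * 2837051.\<close>
  define k where "k = (4 * v\<^sup>2 - 429) / 3"
  have k: "3 * k = 4 * v\<^sup>2 - 429" by (simp add: k_def)
  have cancel: "y = 0" if "x * y = 0" "x \<noteq> 0" for x y :: 'k
    using that by simp
  have "(3 * alpha) * (alpha\<^sup>2 + 20041 - k * alpha) = 0"
    using s k unfolding v[symmetric] be' by algebra
  then have "alpha\<^sup>2 + 20041 - k * alpha = 0" by (rule cancel) (use a0 in simp)
  then have e: "alpha\<^sup>2 + 20041 = k * alpha" by (simp only: right_minus_eq)
  have "alpha ^ 3 * (k ^ 3 - 60123 * k - 5674102) = 0"
    using q' e by algebra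
  then have "k ^ 3 - 60123 * k - 5674102 = 0" by (rule cancel) (use a0 in simp)
  then have kk: "k ^ 3 = 60123 * k + 5674102" by algebra
  have "16 * (4 * v ^ 6 - 1287 * v ^ 4 + 2754 * v\<^sup>2 - 1215) = 0"
    using k kk by algebra
  then have "4 * v ^ 6 - 1287 * v ^ 4 + 2754 * v\<^sup>2 - 1215 = 0" by (rule cancel) simp
  then have "64 * (180 * (\<mu>\<^sup>2 - \<mu> + 1) ^ 3 - 49 * ((\<mu> + 1) * (\<mu> - 2) * (2 * \<mu> - 1))\<^sup>2) = 0"
    unfolding v_def by algebra
  then have "180 * (\<mu>\<^sup>2 - \<mu> + 1) ^ 3 - 49 * ((\<mu> + 1) * (\<mu> - 2) * (2 * \<mu> - 1))\<^sup>2 = 0"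
    by (rule cancel) simp
  then show ?thesis by (simp only: right_minus_eq)
qed

text \<open>The product over the six orderings is symmetric in the critical points, hence a
  combination of e^3 and f^2. The equation for \<mu> makes it proportional to 20 e^3 + 147 f^2,
  because 27 * 49 / 180 = 147 / 20.\<close>

lemma critical_points_similar:
  fixes c1 c2 c3 \<mu> :: "'k::field_char_0"
  assumes sum: "c1 + c2 + c3 = 0"
    and J: "20 * (c1 * c2 + c1 * c3 + c2 * c3) ^ 3 + 147 * (c1 * c2 * c3)\<^sup>2 = 0"
    and \<mu>: "180 * (\<mu>\<^sup>2 - \<mu> + 1) ^ 3 = 49 * ((\<mu> + 1) * (\<mu> - 2) * (2 * \<mu> - 1))\<^sup>2"
  shows "c3 - c1 = \<mu> * (c2 - c1) \<or> c3 - c2 = \<mu> * (c1 - c2) \<or> c2 - c1 = \<mu> * (c3 - c1) \<or>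
    c2 - c3 = \<mu> * (c1 - c3) \<or> c1 - c2 = \<mu> * (c3 - c2) \<or> c1 - c3 = \<mu> * (c2 - c3)"
proof -
  have "(c3 - c1 - \<mu> * (c2 - c1)) * (c3 - c2 - \<mu> * (c1 - c2)) * (c2 - c1 - \<mu> * (c3 - c1)) *
    (c2 - c3 - \<mu> * (c1 - c3)) * (c1 - c2 - \<mu> * (c3 - c2)) * (c1 - c3 - \<mu> * (c2 - c3)) =
    (c1 * c2 + c1 * c3 + c2 * c3) ^ 3 * ((\<mu> + 1) * (\<mu> - 2) * (2 * \<mu> - 1))\<^sup>2 +
    27 * (c1 * c2 * c3)\<^sup>2 * (\<mu>\<^sup>2 - \<mu> + 1) ^ 3" (is "?P = ?e ^ 3 * ?I2 + 27 * ?f * ?I1")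
    using sum by algebra
  moreover have "20 * x = 0" if "x = e * i2 + 27 * f * i1" "20 * e + 147 * f = 0" "180 * i1 = 49 * i2"
    for x e f i1 i2 :: 'k using that by algebra
  ultimately have "20 * ?P = 0" using J \<mu> by blast
  moreover have "x = 0" if "20 * x = 0" for x :: 'k using that by simp
  ultimately have "?P = 0" by blast
  then show ?thesis by (simp only: mult_eq_0_iff right_minus_eq) blast
qed

lemma isomorphic_if_similar:
  fixes C :: "'k::{alg_closed_field, field_char_0} \<Rightarrow> 'c::field"
  assumes "isomorphic_to_hyperelliptic C (crit_sextic y z x)" "x \<noteq> y" "z - x = \<mu> * (y - x)"
  shows "isomorphic_to_hyperelliptic C (crit_sextic 1 \<mu> 0)"
proof (rule isomorphic_to_hyperelliptic_affine[OF assms(1)])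
  show "y - x \<noteq> 0" using assms(2) by simp
  show "pcompose (crit_sextic y z x) [:x, y - x:] = smult ((y - x) ^ 6) (crit_sextic 1 \<mu> 0)"
    by (rule crit_sextic_affine) (use assms(3) in \<open>simp_all add: diff_eq_eq mult.commute add.commute\<close>)
qed

lemma crit_quadratic_roots:
  fixes g1 g2 g3 w m :: "'k::field_char_0"
  assumes c: "c1 = m + g1\<^sup>2" "c2 = m + g2\<^sup>2" "c3 = m + g3\<^sup>2"
    and K: "g1\<^sup>2 + g2\<^sup>2 + g3\<^sup>2 = 0" and w: "w\<^sup>2 = - 2"
  shows "crit_quadratic c1 c2 c3 =
    [:- (m + (- g1\<^sup>2 + w * g2 * g3)), 1:] * [:- (m + (- g1\<^sup>2 - w * g2 * g3)), 1:]"
proof -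
  have S: "c1 + c2 + c3 = 3 * m" unfolding c using K by algebra
  have "2 * c1 - 4 / 3 * (c1 + c2 + c3) = - (m + (- g1\<^sup>2 + w * g2 * g3)) - (m + (- g1\<^sup>2 - w * g2 * g3))"
    unfolding S by (simp add: c)
  moreover have "3 * c1\<^sup>2 - 8 / 3 * c1 * (c1 + c2 + c3) + 2 * (c1 * c2 + c1 * c3 + c2 * c3) =
      (m + (- g1\<^sup>2 + w * g2 * g3)) * (m + (- g1\<^sup>2 - w * g2 * g3))"
  proof -
    have "8 / 3 * c1 * (c1 + c2 + c3) = 8 * c1 * m" unfolding S by simp
    then show ?thesis using K w unfolding c by algebra
  qed
  ultimately show ?thesis by (simp add: crit_quadratic_def algebra_simps)
qed

text \<open>The factor k combines the Moebius factor with the square of the leading coefficient.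
  J_2d scales by k^d, so the absolute invariants are the same for every model.\<close>

lemma invariants_covariant:
  fixes C :: "'k::{alg_closed_field, field_char_0} \<Rightarrow> 'c::field"
  assumes "sextic_model C 1 r" "sextic_model C a r'"
  obtains k where "k \<noteq> 0" "J2 a r' = k * J2 1 r" "J4 a r' = k ^ 2 * J4 1 r" "J6 a r' = k ^ 3 * J6 1 r"
    "J10 a r' = k ^ 5 * J10 1 r"
proof -
  obtain p0 p1 q0 q1 \<sigma> where det: "p1 * q0 - p0 * q1 \<noteq> 0" and \<sigma>: "\<sigma> permutes {1..6}"
    and m: "\<And>i. i \<in> {1..6} \<Longrightarrow> q0 + q1 * r i \<noteq> 0 \<and> r' (\<sigma> i) = (p0 + p1 * r i) / (q0 + q1 * r i)"
    using sextic_models_moebius[OF assms] by metis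
  define l where "l = (p1 * q0 - p0 * q1) ^ 6 / (\<Prod>i = 1..6. q0 + q1 * r i)\<^sup>2"
  have o: "orbit_sum r' S = l ^ n * orbit_sum r S" if "regular n S" for n S
    unfolding l_def by (rule orbit_sum_moebius[of \<sigma> n S q0 q1 r r' p0 p1, OF \<sigma> that m])
  have "(\<Prod>i = 1..6. q0 + q1 * r i) \<noteq> 0" using m by (simp add: prod_zero_iff)
  then have "l \<noteq> 0" using det by (simp add: l_def)
  moreover have "a \<noteq> 0" using assms(2) by (simp add: sextic_model_def)
  ultimately have "a\<^sup>2 * l \<noteq> 0" by simp
  moreover have "J2 a r' = a\<^sup>2 * l * J2 1 r" "J4 a r' = (a\<^sup>2 * l) ^ 2 * J4 1 r"
    "J6 a r' = (a\<^sup>2 * l) ^ 3 * J6 1 r" "J10 a r' = (a\<^sup>2 * l) ^ 5 * J10 1 r"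
    unfolding J2_def J4_def J6_def J10_edges o[OF regular_edge_sets(1)] o[OF regular_edge_sets(2)]
      o[OF regular_edge_sets(3)] o[OF regular_edge_sets(4)]
    by (simp_all add: power_mult_distrib flip: power_mult)
  ultimately show thesis by (rule that)
qed

theorem theorem1:
  fixes C :: "'k::{alg_closed_field, field_char_0} \<Rightarrow> 'c::field"
    and E :: "'k \<Rightarrow> 'e::field"
    and psi :: "'e \<Rightarrow> 'c"
    and im rt5 alpha beta s b :: 'k
  assumes "curve C" and "has_genus C 2"
    and "degree_4_degenerate_elliptic_subcover C E psi"
    and "im ^ 2 = -1" and "rt5 ^ 2 = 5"
    and "alpha ^ 3 = 2837051 + 9408 * im * rt5"
    and "beta = 8511153 + 28224 * im * rt5"
    and "s ^ 2 = 429 * alpha ^ 2 + 60123 * alpha + beta"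
    and "b = (2 * alpha + s) / (2 * alpha)"
  shows "isomorphic_to_hyperelliptic C
      ([:(1 - b) / 3, 2 / 3 * (1 - b), 1:] *
       [:1 / 12 * (b - 4) * b, 1 / 3 * (b - 4), 1:] *
       [:b, - (2 / 3 * (b + 2)), 1:])
    \<or>
    ((\<exists>a r. sextic_model C a r) \<and>
     (\<forall>a r. sextic_model C a r \<longrightarrow>
        J2 a r \<noteq> 0 \<and>
        3652054494822999
          - 312800728170302145 * i1 a r
          - 247728254774362875 * i1 a r ^ 2
          + 3039113062253125 * i1 a r ^ 3
          - 522534367747902600 * i2 a r
          - 28017734537115000 * i1 a r * i2 a r
          - 238234372300000 * i2 a r ^ 2 = 0 \<and>
        1158391804615233525 * i1 a r
          - 17653298856896250 * i1 a r ^ 2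
          + 100894442906250 * i1 a r ^ 3
          - 256292578125 * i1 a r ^ 4
          + 244140625 * i1 a r ^ 5
          - 323890167989102732668800000 * i3 a r
          - 14879672225288904960000000 * i1 a r * i3 a r
          - 40609431102258000000000 * i1 a r ^ 2 * i3 a r
          - 16677181699666569
          - 347405361918358396861440000000000 * i3 a r ^ 2 = 0))"
proof -
  let ?first = "isomorphic_to_hyperelliptic C
      ([:(1 - b) / 3, 2 / 3 * (1 - b), 1:] *
       [:1 / 12 * (b - 4) * b, 1 / 3 * (b - 4), 1:] *
       [:b, - (2 / 3 * (b + 2)), 1:])"
  have psi: "morphism C E psi" and deg: "degenerate C E psi"
    using assms(3) by (simp_all add: degree_4_degenerate_elliptic_subcover_def)
  obtain Q U L c d e where Q: "finite Q" "card Q = 3" and L: "L \<noteq> 0"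
    and U: "\<And>q. q \<in> Q \<Longrightarrow> U - [:q:] = smult L ([:- c q, 1:]\<^sup>2 * [:- d q, 1:] * [:- e q, 1:])"
    and cde: "\<And>q. q \<in> Q \<Longrightarrow> c q \<noteq> d q \<and> c q \<noteq> e q \<and> d q \<noteq> e q"
    and iso: "isomorphic_to_hyperelliptic C (\<Prod>q\<in>Q. [:- d q, 1:] * [:- e q, 1:])"
    by (rule hyperelliptic_normal_form[OF psi deg]) blast
  obtain q1 q2 q3 where q: "Q = {q1, q2, q3}" "q1 \<noteq> q2" "q1 \<noteq> q3" "q2 \<noteq> q3"
    using Q(2) by (auto simp: card_3_iff)
  have U': "U - [:q:] = smult L ([:- c q, 1:]\<^sup>2 * [:d q * e q, - (d q + e q), 1:])" if "q \<in> Q" for q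
    unfolding U[OF that] mult.assoc by (simp add: algebra_simps)
  \<comment> \<open>The critical points are distinct because they lie over different values.\<close>
  have Uc: "poly U (c q) = q" if "q \<in> Q" for q
    using arg_cong[OF U[OF that], of "\<lambda>p. poly p (c q)"] by simp
  have ne: "c q1 \<noteq> c q2" "c q1 \<noteq> c q3" "c q2 \<noteq> c q3"
    using Uc q by (metis insertI1 insertI2)+
  have in_Q: "q1 \<in> Q" "q2 \<in> Q" "q3 \<in> Q" using q by auto
  note U123 = U'[OF in_Q(1)] U'[OF in_Q(2)] U'[OF in_Q(3)]
  have quad: "[:d q1 * e q1, - (d q1 + e q1), 1:] = crit_quadratic (c q1) (c q2) (c q3)"
    "[:d q2 * e q2, - (d q2 + e q2), 1:] = crit_quadratic (c q2) (c q1) (c q3)"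
    "[:d q3 * e q3, - (d q3 + e q3), 1:] = crit_quadratic (c q3) (c q1) (c q2)"
    using quartic_quadratics[OF U123(1,2,3) L] quartic_quadratics[OF U123(2,1,3) L]
      quartic_quadratics[OF U123(3,1,2) L] ne by metis+
  have lin: "[:- d q, 1:] * [:- e q, 1:] = [:d q * e q, - (d q + e q), 1:]" for q
    by (simp add: algebra_simps)
  have prod_Q: "(\<Prod>q\<in>Q. G q) = G q1 * (G q2 * G q3)" for G :: "'k \<Rightarrow> 'k poly"
    using q by simp
  have iso': "isomorphic_to_hyperelliptic C (crit_sextic (c q1) (c q2) (c q3))"
    using iso unfolding lin prod_Q quad crit_sextic_def mult.assoc .
  \<comment> \<open>Centring at the mean makes the critical points sum to 0, as the model
    computation requires.\<close>
  define m where "m = (c q1 + c q2 + c q3) / 3"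
  obtain g1 where g1: "g1\<^sup>2 = c q1 - m" using nth_root_exists[of 2 "c q1 - m"] by auto
  obtain g2 where g2: "g2\<^sup>2 = c q2 - m" using nth_root_exists[of 2 "c q2 - m"] by auto
  obtain g3 where g3: "g3\<^sup>2 = c q3 - m" using nth_root_exists[of 2 "c q3 - m"] by auto
  obtain w where w: "w\<^sup>2 = (- 2 :: 'k)" using nth_root_exists[of 2 "- 2 :: 'k"] by auto
  have cm: "c q1 = m + g1\<^sup>2" "c q2 = m + g2\<^sup>2" "c q3 = m + g3\<^sup>2" by (simp_all add: g1 g2 g3)
  have K: "g1\<^sup>2 + g2\<^sup>2 + g3\<^sup>2 = 0"
    unfolding g1 g2 g3 m_def by (simp add: field_simps)
  define r0 where "r0 i = (if i = 1 then - g1\<^sup>2 + w * g2 * g3 else if i = 2 then - g1\<^sup>2 - w * g2 * g3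
    else if i = 3 then - g2\<^sup>2 + w * g1 * g3 else if i = 4 then - g2\<^sup>2 - w * g1 * g3
    else if i = 5 then - g3\<^sup>2 + w * g1 * g2 else - g3\<^sup>2 - w * g1 * g2)" for i :: nat
  define r where "r = (\<lambda>i. m + r0 i)"
  have K': "g2\<^sup>2 + g1\<^sup>2 + g3\<^sup>2 = 0" "g3\<^sup>2 + g1\<^sup>2 + g2\<^sup>2 = 0" using K by (simp_all add: ac_simps)
  have roots: "crit_quadratic (c q1) (c q2) (c q3) = [:- r 1, 1:] * [:- r 2, 1:]"
    "crit_quadratic (c q2) (c q1) (c q3) = [:- r 3, 1:] * [:- r 4, 1:]"
    "crit_quadratic (c q3) (c q1) (c q2) = [:- r 5, 1:] * [:- r 6, 1:]"
    using crit_quadratic_roots[OF cm(1,2,3) K w] crit_quadratic_roots[OF cm(2,1,3) K'(1) w]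
      crit_quadratic_roots[OF cm(3,1,2) K'(2) w]
    by (simp_all add: r_def r0_def)
  have ids: "{1..6} = {1, 2, 3, 4, 5, 6 :: nat}" by auto
  have sextic: "sextic 1 r = crit_sextic (c q1) (c q2) (c q3)"
    unfolding crit_sextic_def roots sextic_def ids by (simp add: mult.assoc del: mult_pCons_left mult_pCons_right)
  \<comment> \<open>All roots of the quadratic factor for q lie over q; this separates the roots of
    different factors, and \<open>distinct_pair\<close> those of the same factor.\<close>
  have Ur: "poly U x = q" if "q \<in> Q" "[:d q * e q, - (d q + e q), 1:] = [:- x, 1:] * t" for q x t
    using arg_cong[OF U'[OF that(1)], of "\<lambda>p. poly p x"] unfolding that(2) by simp
  have Uv: "poly U (r 1) = q1" "poly U (r 2) = q1" "poly U (r 3) = q2" "poly U (r 4) = q2"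
    "poly U (r 5) = q3" "poly U (r 6) = q3"
    using Ur[OF in_Q(1), unfolded quad roots] Ur[OF in_Q(2), unfolded quad roots]
      Ur[OF in_Q(3), unfolded quad roots] by (metis mult.commute)+
  have distinct_pair: "x \<noteq> y" if "q \<in> Q" "[:d q * e q, - (d q + e q), 1:] = [:- x, 1:] * [:- y, 1:]" for q x y
  proof
    assume "x = y"
    then have "d q * e q = y * y" "- d q - e q = - (2 * y)" using that(2) by auto
    then have "(d q - e q)\<^sup>2 = 0" by algebra
    then show False using cde[OF that(1)] by simp
  qed
  have pairs: "r 1 \<noteq> r 2" "r 3 \<noteq> r 4" "r 5 \<noteq> r 6"
    using distinct_pair[OF in_Q(1)] distinct_pair[OF in_Q(2)] distinct_pair[OF in_Q(3)]
    unfolding quad roots by blast+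
  have cross: "r i \<noteq> r j" if "poly U (r i) \<noteq> poly U (r j)" for i j using that by auto
  have inj: "inj_on r {1..6}"
    unfolding ids using pairs q(2-4) cross[of 1 3] cross[of 1 4] cross[of 1 5] cross[of 1 6]
      cross[of 2 3] cross[of 2 4] cross[of 2 5] cross[of 2 6] cross[of 3 5] cross[of 3 6]
      cross[of 4 5] cross[of 4 6]
    unfolding Uv by (simp add: inj_on_insert) 
  have model: "sextic_model C 1 r"
    unfolding sextic_model_def sextic using inj iso' by simp
  define A where "A = (g1\<^sup>2 * g2\<^sup>2 + g1\<^sup>2 * g3\<^sup>2 + g2\<^sup>2 * g3\<^sup>2) ^ 3"
  define B where "B = (g1 * g2 * g3) ^ 4"
  have r0: "r0 1 = - g1\<^sup>2 + w * g2 * g3" "r0 2 = - g1\<^sup>2 - w * g2 * g3" "r0 3 = - g2\<^sup>2 + w * g1 * g3"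
      "r0 4 = - g2\<^sup>2 - w * g1 * g3" "r0 5 = - g3\<^sup>2 + w * g1 * g2" "r0 6 = - g3\<^sup>2 - w * g1 * g2"
    by (simp_all add: r0_def)
  have tr: "orbit_sum r S = orbit_sum r0 S" for S unfolding r_def by (rule orbit_sum_translate)
  have J: "J2 1 r = - 800 * A - 5880 * B" "J4 1 r = 64 * A\<^sup>2 + 242784 * A * B + 2055780 * B\<^sup>2"
    "J6 1 r = - 16896 * A ^ 3 - 61576576 * A\<^sup>2 * B - 843047136 * A * B\<^sup>2 - 3048065640 * B ^ 3"
    "J10 1 r = - 512 * B * (4 * A + 27 * B) ^ 4"
    using model_invariants[OF K w r0 A_def B_def]
    by (simp_all add: J2_def J4_def J6_def J10_edges tr)
  show ?thesis
  proof (cases "J2 1 r = 0")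
    case True
    then have "- 40 * (20 * A + 147 * B) = 0" unfolding J by algebra
    then have "20 * A + 147 * B = 0" by (metis mult_eq_0_iff neg_equal_0_iff_equal zero_neq_numeral)
    moreover have "B = (g1\<^sup>2 * g2\<^sup>2 * g3\<^sup>2)\<^sup>2" by (simp add: B_def power_mult_distrib flip: power_mult)
    ultimately have J0: "20 * (g1\<^sup>2 * g2\<^sup>2 + g1\<^sup>2 * g3\<^sup>2 + g2\<^sup>2 * g3\<^sup>2) ^ 3 + 147 * (g1\<^sup>2 * g2\<^sup>2 * g3\<^sup>2)\<^sup>2 = 0"
      unfolding A_def by simp
    have mu: "180 * ((b / 2)\<^sup>2 - b / 2 + 1) ^ 3 = 49 * ((b / 2 + 1) * (b / 2 - 2) * (2 * (b / 2) - 1))\<^sup>2"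
      by (rule critical_ratio_equation[OF assms(4-9) refl])
    have dif: "g1\<^sup>2 - g2\<^sup>2 = c q1 - c q2" "g1\<^sup>2 - g3\<^sup>2 = c q1 - c q3" "g2\<^sup>2 - g1\<^sup>2 = c q2 - c q1"
      "g2\<^sup>2 - g3\<^sup>2 = c q2 - c q3" "g3\<^sup>2 - g1\<^sup>2 = c q3 - c q1" "g3\<^sup>2 - g2\<^sup>2 = c q3 - c q2"
      by (simp_all add: cm)
    have comm: "crit_sextic (c q1) (c q2) (c q3) = crit_sextic (c q2) (c q3) (c q1)"
      "crit_sextic (c q1) (c q2) (c q3) = crit_sextic (c q1) (c q3) (c q2)"
      "crit_sextic (c q1) (c q2) (c q3) = crit_sextic (c q3) (c q2) (c q1)"
      "crit_sextic (c q1) (c q2) (c q3) = crit_sextic (c q3) (c q1) (c q2)"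
      "crit_sextic (c q1) (c q2) (c q3) = crit_sextic (c q2) (c q1) (c q3)"
      by (metis crit_sextic_commute)+
    \<comment> \<open>Each of the six possible similarities refers to one ordering of the critical
      points, and the sextic does not depend on the ordering.\<close>
    have "isomorphic_to_hyperelliptic C (crit_sextic 1 (b / 2) 0)"
      using critical_points_similar[OF K J0 mu] unfolding dif
    proof (elim disjE)
      show ?thesis if "c q3 - c q1 = b / 2 * (c q2 - c q1)"
        using isomorphic_if_similar[OF iso'[unfolded comm(1)] _ that] ne by metis
      show ?thesis if "c q3 - c q2 = b / 2 * (c q1 - c q2)"
        using isomorphic_if_similar[OF iso'[unfolded comm(2)] _ that] ne by metis
      show ?thesis if "c q2 - c q1 = b / 2 * (c q3 - c q1)"
        using isomorphic_if_similar[OF iso'[unfolded comm(3)] _ that] ne by metis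
      show ?thesis if "c q2 - c q3 = b / 2 * (c q1 - c q3)"
        using isomorphic_if_similar[OF iso' _ that] ne by metis
      show ?thesis if "c q1 - c q2 = b / 2 * (c q3 - c q2)"
        using isomorphic_if_similar[OF iso'[unfolded comm(4)] _ that] ne by metis
      show ?thesis if "c q1 - c q3 = b / 2 * (c q2 - c q3)"
        using isomorphic_if_similar[OF iso'[unfolded comm(5)] _ that] ne by metis
    qed
    then have ?first unfolding crit_sextic_target .
    then show ?thesis by (rule disjI1)
  next
    case False
    have "J2 a r' \<noteq> 0 \<and> relation12 (i1 a r') (i2 a r') = 0 \<and> relation13 (i1 a r') (i3 a r') = 0"
      if model': "sextic_model C a r'" for a r'
    proof -
      obtain k where k: "k \<noteq> 0" "J2 a r' = k * J2 1 r" "J4 a r' = k ^ 2 * J4 1 r"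
        "J6 a r' = k ^ 3 * J6 1 r" "J10 a r' = k ^ 5 * J10 1 r"
        by (rule invariants_covariant[OF model model'])
      have i: "i1 a r' = 144 * J4 1 r / J2 1 r ^ 2" "i3 a r' = 486 * J10 1 r / J2 1 r ^ 5"
        using k(1) by (simp_all add: i1_def i3_def k(2-5) power_mult_distrib)
      define N where "N = J2 1 r * J4 1 r - 3 * J6 1 r"
      have "J2 a r' * J4 a r' - 3 * J6 a r' = k ^ 3 * N"
        by (simp add: N_def k(2-4) algebra_simps eval_nat_numeral)
      then have "i2 a r' = - 1728 * N / J2 1 r ^ 3"
        unfolding i2_def using k(1) by (simp add: k(2) power_mult_distrib)
      then have i': "i2 a r' = - 1728 * (J2 1 r * J4 1 r - 3 * J6 1 r) / J2 1 r ^ 3" unfolding N_def .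
      note eqs = model_equations[OF J False i(1) i' i(2)]
      have "J2 a r' \<noteq> 0" using k False by simp
      then show ?thesis using eqs by blast
    qed
    then show ?thesis using model unfolding relation12_def relation13_def by blast
  qed
qed

end
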